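(* Let $G$ be a group and $n\geq 2$ a natural number. The group $\widetilde{\mathcal K}(G,n)$ does not depend (up to isomorphism) upon the choice of a presentation $G\cong F/N$ with $F$ free. There exists a central short exact sequence $$0\to H_2(G,\mathbb Z)\to\widetilde{\mathcal K}(G,n)\to\mathcal K(G,n)\to 1,$$ i.e. a short exact sequence in which the image of $H_2(G,\mathbb Z)$ lies in the centre of $\widetilde{\mathcal K}(G,n)$. For $n\geq 3$ the (image of the) group $H_2(G,\mathbb Z)$ lies inside the commutator subgroup of $\widetilde{\mathcal K}(G,n)$.
   Context: For a group $G$ and $n\geq 2$, let $G^{\rm ab}=G/[G,G]$ and let $\mathcal K(G,n)$ be the kernel of the homomorphism $G^n\to G^{\rm ab}$, $(g_1,\dots,g_n)\mapsto\overline{g_1\cdots g_n}$. Choose a presentation $G\cong F/N$ with $F$ a free group and $N$ a normal subgroup of $F$. Then $\mathcal K(N,n)\subseteq\mathcal K(F,n)\subseteq F^n$. Let $\langle\langle\mathcal K(N,n)\rangle\rangle$ be the normal closure of $\mathcal K(N,n)$ in $F^n$ (it is contained in $\mathcal K(F,n)$), and define $\widetilde{\mathcal K}(G,n):=\mathcal K(F,n)/\langle\langle\mathcal K(N,n)\rangle\rangle$. The homology group $H_2(G,\mathbb Z)$ is taken with trivial coefficients. *)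

theory Defs
  imports "HOL-Algebra.Algebra" "HOL-Algebra.Free_Abelian_Groups"
begin

section \<open>Free groups and presentations\<close>

text \<open>A letter \<open>(True, x)\<close> stands for \<open>x\<close>, and \<open>(False, x)\<close> for its inverse.\<close>

definition reduced_word :: "(bool \<times> 'a) list \<Rightarrow> bool" where
  "reduced_word w \<longleftrightarrow> successively (\<lambda>p q. \<not> (snd p = snd q \<and> fst p \<noteq> fst q)) w"

definition reduced_words :: "'a set \<Rightarrow> (bool \<times> 'a) list set" where
  "reduced_words S = {w. set w \<subseteq> UNIV \<times> S \<and> reduced_word w}"

definition word_value ::
  "('b, 'm) monoid_scheme \<Rightarrow> ('a \<Rightarrow> 'b) \<Rightarrow> (bool \<times> 'a) list \<Rightarrow> 'b" where
  "word_value H f w =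
     foldr (\<lambda>(b, x) y. (if b then f x else inv\<^bsub>H\<^esub> f x) \<otimes>\<^bsub>H\<^esub> y) w \<one>\<^bsub>H\<^esub>"

definition free_basis :: "('a, 'm) monoid_scheme \<Rightarrow> 'a set \<Rightarrow> bool" where
  "free_basis F S \<longleftrightarrow>
     S \<subseteq> carrier F \<and> bij_betw (word_value F (\<lambda>x. x)) (reduced_words S) (carrier F)"

definition free_group :: "('a, 'm) monoid_scheme \<Rightarrow> bool" where
  "free_group F \<longleftrightarrow> group F \<and> (\<exists>S. free_basis F S)"

definition presentation ::
  "('a, 'm) monoid_scheme \<Rightarrow> ('b, 'k) monoid_scheme \<Rightarrow> 'b set \<Rightarrow> bool" where
  "presentation G F N \<longleftrightarrow> free_group F \<and> N \<lhd> F \<and> F Mod N \<cong> G"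


section \<open>The groups \<open>\<K>(G,n)\<close> and \<open>\<K>\<close>-tilde\<close>

abbreviation power_group :: "('a, 'm) monoid_scheme \<Rightarrow> nat \<Rightarrow> (nat \<Rightarrow> 'a) monoid" where
  "power_group G n \<equiv> product_group {..<n} (\<lambda>_. G)"

definition abelianization :: "('a, 'm) monoid_scheme \<Rightarrow> 'a set monoid" where
  "abelianization G = G Mod derived G (carrier G)"

definition ab_product :: "('a, 'm) monoid_scheme \<Rightarrow> nat \<Rightarrow> (nat \<Rightarrow> 'a) \<Rightarrow> 'a set" where
  "ab_product G n g =
     derived G (carrier G) #>\<^bsub>G\<^esub> foldr (\<otimes>\<^bsub>G\<^esub>) (map g [0..<n]) \<one>\<^bsub>G\<^esub>"

definition K_set :: "('a, 'm) monoid_scheme \<Rightarrow> nat \<Rightarrow> (nat \<Rightarrow> 'a) set" where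
  "K_set G n = kernel (power_group G n) (abelianization G) (ab_product G n)"

definition K_group :: "('a, 'm) monoid_scheme \<Rightarrow> nat \<Rightarrow> (nat \<Rightarrow> 'a) monoid" where
  "K_group G n = (power_group G n)\<lparr>carrier := K_set G n\<rparr>"

definition normal_closure :: "('a, 'm) monoid_scheme \<Rightarrow> 'a set \<Rightarrow> 'a set" where
  "normal_closure G A = \<Inter>{H. H \<lhd> G \<and> A \<subseteq> H}"

text \<open>The normal closure is taken in \<open>F\<^sup>n\<close>, and the commutator subgroup entering
  \<open>\<K>(N,n)\<close> is that of \<open>N\<close> itself.\<close>

definition K_tilde :: "('a, 'm) monoid_scheme \<Rightarrow> 'a set \<Rightarrow> nat \<Rightarrow> (nat \<Rightarrow> 'a) set monoid" where
  "K_tilde F N n =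
     K_group F n Mod normal_closure (power_group F n) (K_set (F\<lparr>carrier := N\<rparr>) n)"


section \<open>Group homology with trivial integer coefficients\<close>

text \<open>The inhomogeneous bar complex tensored with the trivial module: in degree \<open>p\<close> it is free
  abelian on the \<open>p\<close>-tuples \<open>[g\<^sub>1|\<dots>|g\<^sub>p]\<close>, with
  \<open>\<partial>[g\<^sub>1|\<dots>|g\<^sub>p] = [g\<^sub>2|\<dots>|g\<^sub>p] + (\<Sum>i=1..p-1. (-1)^i [\<dots>|g\<^sub>i g\<^sub>i\<^sub>+\<^sub>1|\<dots>]) + (-1)^p [g\<^sub>1|\<dots>|g\<^sub>p\<^sub>-\<^sub>1]\<close>.\<close>

definition bar_chain_group :: "('a, 'm) monoid_scheme \<Rightarrow> nat \<Rightarrow> ('a list \<Rightarrow>\<^sub>0 int) monoid" where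
  "bar_chain_group G p = free_Abelian_group {xs. length xs = p \<and> set xs \<subseteq> carrier G}"

definition bar_face :: "('a, 'm) monoid_scheme \<Rightarrow> nat \<Rightarrow> nat \<Rightarrow> 'a list \<Rightarrow> 'a list" where
  "bar_face G p i xs =
     (if i = 0 then tl xs
      else if i = p then butlast xs
      else take (i - 1) xs @ (xs ! (i - 1) \<otimes>\<^bsub>G\<^esub> xs ! i) # drop (i + 1) xs)"

definition bar_boundary ::
  "('a, 'm) monoid_scheme \<Rightarrow> nat \<Rightarrow> ('a list \<Rightarrow>\<^sub>0 int) \<Rightarrow> ('a list \<Rightarrow>\<^sub>0 int)" where
  "bar_boundary G p c =
     (if p = 0 then 0
      else frag_extend
        (\<lambda>xs. \<Sum>i\<le>p. frag_cmul ((-1) ^ i) (frag_of (bar_face G p i xs))) c)"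

definition bar_cycles :: "('a, 'm) monoid_scheme \<Rightarrow> nat \<Rightarrow> ('a list \<Rightarrow>\<^sub>0 int) set" where
  "bar_cycles G p = kernel (bar_chain_group G p) (bar_chain_group G (p - 1)) (bar_boundary G p)"

definition bar_boundaries :: "('a, 'm) monoid_scheme \<Rightarrow> nat \<Rightarrow> ('a list \<Rightarrow>\<^sub>0 int) set" where
  "bar_boundaries G p = bar_boundary G (Suc p) ` carrier (bar_chain_group G (Suc p))"

definition group_homology ::
  "('a, 'm) monoid_scheme \<Rightarrow> nat \<Rightarrow> ('a list \<Rightarrow>\<^sub>0 int) set monoid" where
  "group_homology G p = (bar_chain_group G p)\<lparr>carrier := bar_cycles G p\<rparr> Mod bar_boundaries G p"

lemma bar_boundary_1: "bar_boundary G (Suc 0) (frag_of [g]) = 0"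
  by (simp add: bar_boundary_def bar_face_def frag_extend_of frag_cmul_minus_one)

lemma bar_boundary_2:
  "bar_boundary G 2 (frag_of [g, h]) = frag_of [h] - frag_of [g \<otimes>\<^bsub>G\<^esub> h] + frag_of [g]"
  by (simp add: bar_boundary_def bar_face_def numeral_2_eq_2 frag_extend_of)

lemma bar_boundary_3:
  "bar_boundary G 3 (frag_of [g, h, k]) =
     frag_of [h, k] - frag_of [g \<otimes>\<^bsub>G\<^esub> h, k] + frag_of [g, h \<otimes>\<^bsub>G\<^esub> k] - frag_of [g, h]"
  by (simp add: bar_boundary_def bar_face_def numeral_3_eq_3 frag_extend_of)


section \<open>Central extensions\<close>

definition central_short_exact_sequence ::
  "('a, 'k) monoid_scheme \<Rightarrow> ('b, 'l) monoid_scheme \<Rightarrow> ('c, 'm) monoid_scheme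
     \<Rightarrow> ('a \<Rightarrow> 'b) \<Rightarrow> ('b \<Rightarrow> 'c) \<Rightarrow> bool" where
  "central_short_exact_sequence A E Q \<iota> \<pi> \<longleftrightarrow>
     group A \<and> group E \<and> group Q \<and> \<iota> \<in> mon A E \<and> \<pi> \<in> epi E Q \<and>
     \<iota> ` carrier A = kernel E Q \<pi> \<and>
     (\<forall>a\<in>carrier A. \<forall>x\<in>carrier E. \<iota> a \<otimes>\<^bsub>E\<^esub> x = x \<otimes>\<^bsub>E\<^esub> \<iota> a)"


section \<open>The universal property, and existence of presentations\<close>

primrec cancel_cons :: "bool \<times> 'a \<Rightarrow> (bool \<times> 'a) list \<Rightarrow> (bool \<times> 'a) list" where
  "cancel_cons p [] = [p]"
| "cancel_cons p (q # w) = (if snd p = snd q \<and> fst p \<noteq> fst q then w else p # q # w)"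

definition reduce :: "(bool \<times> 'a) list \<Rightarrow> (bool \<times> 'a) list" where
  "reduce w = foldr cancel_cons w []"

lemma reduced_word_Nil [simp]: "reduced_word []"
  by (simp add: reduced_word_def)

lemma reduced_word_ConsD: "reduced_word (p # w) \<Longrightarrow> reduced_word w"
  by (cases w) (auto simp: reduced_word_def)

lemma reduced_cancel_cons: "reduced_word w \<Longrightarrow> reduced_word (cancel_cons p w)"
proof (cases w)
  case (Cons q v)
  assume "reduced_word w"
  then show ?thesis using Cons reduced_word_ConsD[of q v] by (auto simp: reduced_word_def)
qed (simp add: reduced_word_def)

lemma cancel_cons_reduced: "reduced_word (p # w) \<Longrightarrow> cancel_cons p w = p # w"
  by (cases w) (auto simp: reduced_word_def)

lemma set_cancel_cons: "set (cancel_cons p w) \<subseteq> insert p (set w)"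
  by (cases w) auto

lemma reduced_foldr: "reduced_word v \<Longrightarrow> reduced_word (foldr cancel_cons w v)"
  by (induction w) (auto intro: reduced_cancel_cons)

lemma set_foldr_cancel_cons: "set (foldr cancel_cons w v) \<subseteq> set w \<union> set v"
proof (induction w)
  case (Cons p w)
  then show ?case using set_cancel_cons[of p "foldr cancel_cons w v"] by auto
qed simp

lemma foldr_cancel_reduced: "reduced_word w \<Longrightarrow> foldr cancel_cons w [] = w"
proof (induction w)
  case (Cons p w)
  then show ?case using reduced_word_ConsD[of p w] cancel_cons_reduced[of p w] by simp
qed simp

lemma cancel_cons_inverse:
  assumes "reduced_word w" "snd p = snd q" "fst p \<noteq> fst q"
  shows "cancel_cons p (cancel_cons q w) = w"
proof (cases w)
  case Nil
  then show ?thesis using assms by simp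
next
  case (Cons r v)
  show ?thesis
  proof (cases "snd q = snd r \<and> fst q \<noteq> fst r")
    case True
    then have "p = r" using assms by (auto simp: prod_eq_iff)
    then show ?thesis using True Cons assms(1) cancel_cons_reduced[of r v] by simp
  next
    case False
    then show ?thesis using Cons assms by auto
  qed
qed

lemma foldr_cancel_cons:
  assumes "reduced_word v"
  shows "foldr cancel_cons (cancel_cons p w) v = cancel_cons p (foldr cancel_cons w v)"
proof (cases w)
  case (Cons q u)
  then show ?thesis
    using cancel_cons_inverse[OF reduced_foldr[OF assms], of p q u] by auto
qed simp

lemma foldr_cancel_foldr:
  assumes "reduced_word v"
  shows "foldr cancel_cons (foldr cancel_cons w u) v
         = foldr cancel_cons w (foldr cancel_cons u v)"
  by (induction w) (simp_all add: foldr_cancel_cons[OF assms])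

lemma word_value_Nil [simp]: "word_value H f [] = \<one>\<^bsub>H\<^esub>"
  by (simp add: word_value_def)

lemma word_value_Cons:
  "word_value H f (p # w) =
     (if fst p then f (snd p) else inv\<^bsub>H\<^esub> f (snd p)) \<otimes>\<^bsub>H\<^esub> word_value H f w"
  by (simp add: word_value_def case_prod_beta)

context group
begin

lemma word_value_closed:
  assumes "f \<in> S \<rightarrow> carrier G" "set w \<subseteq> UNIV \<times> S"
  shows "word_value G f w \<in> carrier G"
  using assms(2)
proof (induction w)
  case (Cons p w)
  then have "f (snd p) \<in> carrier G" using assms(1) by auto
  then show ?case using Cons by (simp add: word_value_Cons)
qed simp

lemma word_value_append:
  assumes "f \<in> S \<rightarrow> carrier G" "set v \<subseteq> UNIV \<times> S" "set w \<subseteq> UNIV \<times> S"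
  shows "word_value G f (v @ w) = word_value G f v \<otimes> word_value G f w"
  using assms(2)
proof (induction v)
  case Nil
  then show ?case using word_value_closed[OF assms(1,3)] by simp
next
  case (Cons p v)
  then have "f (snd p) \<in> carrier G" using assms(1) by auto
  then show ?case
    using Cons word_value_closed[OF assms(1,3)] word_value_closed[OF assms(1), of v]
    by (simp add: word_value_Cons m_assoc)
qed

lemma word_value_cancel_cons:
  assumes "f \<in> S \<rightarrow> carrier G" "set (p # w) \<subseteq> UNIV \<times> S"
  shows "word_value G f (cancel_cons p w) = word_value G f (p # w)"
proof (cases w)
  case (Cons q v)
  have c: "f (snd p) \<in> carrier G" "word_value G f v \<in> carrier G"
    using assms Cons word_value_closed[OF assms(1), of v] by auto
  show ?thesis
  proof (cases "snd p = snd q \<and> fst p \<noteq> fst q")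
    case True
    then show ?thesis using c Cons
      by (auto simp: word_value_Cons m_assoc[symmetric])
  qed (use Cons in auto)
qed simp

lemma word_value_foldr_cancel:
  assumes "f \<in> S \<rightarrow> carrier G" "set w \<subseteq> UNIV \<times> S" "set v \<subseteq> UNIV \<times> S"
  shows "word_value G f (foldr cancel_cons w v) = word_value G f (w @ v)"
  using assms(2)
proof (induction w)
  case (Cons p w)
  have "set (p # foldr cancel_cons w v) \<subseteq> UNIV \<times> S"
    using set_foldr_cancel_cons[of w v] Cons(2) assms(3) by auto
  then have "word_value G f (foldr cancel_cons (p # w) v)
      = word_value G f (p # foldr cancel_cons w v)"
    using word_value_cancel_cons[OF assms(1), of p "foldr cancel_cons w v"] by simp
  also have "\<dots> = word_value G f (p # w @ v)"
    using Cons by (simp add: word_value_Cons)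
  finally show ?case by simp
qed simp

end

lemma reduce_in_reduced_words: "set w \<subseteq> UNIV \<times> S \<Longrightarrow> reduce w \<in> reduced_words S"
  using set_foldr_cancel_cons[of w "[]"] reduced_foldr[of "[]" w]
  by (auto simp: reduce_def reduced_words_def)

lemma free_basis_universal:
  assumes "group F" "free_basis F S" "group H" "f \<in> S \<rightarrow> carrier H"
  shows "\<exists>\<phi>\<in>hom F H. \<forall>x\<in>S. \<phi> x = f x"
    and "\<lbrakk>\<phi> \<in> hom F H; \<psi> \<in> hom F H; \<forall>x\<in>S. \<phi> x = \<psi> x; y \<in> carrier F\<rbrakk> \<Longrightarrow> \<phi> y = \<psi> y"
proof -
  interpret F: group F by fact
  interpret H: group H by fact
  let ?v = "word_value F (\<lambda>x. x)"
  have S: "(\<lambda>x. x) \<in> S \<rightarrow> carrier F" and Sc: "S \<subseteq> carrier F"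
    and bij: "bij_betw ?v (reduced_words S) (carrier F)"
    using assms(2) by (auto simp: free_basis_def)
  have onto: "\<exists>w\<in>reduced_words S. y = ?v w" if "y \<in> carrier F" for y
    using bij that by (auto simp: bij_betw_def)
  define \<phi> where "\<phi> y = word_value H f (the_inv_into (reduced_words S) ?v y)" for y
  have val: "\<phi> (?v w) = word_value H f w" if w: "set w \<subseteq> UNIV \<times> S" for w
  proof -
    have "?v w = ?v (reduce w)"
      using F.word_value_foldr_cancel[OF S w, of "[]"] by (simp add: reduce_def)
    then have "the_inv_into (reduced_words S) ?v (?v w) = reduce w"
      using bij reduce_in_reduced_words[OF w] by (simp add: bij_betw_def the_inv_into_f_f)
    then show ?thesis
      using H.word_value_foldr_cancel[OF assms(4) w, of "[]"] by (simp add: \<phi>_def reduce_def)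
  qed
  have "\<phi> \<in> hom F H"
  proof (rule homI)
    fix x assume "x \<in> carrier F"
    then show "\<phi> x \<in> carrier H"
      using onto[of x] val H.word_value_closed[OF assms(4)] by (auto simp: reduced_words_def)
  next
    fix x y assume "x \<in> carrier F" "y \<in> carrier F"
    then obtain v w where v: "set v \<subseteq> UNIV \<times> S" "x = ?v v" and w: "set w \<subseteq> UNIV \<times> S" "y = ?v w"
      using onto[of x] onto[of y] by (auto simp: reduced_words_def)
    have "x \<otimes>\<^bsub>F\<^esub> y = ?v (v @ w)"
      using F.word_value_append[OF S v(1) w(1)] v w by simp
    then show "\<phi> (x \<otimes>\<^bsub>F\<^esub> y) = \<phi> x \<otimes>\<^bsub>H\<^esub> \<phi> y"
      using val[of "v @ w"] val[OF v(1)] val[OF w(1)] v w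
        H.word_value_append[OF assms(4) v(1) w(1)] by simp
  qed
  moreover have "\<phi> x = f x" if "x \<in> S" for x
  proof -
    have "x \<in> carrier F" "f x \<in> carrier H" using that Sc assms(4) by auto
    then show ?thesis using val[of "[(True, x)]"] that by (simp add: word_value_Cons)
  qed
  ultimately show "\<exists>\<phi>\<in>hom F H. \<forall>x\<in>S. \<phi> x = f x" by blast
  show "\<phi> y = \<psi> y"
    if h: "\<phi> \<in> hom F H" "\<psi> \<in> hom F H" and e: "\<forall>x\<in>S. \<phi> x = \<psi> x" and y: "y \<in> carrier F" for \<phi> \<psi> y
  proof -
    interpret p: group_hom F H \<phi> by unfold_locales fact
    interpret q: group_hom F H \<psi> by unfold_locales fact
    have "\<phi> (?v w) = \<psi> (?v w)" if "set w \<subseteq> UNIV \<times> S" for w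
      using that
    proof (induction w)
      case (Cons r w)
      then have "snd r \<in> carrier F" "?v w \<in> carrier F" "\<phi> (snd r) = \<psi> (snd r)"
        using Sc e F.word_value_closed[OF S, of w] by auto
      then show ?case using Cons by (simp add: word_value_Cons)
    qed simp
    then show ?thesis using onto[OF y] by (auto simp: reduced_words_def)
  qed
qed

definition word_group :: "'a set \<Rightarrow> (bool \<times> 'a) list monoid" where
  "word_group S = \<lparr>carrier = reduced_words S, monoid.mult = foldr cancel_cons, one = []\<rparr>"

lemma word_group_group: "group (word_group S)"
proof (rule groupI)
  fix x y assume "x \<in> carrier (word_group S)" "y \<in> carrier (word_group S)"
  then show "x \<otimes>\<^bsub>word_group S\<^esub> y \<in> carrier (word_group S)"
    using set_foldr_cancel_cons[of x y] reduced_foldr[of y x]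
    by (auto simp: word_group_def reduced_words_def)
next
  fix x assume "x \<in> carrier (word_group S)"
  then have x: "set x \<subseteq> UNIV \<times> S" by (simp add: word_group_def reduced_words_def)
  have "\<exists>y. set y \<subseteq> UNIV \<times> S \<and> reduced_word y \<and> foldr cancel_cons y (foldr cancel_cons x []) = []"
    using x
  proof (induction x)
    case Nil
    then show ?case by (intro exI[of _ "[]"]) simp
  next
    case (Cons p x)
    then obtain y where y: "set y \<subseteq> UNIV \<times> S" "reduced_word y"
      "foldr cancel_cons y (foldr cancel_cons x []) = []" by auto
    let ?p = "(\<not> fst p, snd p)"
    let ?z = "foldr cancel_cons y [?p]"
    have r: "reduced_word [?p]" by (simp add: reduced_word_def)
    have "foldr cancel_cons ?z (foldr cancel_cons (p # x) [])
        = foldr cancel_cons y (cancel_cons ?p (cancel_cons p (foldr cancel_cons x [])))"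
      using foldr_cancel_foldr[of "foldr cancel_cons (p # x) []" y "[?p]"]
        reduced_foldr[of "[]" "p # x"] by simp
    also have "\<dots> = []"
      using cancel_cons_inverse[of "foldr cancel_cons x []" ?p p] reduced_foldr[of "[]" x] y
      by simp
    finally show ?case
      using reduced_foldr[OF r, of y] set_foldr_cancel_cons[of y "[?p]"] y Cons(2)
      by (intro exI[of _ ?z]) auto
  qed
  then show "\<exists>y\<in>carrier (word_group S). y \<otimes>\<^bsub>word_group S\<^esub> x = \<one>\<^bsub>word_group S\<^esub>"
    using \<open>x \<in> carrier (word_group S)\<close> foldr_cancel_reduced[of x]
    by (auto simp: word_group_def reduced_words_def)
qed (auto simp: word_group_def reduced_words_def foldr_cancel_foldr)

lemma word_group_inv_letter:
  assumes "x \<in> S"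
  shows "inv\<^bsub>word_group S\<^esub> [(True, x)] = [(False, x)]"
  by (rule group.inv_equality[OF word_group_group])
    (use assms in \<open>auto simp: word_group_def reduced_words_def reduced_word_def\<close>)

lemma free_basis_word_group: "free_basis (word_group S) ((\<lambda>x. [(True, x)]) ` S)"
proof -
  let ?e = "\<lambda>x. [(True, x)]"
  let ?F = "word_group S"
  let ?m = "map (\<lambda>(b, y). (b, snd (hd y)))"
  have val: "word_value ?F (\<lambda>x. x) w = ?m w" if "w \<in> reduced_words (?e ` S)" for w
    using that
  proof (induction w)
    case Nil
    then show ?case by (simp add: word_group_def)
  next
    case (Cons p w)
    then obtain b x where p: "p = (b, ?e x)" "x \<in> S"
      by (cases p) (auto simp: reduced_words_def)
    have w: "w \<in> reduced_words (?e ` S)"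
      using Cons(2) by (auto simp: reduced_words_def dest: reduced_word_ConsD)
    have "word_value ?F (\<lambda>x. x) (p # w) = [(b, x)] \<otimes>\<^bsub>?F\<^esub> ?m w"
      using Cons(1)[OF w] p by (simp add: word_value_Cons word_group_inv_letter)
    also have "\<dots> = (b, x) # ?m w"
      using Cons(2) p
      by (cases w) (auto simp: word_group_def reduced_words_def reduced_word_def)
    finally show ?case using p by simp
  qed
  have "bij_betw ?m (reduced_words (?e ` S)) (reduced_words S)"
  proof (rule bij_betwI[where g = "map (\<lambda>(b, x). (b, ?e x))"])
    show "?m \<in> reduced_words (?e ` S) \<rightarrow> reduced_words S"
    proof
      fix w assume w: "w \<in> reduced_words (?e ` S)"
      then have e: "snd p = ?e (snd (hd (snd p)))" if "p \<in> set w" for p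
        using that by (auto simp: reduced_words_def)
      have "successively (\<lambda>p q. \<not> (snd (hd (snd p)) = snd (hd (snd q)) \<and> fst p \<noteq> fst q)) w"
      proof (rule successively_mono)
        show "successively (\<lambda>p q. \<not> (snd p = snd q \<and> fst p \<noteq> fst q)) w"
          using w by (simp add: reduced_words_def reduced_word_def)
      qed (use e in metis)
      then show "?m w \<in> reduced_words S"
        using w by (auto simp: reduced_words_def reduced_word_def successively_map case_prod_beta)
    qed
    show "map (\<lambda>(b, x). (b, ?e x)) \<in> reduced_words S \<rightarrow> reduced_words (?e ` S)"
      by (force simp: reduced_words_def reduced_word_def successively_map case_prod_beta)
    show "map (\<lambda>(b, x). (b, ?e x)) (?m w) = w" if "w \<in> reduced_words (?e ` S)" for w
      using that by (auto simp: reduced_words_def intro!: map_idI)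
    show "?m (map (\<lambda>(b, x). (b, ?e x)) w) = w" for w :: "(bool \<times> 'a) list"
      by (auto intro!: map_idI)
  qed
  then have "bij_betw (word_value ?F (\<lambda>x. x)) (reduced_words (?e ` S)) (reduced_words S)"
    using bij_betw_cong[of "reduced_words (?e ` S)" "word_value ?F (\<lambda>x. x)" ?m] val by blast
  then show ?thesis
    by (auto simp: free_basis_def word_group_def reduced_words_def reduced_word_def)
qed

lemma presentation_exists:
  assumes "group G"
  shows "\<exists>(F :: (bool \<times> 'a) list monoid) N. presentation (G :: ('a, 'm) monoid_scheme) F N"
proof -
  let ?F = "word_group (carrier G)"
  let ?S = "(\<lambda>x. [(True, x)]) ` carrier G"
  have "(\<lambda>w. snd (hd w)) \<in> ?S \<rightarrow> carrier G" by auto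
  from free_basis_universal(1)[OF word_group_group free_basis_word_group assms this]
  obtain \<phi> where \<phi>: "\<phi> \<in> hom ?F G" "\<And>x. x \<in> carrier G \<Longrightarrow> \<phi> [(True, x)] = x" by auto
  interpret group_hom ?F G \<phi>
    using \<phi> assms word_group_group by (simp add: group_hom_def group_hom_axioms_def)
  have "\<phi> ` carrier ?F = carrier G"
  proof
    show "carrier G \<subseteq> \<phi> ` carrier ?F"
    proof
      fix x assume x: "x \<in> carrier G"
      then have "[(True, x)] \<in> carrier ?F"
        by (simp add: word_group_def reduced_words_def reduced_word_def)
      then show "x \<in> \<phi> ` carrier ?F" using \<phi>(2)[OF x] by force
    qed
  qed auto
  then have "?F Mod kernel ?F G \<phi> \<cong> G" by (rule FactGroup_iso)
  then have "presentation G ?F (kernel ?F G \<phi>)"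
    using normal_kernel free_basis_word_group word_group_group
    by (auto simp: presentation_def free_group_def)
  then show ?thesis by blast
qed

end

theory Submission
  imports Defs
begin

text \<open>Let \<open>\<phi> : F \<rightarrow> G\<close> be onto with kernel \<open>N\<close>, and let \<open>M = [F, N]\<close>. Everything reduces to the
  group \<open>R = F/M\<close>, a central extension of \<open>G\<close> by \<open>N/M\<close>, through the identity
  \<open>\<langle>\<langle>\<K>(N,n)\<rangle>\<rangle> = {a \<in> N\<^sup>n. a\<^sub>1 \<cdots> a\<^sub>n \<in> M}\<close>
  (\<open>normal_closure_K_set\<close>). It holds because the commutator of \<open>(x, 1, \<dots>, 1)\<close> with
  \<open>(y, y\<^sup>-\<^sup>1, 1, \<dots>, 1) \<in> \<K>(N,n)\<close> is \<open>([x,y], 1, \<dots>, 1)\<close>, and because the elements of \<open>N\<close> are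
  central modulo \<open>M\<close>, so that the product of the components is multiplicative on \<open>N\<^sup>n\<close> modulo \<open>M\<close>.

  Two homomorphisms into a central extension which agree in the base agree on the derived subgroup
  (\<open>homs_agree_on_derived\<close>). Since \<open>\<K>(F,n)\<close> consists of the tuples with product in \<open>[F,F]\<close>, this
  gives the independence of the presentation: lifts \<open>\<alpha> : F \<rightarrow> F'\<close> and \<open>\<beta> : F' \<rightarrow> F\<close> of the identity of
  \<open>G\<close> exist by freeness, and their composites induce the identity on the two quotients
  (\<open>K_tilde_independent\<close>).

  The kernel of \<open>\<K>(F,n)/\<langle>\<langle>\<K>(N,n)\<rangle>\<rangle> \<rightarrow> \<K>(G,n)\<close> is represented by the tuples \<open>(c, 1, \<dots>, 1)\<close> with
  \<open>c \<in> N \<inter> [F,F]\<close>, hence is \<open>(N \<inter> [F,F])/[F,N]\<close>. It is central because \<open>[N,F] = M\<close>, and for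
  \<open>n \<ge> 3\<close> it consists of products of commutators because \<open>([x,y], 1, 1)\<close> is the commutator of
  \<open>(x, x\<^sup>-\<^sup>1, 1)\<close> and \<open>(y, 1, y\<^sup>-\<^sup>1)\<close>.

  It remains to identify this quotient with \<open>H\<^sub>2(G)\<close> computed from the bar complex, which is Hopf's
  formula (\<open>hopf_formula\<close>). The symbols \<open>[g|h]\<close> form a 2-cocycle with values in \<open>C\<^sub>2/B\<^sub>2\<close> and so
  define a central extension \<open>E\<close> of \<open>G\<close>. Freeness of \<open>F\<close> gives a homomorphism \<open>R \<rightarrow> E\<close> over \<open>G\<close>, and
  freeness of the chain groups gives one \<open>E \<rightarrow> R\<close>. By the agreement principle they restrict to
  inverse isomorphisms between \<open>[R,R]\<close> and \<open>[E,E]\<close>, hence between their intersections with the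
  kernels of the maps to \<open>G\<close>. In \<open>R\<close> the intersection is \<open>(N \<inter> [F,F])/M\<close>; in \<open>E\<close> it is
  \<open>Z\<^sub>2/B\<^sub>2 = H\<^sub>2(G)\<close> (\<open>bar_embedding_derived_iff\<close>), because the abelianization of \<open>E\<close> is \<open>C\<^sub>1\<close>
  and the embedding of \<open>C\<^sub>2/B\<^sub>2\<close> becomes the boundary map there.\<close>

section \<open>Homomorphisms, kernels and commutators\<close>

lemma group_homI: "\<lbrakk>group G; group H; h \<in> hom G H\<rbrakk> \<Longrightarrow> group_hom G H h"
  by (simp add: group_hom_def group_hom_axioms_def)

lemma (in normal) group_hom_coset: "group_hom G (G Mod H) (\<lambda>x. H #> x)"
  by (rule group_homI[OF is_group factorgroup_is_group r_coset_hom_Mod])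

lemma (in normal) coset_eq_one_iff: "x \<in> carrier G \<Longrightarrow> H #> x = \<one>\<^bsub>G Mod H\<^esub> \<longleftrightarrow> x \<in> H"
  using coset_join1[OF _ _ subgroup_axioms] coset_join2[OF _ subgroup_axioms] by auto

lemma (in group) mult_inv_eq_one:
  assumes "x \<in> carrier G" "y \<in> carrier G"
  shows "x \<otimes> inv y = \<one> \<longleftrightarrow> x = y"
  using inv_equality[of x "inv y"] assms by auto

text \<open>An embedding of \<open>A\<close> into \<open>B\<close> can be given on preimages: if every element of \<open>A\<close> lifts to \<open>Y\<close> and the
  lifts of \<open>1\<close> are exactly the elements that \<open>g\<close> kills, then \<open>g\<close> of a lift does not depend on the lift.\<close>
lemma mon_from_equal_kernels:
  assumes h: "group_hom Y A h" "h ` carrier Y = carrier A" and g: "group_hom Y B g"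
    and ker: "\<And>x. x \<in> carrier Y \<Longrightarrow> h x = \<one>\<^bsub>A\<^esub> \<longleftrightarrow> g x = \<one>\<^bsub>B\<^esub>"
  obtains \<iota> where "\<iota> \<in> mon A B" "\<And>x. x \<in> carrier Y \<Longrightarrow> \<iota> (h x) = g x"
proof -
  interpret h: group_hom Y A h by (rule h(1))
  interpret g: group_hom Y B g by (rule g)
  have eq: "h x = h y \<longleftrightarrow> g x = g y" if xy: "x \<in> carrier Y" "y \<in> carrier Y" for x y
  proof -
    have "h x = h y \<longleftrightarrow> h (x \<otimes>\<^bsub>Y\<^esub> inv\<^bsub>Y\<^esub> y) = \<one>\<^bsub>A\<^esub>"
      using h.H.mult_inv_eq_one[of "h x" "h y"] xy by simp
    also have "\<dots> \<longleftrightarrow> g (x \<otimes>\<^bsub>Y\<^esub> inv\<^bsub>Y\<^esub> y) = \<one>\<^bsub>B\<^esub>"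
      by (rule ker) (use xy in simp)
    also have "\<dots> \<longleftrightarrow> g x = g y"
      using g.H.mult_inv_eq_one[of "g x" "g y"] xy by simp
    finally show ?thesis .
  qed
  define s where "s = inv_into (carrier Y) h"
  have s: "s z \<in> carrier Y" "h (s z) = z" if "z \<in> carrier A" for z
    using inv_into_into[of z h "carrier Y"] f_inv_into_f[of z h "carrier Y"] that h(2)
    by (simp_all add: s_def)
  have \<iota>: "g (s (h x)) = g x" if "x \<in> carrier Y" for x
    using eq[of "s (h x)" x] s that by simp
  show ?thesis
  proof
    show "g (s (h x)) = g x" if "x \<in> carrier Y" for x by (rule \<iota>[OF that])
    show "(\<lambda>z. g (s z)) \<in> mon A B"
      unfolding mon_def
    proof (intro CollectI conjI homI inj_onI)
      fix z assume z: "z \<in> carrier A"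
      then show "g (s z) \<in> carrier B" using s by simp
      fix w assume w: "w \<in> carrier A"
      have "h (s (z \<otimes>\<^bsub>A\<^esub> w)) = h (s z \<otimes>\<^bsub>Y\<^esub> s w)"
        using s z w by simp
      then show "g (s (z \<otimes>\<^bsub>A\<^esub> w)) = g (s z) \<otimes>\<^bsub>B\<^esub> g (s w)"
        using eq[of "s (z \<otimes>\<^bsub>A\<^esub> w)" "s z \<otimes>\<^bsub>Y\<^esub> s w"] s z w by simp
      assume "g (s z) = g (s w)"
      then show "z = w" using eq[of "s z" "s w"] s z w by metis
    qed
  qed
qed

lemma (in group_hom) subgroup_preimage:
  assumes "subgroup K H"
  shows "subgroup {x \<in> carrier G. h x \<in> K} G"
proof -
  interpret K: subgroup K H by fact
  show ?thesis
    by (rule G.subgroupI) (use K.one_closed hom_one in \<open>auto intro!: exI[of _ "\<one>\<^bsub>G\<^esub>"]\<close>)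
qed

lemma (in group) equalizer_subgroup:
  assumes "group H" "f \<in> hom G H" "g \<in> hom G H"
  shows "subgroup {x \<in> carrier G. f x = g x} G"
proof -
  interpret f: group_hom G H f by (rule group_homI[OF is_group assms(1,2)])
  interpret g: group_hom G H g by (rule group_homI[OF is_group assms(1,3)])
  show ?thesis
  proof (rule subgroupI)
    show "{x \<in> carrier G. f x = g x} \<noteq> {}" using f.hom_one g.hom_one by force
    show "{x \<in> carrier G. f x = g x} \<subseteq> carrier G" by blast
    show "inv x \<in> {x \<in> carrier G. f x = g x}" if "x \<in> {x \<in> carrier G. f x = g x}" for x
      using that by simp
    show "x \<otimes> y \<in> {x \<in> carrier G. f x = g x}"
      if "x \<in> {x \<in> carrier G. f x = g x}" "y \<in> {x \<in> carrier G. f x = g x}" for x y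
      using that by simp
  qed
qed

lemma (in group_hom) image_derived_subset:
  assumes "x \<in> derived G (carrier G)"
  shows "h x \<in> derived H (carrier H)"
proof -
  have "h ` derived G (carrier G) = derived H (h ` carrier G)"
    by (rule derived_img[symmetric]) simp
  also have "\<dots> \<subseteq> derived H (carrier H)"
    by (rule H.mono_derived) (use hom_closed in blast)
  finally show ?thesis using assms by blast
qed

lemma hom_comm_group_derived:
  assumes "group G" "comm_group H" "h \<in> hom G H" "x \<in> derived G (carrier G)"
  shows "h x = \<one>\<^bsub>H\<^esub>"
proof -
  interpret H: comm_group H by fact
  interpret h: group_hom G H h by (rule group_homI[OF assms(1) H.is_group assms(3)])
  have "h ` derived G (carrier G) = derived H (h ` carrier G)"
    using h.derived_img[of "carrier G"] by simp
  also have "\<dots> = {\<one>\<^bsub>H\<^esub>}"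
    by (rule H.derived_eq_singleton) auto
  finally show ?thesis using assms(4) by blast
qed

lemma (in group) commutator_eq_one:
  assumes "x \<in> carrier G" "y \<in> carrier G"
  shows "x \<otimes> y \<otimes> inv x \<otimes> inv y = \<one> \<longleftrightarrow> x \<otimes> y = y \<otimes> x"
proof
  assume 1: "x \<otimes> y \<otimes> inv x \<otimes> inv y = \<one>"
  have "x \<otimes> y = (x \<otimes> y \<otimes> inv x \<otimes> inv y) \<otimes> (y \<otimes> x)"
  proof -
    have "inv y \<otimes> (y \<otimes> x) = x" using assms by (simp flip: m_assoc)
    then show ?thesis using assms by (simp add: m_assoc)
  qed
  then show "x \<otimes> y = y \<otimes> x" using 1 assms by simp
qed (use assms in \<open>simp add: m_assoc\<close>)

text \<open>Central factors cancel out of a commutator. This is the only point at which centrality enters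
  the comparison of homomorphisms below.\<close>
lemma (in group) commutator_central_multiples:
  assumes "z \<in> carrier G" "w \<in> carrier G" "a \<in> carrier G" "b \<in> carrier G"
    and z: "\<And>x. x \<in> carrier G \<Longrightarrow> z \<otimes> x = x \<otimes> z"
    and w: "\<And>x. x \<in> carrier G \<Longrightarrow> w \<otimes> x = x \<otimes> w"
  shows "(z \<otimes> a) \<otimes> (w \<otimes> b) \<otimes> inv (z \<otimes> a) \<otimes> inv (w \<otimes> b) = a \<otimes> b \<otimes> inv a \<otimes> inv b"
proof -
  have "(z \<otimes> a) \<otimes> (w \<otimes> b) = z \<otimes> (a \<otimes> w) \<otimes> b"
    using assms(1-4) by (simp add: m_assoc)
  also have "\<dots> = z \<otimes> (w \<otimes> (a \<otimes> b))"
    unfolding w[OF assms(3), symmetric] using assms(1-4) by (simp add: m_assoc)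
  also have "a \<otimes> b = a \<otimes> b \<otimes> inv a \<otimes> inv b \<otimes> (b \<otimes> a)"
  proof -
    have "inv b \<otimes> (b \<otimes> a) = a"
      using assms(1-4) by (simp flip: m_assoc)
    then show ?thesis using assms(1-4) by (simp add: m_assoc)
  qed
  also have "z \<otimes> (w \<otimes> (a \<otimes> b \<otimes> inv a \<otimes> inv b \<otimes> (b \<otimes> a)))
      = a \<otimes> b \<otimes> inv a \<otimes> inv b \<otimes> (b \<otimes> a) \<otimes> w \<otimes> z"
  proof -
    have "a \<otimes> b \<otimes> inv a \<otimes> inv b \<otimes> (b \<otimes> a) \<in> carrier G"
      using assms(1-4) by simp
    then show ?thesis using assms(2) z w by (metis m_closed)
  qed
  also have "\<dots> = a \<otimes> b \<otimes> inv a \<otimes> inv b \<otimes> (b \<otimes> (a \<otimes> w) \<otimes> z)"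
    using assms(1-4) by (simp add: m_assoc)
  also have "b \<otimes> (a \<otimes> w) \<otimes> z = (w \<otimes> b) \<otimes> (z \<otimes> a)"
  proof -
    have "b \<otimes> (a \<otimes> w) \<otimes> z = (b \<otimes> w) \<otimes> (a \<otimes> z)"
      unfolding w[OF assms(3), symmetric] using assms(1-4) by (simp add: m_assoc)
    then show ?thesis unfolding w[OF assms(4)] z[OF assms(3)] .
  qed
  finally have "(z \<otimes> a) \<otimes> (w \<otimes> b) = a \<otimes> b \<otimes> inv a \<otimes> inv b \<otimes> ((w \<otimes> b) \<otimes> (z \<otimes> a))" .
  moreover have "x \<otimes> inv p \<otimes> inv q = y"
    if "x = y \<otimes> (q \<otimes> p)" "y \<in> carrier G" "p \<in> carrier G" "q \<in> carrier G" for x y p q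
  proof -
    have "x \<otimes> inv p \<otimes> inv q = x \<otimes> inv (q \<otimes> p)"
    proof -
      have "x \<in> carrier G" using that by simp
      then show ?thesis using that(3,4) by (simp add: inv_mult_group m_assoc)
    qed
    moreover have "y \<otimes> u \<otimes> inv u = y" if "u \<in> carrier G" for u
      using that \<open>y \<in> carrier G\<close> by (simp add: m_assoc)
    ultimately show ?thesis using that m_closed by metis
  qed
  ultimately show ?thesis using assms(1-4) by blast
qed

section \<open>Central extensions and homomorphisms over the base\<close>

locale central_extension = group_hom E Q p
  for E (structure) and Q (structure) and p +
  assumes surj: "p ` carrier E = carrier Q"
    and central: "\<lbrakk>z \<in> carrier E; p z = \<one>\<^bsub>Q\<^esub>; x \<in> carrier E\<rbrakk>
      \<Longrightarrow> z \<otimes>\<^bsub>E\<^esub> x = x \<otimes>\<^bsub>E\<^esub> z"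

text \<open>Over each element of the source the two values differ by a central factor, and central factors
  disappear in commutators.\<close>
lemma (in central_extension) homs_agree_on_derived:
  assumes "group Y" "f \<in> hom Y E" "g \<in> hom Y E"
    and over: "\<And>x. x \<in> carrier Y \<Longrightarrow> p (f x) = p (g x)"
    and x: "x \<in> derived Y (carrier Y)"
  shows "f x = g x"
proof -
  interpret Y: group Y by fact
  interpret f: group_hom Y E f by (rule group_homI[OF assms(1) G.is_group assms(2)])
  interpret g: group_hom Y E g by (rule group_homI[OF assms(1) G.is_group assms(3)])
  have "derived_set Y (carrier Y) \<subseteq> {x \<in> carrier Y. f x = g x}"
  proof clarsimp
    fix a b assume ab: "a \<in> carrier Y" "b \<in> carrier Y"
    define z w where "z = f a \<otimes> inv (g a)" and "w = f b \<otimes> inv (g b)"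
    have c: "z \<in> carrier E" "w \<in> carrier E" and 1: "p z = \<one>\<^bsub>Q\<^esub>" "p w = \<one>\<^bsub>Q\<^esub>"
      using ab over by (auto simp: z_def w_def)
    have "f a = z \<otimes> g a" "f b = w \<otimes> g b"
      using ab by (auto simp: z_def w_def G.m_assoc)
    then show "f a \<otimes> f b \<otimes> inv f a \<otimes> inv f b = g a \<otimes> g b \<otimes> inv g a \<otimes> inv g b"
      using G.commutator_central_multiples[of z w "g a" "g b"] c 1 central ab by auto
  qed
  then have "derived Y (carrier Y) \<subseteq> {x \<in> carrier Y. f x = g x}"
    unfolding derived_def
    by (rule Y.generate_subgroup_incl) (rule Y.equalizer_subgroup[OF G.is_group assms(2,3)])
  with x show ?thesis by blast
qed

text \<open>Free groups are projective: lift the basis and extend.\<close>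
lemma free_group_lift:
  assumes "group F" "free_basis F S" "\<phi> \<in> hom F Q"
    and E: "group E" "q \<in> hom E Q" "q ` carrier E = carrier Q" and "group Q"
  obtains \<theta> where "\<theta> \<in> hom F E" "\<And>x. x \<in> carrier F \<Longrightarrow> q (\<theta> x) = \<phi> x"
proof -
  have S: "S \<subseteq> carrier F" using assms(2) by (simp add: free_basis_def)
  have "\<forall>s\<in>S. \<exists>y\<in>carrier E. q y = \<phi> s"
    using S assms(3) E(3) hom_in_carrier[of \<phi> F Q] by (metis imageE subsetD)
  then obtain f where f: "f \<in> S \<rightarrow> carrier E" "\<And>s. s \<in> S \<Longrightarrow> q (f s) = \<phi> s"
    by (metis Pi_I)
  obtain \<theta> where \<theta>: "\<theta> \<in> hom F E" "\<forall>s\<in>S. \<theta> s = f s"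
    using free_basis_universal(1)[OF assms(1,2) E(1) f(1)] by blast
  have \<phi>S: "\<phi> \<in> S \<rightarrow> carrier Q"
    using S hom_in_carrier[OF assms(3)] by blast
  have "(q \<circ> \<theta>) x = \<phi> x" if "x \<in> carrier F" for x
  proof (rule free_basis_universal(2)[OF assms(1,2) \<open>group Q\<close> \<phi>S _ assms(3) _ that])
    show "q \<circ> \<theta> \<in> hom F Q" by (rule Group.hom_compose[OF \<theta>(1) E(2)])
    show "\<forall>x\<in>S. (q \<circ> \<theta>) x = \<phi> x" using \<theta>(2) f(2) by simp
  qed
  then show ?thesis using that[OF \<theta>(1)] by auto
qed


section \<open>The extension defined by a cocycle\<close>

locale cocycle = A: comm_group A + G: group G
  for A (structure) and G (structure) +
  fixes c
  assumes c_closed [simp, intro]: "\<lbrakk>g \<in> carrier G; h \<in> carrier G\<rbrakk> \<Longrightarrow> c g h \<in> carrier A"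
    and c_cocycle: "\<lbrakk>g \<in> carrier G; h \<in> carrier G; k \<in> carrier G\<rbrakk>
      \<Longrightarrow> c g h \<otimes>\<^bsub>A\<^esub> c (g \<otimes>\<^bsub>G\<^esub> h) k = c h k \<otimes>\<^bsub>A\<^esub> c g (h \<otimes>\<^bsub>G\<^esub> k)"
begin

definition ext where
  "ext = \<lparr>carrier = carrier A \<times> carrier G,
    monoid.mult = (\<lambda>(a, g) (b, h). (a \<otimes>\<^bsub>A\<^esub> b \<otimes>\<^bsub>A\<^esub> c g h, g \<otimes>\<^bsub>G\<^esub> h)),
    one = (inv\<^bsub>A\<^esub> c \<one>\<^bsub>G\<^esub> \<one>\<^bsub>G\<^esub>, \<one>\<^bsub>G\<^esub>)\<rparr>"

definition emb where "emb a = (a \<otimes>\<^bsub>A\<^esub> inv\<^bsub>A\<^esub> c \<one>\<^bsub>G\<^esub> \<one>\<^bsub>G\<^esub>, \<one>\<^bsub>G\<^esub>)"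

lemma ext_simps [simp]:
  "carrier ext = carrier A \<times> carrier G"
  "(a, g) \<otimes>\<^bsub>ext\<^esub> (b, h) = (a \<otimes>\<^bsub>A\<^esub> b \<otimes>\<^bsub>A\<^esub> c g h, g \<otimes>\<^bsub>G\<^esub> h)"
  "\<one>\<^bsub>ext\<^esub> = (inv\<^bsub>A\<^esub> c \<one>\<^bsub>G\<^esub> \<one>\<^bsub>G\<^esub>, \<one>\<^bsub>G\<^esub>)"
  by (simp_all add: ext_def)

text \<open>The cocycle need not be normalized: \<open>c 1 1\<close> is arbitrary, which is why the unit of the extension
  and the embedding of \<open>A\<close> carry the correction \<open>(c 1 1)\<^sup>-\<^sup>1\<close>.\<close>
lemma c_one_left: "g \<in> carrier G \<Longrightarrow> c \<one>\<^bsub>G\<^esub> g = c \<one>\<^bsub>G\<^esub> \<one>\<^bsub>G\<^esub>"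
  using c_cocycle[of "\<one>\<^bsub>G\<^esub>" "\<one>\<^bsub>G\<^esub>" g] by simp

lemma c_one_right: "g \<in> carrier G \<Longrightarrow> c g \<one>\<^bsub>G\<^esub> = c \<one>\<^bsub>G\<^esub> \<one>\<^bsub>G\<^esub>"
  using c_cocycle[of g "\<one>\<^bsub>G\<^esub>" "\<one>\<^bsub>G\<^esub>"] by simp

lemma group_ext: "group ext"
proof (rule groupI; clarsimp)
  fix a g b h d k
  assume [simp]: "a \<in> carrier A" "g \<in> carrier G" "b \<in> carrier A" "h \<in> carrier G"
    "d \<in> carrier A" "k \<in> carrier G"
  have "a \<otimes>\<^bsub>A\<^esub> b \<otimes>\<^bsub>A\<^esub> c g h \<otimes>\<^bsub>A\<^esub> d \<otimes>\<^bsub>A\<^esub> c (g \<otimes>\<^bsub>G\<^esub> h) k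
      = a \<otimes>\<^bsub>A\<^esub> b \<otimes>\<^bsub>A\<^esub> d \<otimes>\<^bsub>A\<^esub> (c g h \<otimes>\<^bsub>A\<^esub> c (g \<otimes>\<^bsub>G\<^esub> h) k)"
    by (simp add: A.m_ac)
  also have "\<dots> = a \<otimes>\<^bsub>A\<^esub> (b \<otimes>\<^bsub>A\<^esub> d \<otimes>\<^bsub>A\<^esub> c h k) \<otimes>\<^bsub>A\<^esub> c g (h \<otimes>\<^bsub>G\<^esub> k)"
    by (simp add: c_cocycle A.m_ac)
  finally show "a \<otimes>\<^bsub>A\<^esub> b \<otimes>\<^bsub>A\<^esub> c g h \<otimes>\<^bsub>A\<^esub> d \<otimes>\<^bsub>A\<^esub> c (g \<otimes>\<^bsub>G\<^esub> h) k
      = a \<otimes>\<^bsub>A\<^esub> (b \<otimes>\<^bsub>A\<^esub> d \<otimes>\<^bsub>A\<^esub> c h k) \<otimes>\<^bsub>A\<^esub> c g (h \<otimes>\<^bsub>G\<^esub> k)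
    \<and> g \<otimes>\<^bsub>G\<^esub> h \<otimes>\<^bsub>G\<^esub> k = g \<otimes>\<^bsub>G\<^esub> (h \<otimes>\<^bsub>G\<^esub> k)"
    by (simp add: G.m_assoc)
next
  fix a g assume [simp]: "a \<in> carrier A" "g \<in> carrier G"
  have "inv\<^bsub>A\<^esub> c \<one>\<^bsub>G\<^esub> \<one>\<^bsub>G\<^esub> \<otimes>\<^bsub>A\<^esub> a \<otimes>\<^bsub>A\<^esub> c \<one>\<^bsub>G\<^esub> g
      = a \<otimes>\<^bsub>A\<^esub> (c \<one>\<^bsub>G\<^esub> \<one>\<^bsub>G\<^esub> \<otimes>\<^bsub>A\<^esub> inv\<^bsub>A\<^esub> c \<one>\<^bsub>G\<^esub> \<one>\<^bsub>G\<^esub>)"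
    unfolding c_one_left[OF \<open>g \<in> carrier G\<close>] by (simp only: A.m_ac c_closed A.inv_closed G.one_closed \<open>a \<in> carrier A\<close> A.m_closed)
  then show "inv\<^bsub>A\<^esub> c \<one>\<^bsub>G\<^esub> \<one>\<^bsub>G\<^esub> \<otimes>\<^bsub>A\<^esub> a \<otimes>\<^bsub>A\<^esub> c \<one>\<^bsub>G\<^esub> g = a" by simp
next
  fix a g assume [simp]: "a \<in> carrier A" "g \<in> carrier G"
  show "\<exists>b\<in>carrier A. \<exists>h\<in>carrier G.
    b \<otimes>\<^bsub>A\<^esub> a \<otimes>\<^bsub>A\<^esub> c h g = inv\<^bsub>A\<^esub> c \<one>\<^bsub>G\<^esub> \<one>\<^bsub>G\<^esub> \<and> h \<otimes>\<^bsub>G\<^esub> g = \<one>\<^bsub>G\<^esub>"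
  proof (intro bexI conjI)
    let ?u = "a \<otimes>\<^bsub>A\<^esub> c (inv\<^bsub>G\<^esub> g) g"
    have "(inv\<^bsub>A\<^esub> c \<one>\<^bsub>G\<^esub> \<one>\<^bsub>G\<^esub> \<otimes>\<^bsub>A\<^esub> inv\<^bsub>A\<^esub> ?u) \<otimes>\<^bsub>A\<^esub> ?u = inv\<^bsub>A\<^esub> c \<one>\<^bsub>G\<^esub> \<one>\<^bsub>G\<^esub>"
      by (subst A.m_assoc) (simp_all del: A.inv_mult)
    then show "(inv\<^bsub>A\<^esub> c \<one>\<^bsub>G\<^esub> \<one>\<^bsub>G\<^esub> \<otimes>\<^bsub>A\<^esub> inv\<^bsub>A\<^esub> ?u) \<otimes>\<^bsub>A\<^esub> a \<otimes>\<^bsub>A\<^esub> c (inv\<^bsub>G\<^esub> g) g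
        = inv\<^bsub>A\<^esub> c \<one>\<^bsub>G\<^esub> \<one>\<^bsub>G\<^esub>"
      by (subst A.m_assoc) (simp_all del: A.inv_mult)
    show "inv\<^bsub>G\<^esub> g \<otimes>\<^bsub>G\<^esub> g = \<one>\<^bsub>G\<^esub>" by simp
  qed auto
qed

text \<open>The embedded copy of \<open>A\<close> acts on either side by translation of the first component; in particular
  it is central.\<close>
lemma emb_mult:
  assumes [simp]: "a \<in> carrier A" "b \<in> carrier A" "g \<in> carrier G"
  shows "emb a \<otimes>\<^bsub>ext\<^esub> (b, g) = (a \<otimes>\<^bsub>A\<^esub> b, g)" "(b, g) \<otimes>\<^bsub>ext\<^esub> emb a = (a \<otimes>\<^bsub>A\<^esub> b, g)"
proof -
  have "a \<otimes>\<^bsub>A\<^esub> inv\<^bsub>A\<^esub> c \<one>\<^bsub>G\<^esub> \<one>\<^bsub>G\<^esub> \<otimes>\<^bsub>A\<^esub> b \<otimes>\<^bsub>A\<^esub> c \<one>\<^bsub>G\<^esub> \<one>\<^bsub>G\<^esub>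
      = a \<otimes>\<^bsub>A\<^esub> b \<otimes>\<^bsub>A\<^esub> (inv\<^bsub>A\<^esub> c \<one>\<^bsub>G\<^esub> \<one>\<^bsub>G\<^esub> \<otimes>\<^bsub>A\<^esub> c \<one>\<^bsub>G\<^esub> \<one>\<^bsub>G\<^esub>)"
    by (simp only: A.m_ac c_closed A.inv_closed G.one_closed assms A.m_closed)
  then have *: "a \<otimes>\<^bsub>A\<^esub> inv\<^bsub>A\<^esub> c \<one>\<^bsub>G\<^esub> \<one>\<^bsub>G\<^esub> \<otimes>\<^bsub>A\<^esub> b \<otimes>\<^bsub>A\<^esub> c \<one>\<^bsub>G\<^esub> \<one>\<^bsub>G\<^esub> = a \<otimes>\<^bsub>A\<^esub> b"
    by simp
  have "b \<otimes>\<^bsub>A\<^esub> (a \<otimes>\<^bsub>A\<^esub> inv\<^bsub>A\<^esub> c \<one>\<^bsub>G\<^esub> \<one>\<^bsub>G\<^esub>) = a \<otimes>\<^bsub>A\<^esub> inv\<^bsub>A\<^esub> c \<one>\<^bsub>G\<^esub> \<one>\<^bsub>G\<^esub> \<otimes>\<^bsub>A\<^esub> b"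
    by (rule A.m_comm) auto
  with * show "emb a \<otimes>\<^bsub>ext\<^esub> (b, g) = (a \<otimes>\<^bsub>A\<^esub> b, g)" "(b, g) \<otimes>\<^bsub>ext\<^esub> emb a = (a \<otimes>\<^bsub>A\<^esub> b, g)"
    by (simp_all add: emb_def c_one_left[OF assms(3)] c_one_right[OF assms(3)])
qed

lemma emb_closed: "a \<in> carrier A \<Longrightarrow> emb a \<in> carrier ext"
  by (simp add: emb_def)

lemma emb_hom: "emb \<in> hom A ext"
proof (rule homI)
  fix a b assume "a \<in> carrier A" "b \<in> carrier A"
  then show "emb (a \<otimes>\<^bsub>A\<^esub> b) = emb a \<otimes>\<^bsub>ext\<^esub> emb b"
    using emb_mult(1)[of a "b \<otimes>\<^bsub>A\<^esub> inv\<^bsub>A\<^esub> c \<one>\<^bsub>G\<^esub> \<one>\<^bsub>G\<^esub>" "\<one>\<^bsub>G\<^esub>"]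
    by (simp add: emb_def A.m_assoc)
qed (rule emb_closed)

lemma emb_inj: "inj_on emb (carrier A)"
  by (rule inj_onI) (simp add: emb_def)

lemma emb_onto:
  assumes "x \<in> carrier ext" "snd x = \<one>\<^bsub>G\<^esub>"
  obtains a where "a \<in> carrier A" "x = emb a"
proof
  show "fst x \<otimes>\<^bsub>A\<^esub> c \<one>\<^bsub>G\<^esub> \<one>\<^bsub>G\<^esub> \<in> carrier A" using assms by auto
  show "x = emb (fst x \<otimes>\<^bsub>A\<^esub> c \<one>\<^bsub>G\<^esub> \<one>\<^bsub>G\<^esub>)"
    using assms by (auto simp: emb_def A.m_assoc prod_eq_iff)
qed

lemma central_extension_ext: "central_extension ext G snd"
proof -
  interpret Y: group ext by (rule group_ext)
  show ?thesis
  proof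
    show "snd \<in> hom ext G" by (rule homI) auto
    show "snd ` carrier ext = carrier G" by force
    show "z \<otimes>\<^bsub>ext\<^esub> x = x \<otimes>\<^bsub>ext\<^esub> z"
      if "z \<in> carrier ext" "snd z = \<one>\<^bsub>G\<^esub>" "x \<in> carrier ext" for z x
    proof -
      from that(1,2) obtain a where "a \<in> carrier A" "z = emb a" by (rule emb_onto)
      then show ?thesis using that(3) by (cases x) (simp add: emb_mult)
    qed
  qed
qed

end

section \<open>The bar complex in low degrees\<close>

lemma bar_face_closed:
  assumes "group G" "p > 0" "i \<le> p" "length xs = p" "set xs \<subseteq> carrier G"
  shows "length (bar_face G p i xs) = p - 1 \<and> set (bar_face G p i xs) \<subseteq> carrier G"
proof -
  interpret group G by fact
  have "xs ! (i - 1) \<otimes>\<^bsub>G\<^esub> xs ! i \<in> carrier G" if "0 < i" "i < p"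
    using that assms by (intro m_closed) (auto simp: subset_iff)
  moreover have "set (tl xs) \<subseteq> carrier G" "set (butlast xs) \<subseteq> carrier G"
    using assms(5) by (auto dest: list.set_sel(2) in_set_butlastD) (metis empty_iff empty_set list.set_sel(2) subsetD tl_Nil)
  ultimately show ?thesis
    using assms by (auto simp: bar_face_def dest: in_set_takeD in_set_dropD)
qed

lemma bar_boundary_hom:
  assumes "group G" "p > 0"
  shows "bar_boundary G p \<in> hom (bar_chain_group G p) (bar_chain_group G (p - 1))"
proof (rule homI)
  let ?S = "{xs. length xs = p \<and> set xs \<subseteq> carrier G}"
  let ?T = "{xs. length xs = p - 1 \<and> set xs \<subseteq> carrier G}"
  fix c assume "c \<in> carrier (bar_chain_group G p)"
  then have c: "Poly_Mapping.keys c \<subseteq> ?S" by (simp add: bar_chain_group_def)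
  have "Poly_Mapping.keys (\<Sum>i\<le>p. frag_cmul ((-1) ^ i) (frag_of (bar_face G p i xs))) \<subseteq> ?T"
    if "xs \<in> ?S" for xs
  proof -
    have "(\<Sum>i\<le>p. frag_cmul ((-1) ^ i) (frag_of (bar_face G p i xs)))
        \<in> carrier (free_Abelian_group ?T)"
    proof (rule sum_closed_free_Abelian_group)
      fix i assume "i \<in> {..p}"
      then have "Poly_Mapping.keys (frag_of (bar_face G p i xs)) \<subseteq> ?T"
        using that bar_face_closed[OF assms, of i xs] by simp
      then show "frag_cmul ((-1) ^ i) (frag_of (bar_face G p i xs))
          \<in> carrier (free_Abelian_group ?T)"
        using keys_cmul[of "(-1) ^ i" "frag_of (bar_face G p i xs)"]
        unfolding carrier_free_Abelian_group_iff by (rule order_trans[rotated])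
    qed
    then show ?thesis by simp
  qed
  then have "Poly_Mapping.keys (bar_boundary G p c) \<subseteq> ?T"
    using c assms(2) keys_frag_extend[of "\<lambda>xs. \<Sum>i\<le>p. frag_cmul ((-1) ^ i) (frag_of (bar_face G p i xs))" c]
    unfolding bar_boundary_def by (smt (verit) SUP_least order_trans subset_iff not_gr_zero)
  then show "bar_boundary G p c \<in> carrier (bar_chain_group G (p - 1))"
    by (simp add: bar_chain_group_def)
next
  fix c d
  show "bar_boundary G p (c \<otimes>\<^bsub>bar_chain_group G p\<^esub> d)
    = bar_boundary G p c \<otimes>\<^bsub>bar_chain_group G (p - 1)\<^esub> bar_boundary G p d"
    using assms(2) by (simp add: bar_boundary_def bar_chain_group_def frag_extend_add)
qed

lemma bar_boundary_diff: "bar_boundary G p (c - d) = bar_boundary G p c - bar_boundary G p d"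
  by (simp add: bar_boundary_def frag_extend_diff)

lemma bar_boundary_zero: "bar_boundary G p 0 = 0"
  by (simp add: bar_boundary_def)

lemma bar_chain_diff_closed:
  assumes "a \<in> carrier (bar_chain_group G p)" "b \<in> carrier (bar_chain_group G p)"
  shows "a - b \<in> carrier (bar_chain_group G p)"
  using assms order_trans[OF keys_diff[of a b]] by (simp add: bar_chain_group_def)

lemma bar_chain_induct [consumes 1, case_names zero diff generator]:
  assumes "c \<in> carrier (bar_chain_group G p)" "P 0"
    "\<And>a b. \<lbrakk>a \<in> carrier (bar_chain_group G p); b \<in> carrier (bar_chain_group G p); P a; P b\<rbrakk> \<Longrightarrow> P (a - b)"
    "\<And>xs. \<lbrakk>length xs = p; set xs \<subseteq> carrier G\<rbrakk> \<Longrightarrow> P (frag_of xs)"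
  shows "P c"
  using assms by (auto simp: bar_chain_group_def intro: free_Abelian_group_induct[of c])

lemma length_2_cases: "length xs = 2 \<Longrightarrow> (\<And>g h. xs = [g, h] \<Longrightarrow> P) \<Longrightarrow> P"
  by (auto simp: numeral_2_eq_2 length_Suc_conv)

lemma length_3_cases: "length xs = 3 \<Longrightarrow> (\<And>g h k. xs = [g, h, k] \<Longrightarrow> P) \<Longrightarrow> P"
  by (auto simp: numeral_3_eq_3 length_Suc_conv)

text \<open>Among the identities \<open>\<partial>\<partial> = 0\<close>, this is the one that lets the boundary descend to
  \<open>C\<^sub>2/B\<^sub>2\<close>.\<close>
lemma bar_boundary_2_3:
  assumes "group G" "c \<in> carrier (bar_chain_group G 3)"
  shows "bar_boundary G 2 (bar_boundary G 3 c) = 0"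
  using assms(2)
proof (induction rule: bar_chain_induct)
  case (generator xs)
  interpret group G by fact
  obtain g h k where xs: "xs = [g, h, k]" using generator(1) by (rule length_3_cases)
  have bd_add: "bar_boundary G 2 (u + v) = bar_boundary G 2 u + bar_boundary G 2 v" for u v
    by (simp add: bar_boundary_def frag_extend_add)
  show ?case
    using generator(2)
    by (simp add: xs bar_boundary_3 bar_boundary_2 bd_add bar_boundary_diff m_assoc)
qed (simp_all add: bar_boundary_zero bar_boundary_diff)

text \<open>The group \<open>C\<^sub>2/B\<^sub>2\<close>, of which \<open>H\<^sub>2\<close> is the subgroup of classes of cycles.\<close>

definition bar_quotient where
  "bar_quotient G = bar_chain_group G 2 Mod bar_boundaries G 2"

definition bar_class where
  "bar_class G c = bar_boundaries G 2 #>\<^bsub>bar_chain_group G 2\<^esub> c"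

lemma bar_boundaries_eq: "bar_boundaries G 2 = bar_boundary G 3 ` carrier (bar_chain_group G 3)"
proof -
  have "Suc 2 = 3" by simp
  then show ?thesis unfolding bar_boundaries_def by metis
qed

context group
begin

lemma comm_group_chain: "comm_group (bar_chain_group G p)"
  by (simp add: bar_chain_group_def abelian_free_Abelian_group)

lemma chain_mult: "x \<otimes>\<^bsub>bar_chain_group G p\<^esub> y = x + y"
  by (simp add: bar_chain_group_def)

lemma chain_one: "\<one>\<^bsub>bar_chain_group G p\<^esub> = 0"
  by (simp add: bar_chain_group_def)

lemma group_hom_boundary_3: "group_hom (bar_chain_group G 3) (bar_chain_group G 2) (bar_boundary G 3)"
  using bar_boundary_hom[OF is_group, of 3] comm_group_chain
  by (simp add: group_homI comm_group_def)

lemma group_hom_boundary_2: "group_hom (bar_chain_group G 2) (bar_chain_group G (Suc 0)) (bar_boundary G 2)"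
  using bar_boundary_hom[OF is_group, of 2] comm_group_chain
  by (simp add: group_homI comm_group_def)

lemma subgroup_boundaries: "subgroup (bar_boundaries G 2) (bar_chain_group G 2)"
  unfolding bar_boundaries_eq by (rule group_hom.img_is_subgroup[OF group_hom_boundary_3])

lemma normal_boundaries: "bar_boundaries G 2 \<lhd> bar_chain_group G 2"
  using comm_group.subgroup_imp_normal[OF comm_group_chain subgroup_boundaries] .

lemma subgroup_cycles: "subgroup (bar_cycles G 2) (bar_chain_group G 2)"
  using group_hom.subgroup_kernel[OF group_hom_boundary_2] by (simp add: bar_cycles_def)

lemma cycles_iff:
  "c \<in> bar_cycles G 2 \<longleftrightarrow> c \<in> carrier (bar_chain_group G 2) \<and> bar_boundary G 2 c = 0"
  by (auto simp: bar_cycles_def kernel_def chain_one)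

lemma comm_group_bar_quotient: "comm_group (bar_quotient G)"
  unfolding bar_quotient_def
  by (rule comm_group.abelian_FactGroup[OF comm_group_chain subgroup_boundaries])

lemma bar_class_hom: "bar_class G \<in> hom (bar_chain_group G 2) (bar_quotient G)"
proof -
  have "bar_class G = (\<lambda>c. bar_boundaries G 2 #>\<^bsub>bar_chain_group G 2\<^esub> c)"
    by (simp add: bar_class_def fun_eq_iff)
  then show ?thesis
    using normal.r_coset_hom_Mod[OF normal_boundaries] by (simp add: bar_quotient_def)
qed

lemma carrier_bar_quotient: "carrier (bar_quotient G) = bar_class G ` carrier (bar_chain_group G 2)"
  by (auto simp: bar_quotient_def carrier_FactGroup bar_class_def)

lemma group_hom_bar_class: "group_hom (bar_chain_group G 2) (bar_quotient G) (bar_class G)"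
  using bar_class_hom comm_group_chain comm_group_bar_quotient
  by (simp add: group_homI comm_group_def)

lemma bar_class_boundary:
  assumes "c \<in> bar_boundaries G 2"
  shows "bar_class G c = \<one>\<^bsub>bar_quotient G\<^esub>"
proof -
  interpret C: comm_group "bar_chain_group G 2" by (rule comm_group_chain)
  show ?thesis
    using C.coset_join2[OF _ subgroup_boundaries assms] subgroup.subset[OF subgroup_boundaries] assms
    by (auto simp: bar_class_def bar_quotient_def)
qed

text \<open>Since \<open>B\<^sub>2\<close> is generated by the boundaries of the symbols \<open>[g|h|k]\<close>, a homomorphism on
  \<open>C\<^sub>2\<close> descends to \<open>C\<^sub>2/B\<^sub>2\<close> as soon as it satisfies the cocycle identity.\<close>
lemma bar_quotient_lift:
  assumes "group H" "f \<in> hom (bar_chain_group G 2) H"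
    and "\<And>g h k. \<lbrakk>g \<in> carrier G; h \<in> carrier G; k \<in> carrier G\<rbrakk>
      \<Longrightarrow> f (bar_boundary G 3 (frag_of [g, h, k])) = \<one>\<^bsub>H\<^esub>"
  obtains f' where "f' \<in> hom (bar_quotient G) H"
    "\<And>c. c \<in> carrier (bar_chain_group G 2) \<Longrightarrow> f' (bar_class G c) = f c"
proof -
  interpret C: comm_group "bar_chain_group G 2" by (rule comm_group_chain)
  interpret C3: comm_group "bar_chain_group G 3" by (rule comm_group_chain)
  interpret f: group_hom "bar_chain_group G 2" H f by (rule group_homI[OF C.is_group assms(1,2)])
  interpret d: group_hom "bar_chain_group G 3" "bar_chain_group G 2" "bar_boundary G 3"
    by (rule group_hom_boundary_3)
  have "f (bar_boundary G 3 c) = \<one>\<^bsub>H\<^esub>" if "c \<in> carrier (bar_chain_group G 3)" for c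
    using that
  proof (induction rule: bar_chain_induct)
    case zero
    then show ?case using f.hom_one by (simp add: bar_boundary_zero chain_one)
  next
    case (diff a b)
    have ab: "a - b \<in> carrier (bar_chain_group G 3)"
      using diff(1,2) by (rule bar_chain_diff_closed)
    have "f (bar_boundary G 3 (a - b) \<otimes>\<^bsub>bar_chain_group G 2\<^esub> bar_boundary G 3 b)
        = f (bar_boundary G 3 (a - b)) \<otimes>\<^bsub>H\<^esub> f (bar_boundary G 3 b)"
      by (rule f.hom_mult[OF d.hom_closed[OF ab] d.hom_closed[OF diff(2)]])
    then have "f (bar_boundary G 3 (a - b)) \<otimes>\<^bsub>H\<^esub> f (bar_boundary G 3 b) = f (bar_boundary G 3 a)"
      by (simp add: chain_mult bar_boundary_diff)
    moreover have "f (bar_boundary G 3 (a - b)) \<in> carrier H"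
      using f.hom_closed[OF d.hom_closed[OF ab]] .
    ultimately show ?case using diff by simp
  next
    case (generator xs)
    then show ?case using assms(3) by (auto elim!: length_3_cases)
  qed
  then have "bar_boundaries G 2 \<subseteq> kernel (bar_chain_group G 2) H f"
    using subgroup.subset[OF subgroup_boundaries] by (auto simp: bar_boundaries_eq kernel_def)
  from f.FactGroup_universal_kernel[OF normal_boundaries this] that show ?thesis
    unfolding bar_quotient_def bar_class_def by blast
qed

lemma carrier_group_homology:
  "carrier (group_homology G 2) = bar_class G ` bar_cycles G 2"
  by (auto simp: group_homology_def carrier_FactGroup bar_class_def r_coset_def)

lemma group_homology_eq:
  "group_homology G 2 = (bar_quotient G)\<lparr>carrier := bar_class G ` bar_cycles G 2\<rparr>"
  using carrier_group_homology
  by (simp add: group_homology_def bar_quotient_def FactGroup_def set_mult_def[abs_def])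

lemma group_homology_group: "group (group_homology G 2)"
  unfolding group_homology_eq
  by (intro group.subgroup_imp_group group_hom.subgroup_img_is_subgroup[OF group_hom_bar_class]
      subgroup_cycles comm_group.axioms(2)[OF comm_group_bar_quotient])

lemma bar_generator [simp]:
  "\<lbrakk>g \<in> carrier G; h \<in> carrier G\<rbrakk> \<Longrightarrow> frag_of [g, h] \<in> carrier (bar_chain_group G 2)"
  by (simp add: bar_chain_group_def)

text \<open>Modulo \<open>B\<^sub>2\<close>, the boundary of \<open>[g|h|k]\<close> is exactly the cocycle identity for \<open>[g|h]\<close>.\<close>
lemma bar_cocycle: "cocycle (bar_quotient G) G (\<lambda>g h. bar_class G (frag_of [g, h]))"
proof -
  interpret A: comm_group "bar_quotient G" by (rule comm_group_bar_quotient)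
  interpret q: group_hom "bar_chain_group G 2" "bar_quotient G" "bar_class G"
    by (rule group_hom_bar_class)
  show ?thesis
  proof (intro cocycle.intro cocycle_axioms.intro comm_group_bar_quotient is_group)
    fix g h k assume [simp]: "g \<in> carrier G" "h \<in> carrier G" "k \<in> carrier G"
    let ?d = "bar_boundary G 3 (frag_of [g, h, k])"
    have "frag_of [g, h, k] \<in> carrier (bar_chain_group G 3)"
      by (simp add: bar_chain_group_def)
    then have d: "?d \<in> bar_boundaries G 2" by (auto simp: bar_boundaries_eq)
    then have dc: "?d \<in> carrier (bar_chain_group G 2)"
      using subgroup.subset[OF subgroup_boundaries] by blast
    have "frag_of [h, k] + frag_of [g, h \<otimes> k] = ?d + (frag_of [g, h] + frag_of [g \<otimes> h, k])"
      by (simp add: bar_boundary_3)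
    then have "bar_class G (frag_of [h, k] \<otimes>\<^bsub>bar_chain_group G 2\<^esub> frag_of [g, h \<otimes> k])
        = bar_class G (?d \<otimes>\<^bsub>bar_chain_group G 2\<^esub>
            (frag_of [g, h] \<otimes>\<^bsub>bar_chain_group G 2\<^esub> frag_of [g \<otimes> h, k]))"
      by (simp add: chain_mult)
    then show "bar_class G (frag_of [g, h]) \<otimes>\<^bsub>bar_quotient G\<^esub> bar_class G (frag_of [g \<otimes> h, k])
        = bar_class G (frag_of [h, k]) \<otimes>\<^bsub>bar_quotient G\<^esub> bar_class G (frag_of [g, h \<otimes> k])"
      using dc bar_class_boundary[OF d] by simp
  qed (simp add: q.hom_closed)
qed

end

lemma bar_chain_hom_unique:
  assumes "group G" "group H" "f \<in> hom (bar_chain_group G p) H" "g \<in> hom (bar_chain_group G p) H"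
    and eq: "\<And>xs. \<lbrakk>length xs = p; set xs \<subseteq> carrier G\<rbrakk> \<Longrightarrow> f (frag_of xs) = g (frag_of xs)"
    and c: "c \<in> carrier (bar_chain_group G p)"
  shows "f c = g c"
proof -
  interpret C: comm_group "bar_chain_group G p" using group.comm_group_chain[OF assms(1)] .
  interpret f: group_hom "bar_chain_group G p" H f by (rule group_homI[OF C.is_group assms(2,3)])
  interpret g: group_hom "bar_chain_group G p" H g by (rule group_homI[OF C.is_group assms(2,4)])
  show ?thesis
    using c
  proof (induction rule: bar_chain_induct)
    case zero
    then show ?case
      using f.hom_one g.hom_one by (simp add: group.chain_one[OF assms(1)])
  next
    case (diff a b)
    have ab: "a - b \<in> carrier (bar_chain_group G p)"
      using diff(1,2) by (rule bar_chain_diff_closed)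
    have "f ((a - b) \<otimes>\<^bsub>bar_chain_group G p\<^esub> b) = f (a - b) \<otimes>\<^bsub>H\<^esub> f b"
      "g ((a - b) \<otimes>\<^bsub>bar_chain_group G p\<^esub> b) = g (a - b) \<otimes>\<^bsub>H\<^esub> g b"
      using f.hom_mult[OF ab diff(2)] g.hom_mult[OF ab diff(2)] by simp_all
    then have "f (a - b) \<otimes>\<^bsub>H\<^esub> f b = g (a - b) \<otimes>\<^bsub>H\<^esub> f b"
      using diff(3,4) by (simp add: group.chain_mult[OF assms(1)])
    then show ?case
      using f.hom_closed[OF ab] g.hom_closed[OF ab] f.hom_closed[OF diff(2)] by simp
  next
    case (generator xs)
    then show ?case using eq by blast
  qed
qed

section \<open>The bar extension\<close>

context group
begin

interpretation bar: cocycle "bar_quotient G" G "\<lambda>g h. bar_class G (frag_of [g, h])"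
  by (rule bar_cocycle)

abbreviation "bar_extension \<equiv> cocycle.ext (bar_quotient G) G (\<lambda>g h. bar_class G (frag_of [g, h]))"
abbreviation "bar_embedding \<equiv> cocycle.emb (bar_quotient G) G (\<lambda>g h. bar_class G (frag_of [g, h]))"

text \<open>The bar extension maps to every central extension \<open>R\<close> of \<open>G\<close>. A set-theoretic section \<open>s\<close> of
  \<open>R \<rightarrow> G\<close> has the factor set \<open>s g \<cdot> s h \<cdot> (s (g h))\<^sup>-\<^sup>1\<close>; sending \<open>[g|h]\<close> to it defines a
  homomorphism on \<open>C\<^sub>2\<close>, which kills \<open>B\<^sub>2\<close> because factor sets are cocycles. The map of extensions is
  \<open>(a, g) \<mapsto> \<Phi> a \<cdot> s g\<close>.\<close>
lemma bar_extension_versal: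
  assumes "central_extension R G q"
  obtains \<Psi> where "\<Psi> \<in> hom bar_extension R"
    "\<And>x. x \<in> carrier bar_extension \<Longrightarrow> q (\<Psi> x) = snd x"
proof -
  interpret q: central_extension R G q by fact
  define Z where "Z = kernel R G q"
  have Z: "z \<in> Z \<longleftrightarrow> z \<in> carrier R \<and> q z = \<one>" for z
    by (auto simp: Z_def kernel_def)
  have "subgroup Z R" unfolding Z_def by (rule q.subgroup_kernel)
  then have gZ: "group (R\<lparr>carrier := Z\<rparr>)" by (rule q.G.subgroup_imp_group)
  then interpret RZ: comm_group "R\<lparr>carrier := Z\<rparr>"
    by (rule group.group_comm_groupI) (auto simp: Z q.central)
  have "\<forall>g\<in>carrier G. \<exists>r\<in>carrier R. q r = g"
    using q.surj by (metis imageE)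
  then obtain s where s: "\<And>g. g \<in> carrier G \<Longrightarrow> s g \<in> carrier R"
    "\<And>g. g \<in> carrier G \<Longrightarrow> q (s g) = g" by metis
  define f where "f g h = s g \<otimes>\<^bsub>R\<^esub> s h \<otimes>\<^bsub>R\<^esub> inv\<^bsub>R\<^esub> s (g \<otimes> h)" for g h
  have f: "f g h \<in> Z" "f g h \<otimes>\<^bsub>R\<^esub> s (g \<otimes> h) = s g \<otimes>\<^bsub>R\<^esub> s h"
    if "g \<in> carrier G" "h \<in> carrier G" for g h
  proof -
    have "q (f g h) = g \<otimes> h \<otimes> inv (g \<otimes> h)" using that s by (simp add: f_def)
    also have "\<dots> = \<one>" by (rule r_inv[OF m_closed[OF that]])
    finally show "f g h \<in> Z" using that s by (simp add: f_def Z)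
    show "f g h \<otimes>\<^bsub>R\<^esub> s (g \<otimes> h) = s g \<otimes>\<^bsub>R\<^esub> s h"
      using that s by (simp add: f_def q.G.m_assoc)
  qed
  have "(\<lambda>xs. f (xs ! 0) (xs ! 1)) ` {xs. length xs = 2 \<and> set xs \<subseteq> carrier G}
      \<subseteq> carrier (R\<lparr>carrier := Z\<rparr>)"
    using f(1) by (auto elim!: length_2_cases)
  from RZ.free_Abelian_group_universal[OF this] obtain k where
    k: "k \<in> hom (free_Abelian_group {xs. length xs = 2 \<and> set xs \<subseteq> carrier G}) (R\<lparr>carrier := Z\<rparr>)"
    "\<And>xs. xs \<in> {xs. length xs = 2 \<and> set xs \<subseteq> carrier G} \<Longrightarrow> k (frag_of xs) = f (xs ! 0) (xs ! 1)"
    by blast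
  have kf: "k (frag_of [g, h]) = f g h" if "g \<in> carrier G" "h \<in> carrier G" for g h
    using k(2)[of "[g, h]"] that by simp
  note k = k(1)[folded bar_chain_group_def]
  have kmult: "k (x + y) = k x \<otimes>\<^bsub>R\<^esub> k y"
    if "x \<in> carrier (bar_chain_group G 2)" "y \<in> carrier (bar_chain_group G 2)" for x y
    using hom_mult[OF k that] by (simp add: chain_mult)
  have "k (bar_boundary G 3 (frag_of [g, h, l])) = \<one>\<^bsub>R\<lparr>carrier := Z\<rparr>\<^esub>"
    if [simp]: "g \<in> carrier G" "h \<in> carrier G" "l \<in> carrier G" for g h l
  proof -
    let ?d = "bar_boundary G 3 (frag_of [g, h, l])"
    have d: "?d \<in> carrier (bar_chain_group G 2)"
      using group_hom.hom_closed[OF group_hom_boundary_3, of "frag_of [g, h, l]"]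
      by (simp add: bar_chain_group_def)
    have f1: "f g h \<in> carrier R" "f (g \<otimes> h) l \<in> carrier R" "f h l \<in> carrier R" "f g (h \<otimes> l) \<in> carrier R"
      using f(1) Z by auto
    have add: "u + v \<in> carrier (bar_chain_group G 2)"
      if "u \<in> carrier (bar_chain_group G 2)" "v \<in> carrier (bar_chain_group G 2)" for u v
      using monoid.m_closed[OF comm_group.axioms(2)[OF comm_group_chain, THEN group.is_monoid] that]
      by (simp add: chain_mult)
    have 1: "f h l \<otimes>\<^bsub>R\<^esub> f g (h \<otimes> l) = k ?d \<otimes>\<^bsub>R\<^esub> (f g h \<otimes>\<^bsub>R\<^esub> f (g \<otimes> h) l)"
    proof -
      have "frag_of [h, l] + frag_of [g, h \<otimes> l] = ?d + (frag_of [g, h] + frag_of [g \<otimes> h, l])"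
        by (simp add: bar_boundary_3)
      then have "k (frag_of [h, l] + frag_of [g, h \<otimes> l])
          = k (?d + (frag_of [g, h] + frag_of [g \<otimes> h, l]))" by simp
      then show ?thesis
        using d by (simp add: kmult kf add)
    qed
    \<comment> \<open>Both sides of the cocycle identity, multiplied by \<open>s (g h l)\<close>, are \<open>s g \<cdot> s h \<cdot> s l\<close>.\<close>
    have "f h l \<otimes>\<^bsub>R\<^esub> f g (h \<otimes> l) \<otimes>\<^bsub>R\<^esub> s (g \<otimes> (h \<otimes> l)) = f h l \<otimes>\<^bsub>R\<^esub> s g \<otimes>\<^bsub>R\<^esub> s (h \<otimes> l)"
      using f1 s by (simp add: f(2) q.G.m_assoc)
    also have "f h l \<otimes>\<^bsub>R\<^esub> s g = s g \<otimes>\<^bsub>R\<^esub> f h l"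
      by (rule q.central) (use f(1)[of h l] s(1) Z in auto)
    also have "s g \<otimes>\<^bsub>R\<^esub> f h l \<otimes>\<^bsub>R\<^esub> s (h \<otimes> l) = s g \<otimes>\<^bsub>R\<^esub> s h \<otimes>\<^bsub>R\<^esub> s l"
      using f1 s by (simp add: f(2) q.G.m_assoc)
    also have "\<dots> = f g h \<otimes>\<^bsub>R\<^esub> f (g \<otimes> h) l \<otimes>\<^bsub>R\<^esub> s (g \<otimes> (h \<otimes> l))"
    proof -
      have "f g h \<otimes>\<^bsub>R\<^esub> f (g \<otimes> h) l \<otimes>\<^bsub>R\<^esub> s (g \<otimes> h \<otimes> l) = f g h \<otimes>\<^bsub>R\<^esub> (s (g \<otimes> h) \<otimes>\<^bsub>R\<^esub> s l)"
        using f1 s by (simp add: f(2) q.G.m_assoc)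
      also have "\<dots> = s g \<otimes>\<^bsub>R\<^esub> s h \<otimes>\<^bsub>R\<^esub> s l"
        using f1 s by (simp add: f(2) flip: q.G.m_assoc)
      finally show ?thesis by (simp add: m_assoc)
    qed
    finally have "f h l \<otimes>\<^bsub>R\<^esub> f g (h \<otimes> l) = f g h \<otimes>\<^bsub>R\<^esub> f (g \<otimes> h) l"
      using f1 s by simp
    moreover have "k ?d \<in> carrier R" using hom_in_carrier[OF k d] Z by simp
    ultimately show ?thesis
      using 1 f1 q.G.r_cancel_one'[of "f g h \<otimes>\<^bsub>R\<^esub> f (g \<otimes> h) l" "k ?d"] by simp
  qed
  from bar_quotient_lift[OF gZ k this] obtain \<Phi> where
    \<Phi>: "\<Phi> \<in> hom (bar_quotient G) (R\<lparr>carrier := Z\<rparr>)"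
    and \<Phi>k: "\<And>c. c \<in> carrier (bar_chain_group G 2) \<Longrightarrow> \<Phi> (bar_class G c) = k c" by blast
  have \<Phi>c: "\<Phi> a \<in> Z" "\<Phi> a \<in> carrier R" if "a \<in> carrier (bar_quotient G)" for a
    using hom_in_carrier[OF \<Phi> that] Z by auto
  have \<Phi>m: "\<Phi> (a \<otimes>\<^bsub>bar_quotient G\<^esub> b) = \<Phi> a \<otimes>\<^bsub>R\<^esub> \<Phi> b"
    if "a \<in> carrier (bar_quotient G)" "b \<in> carrier (bar_quotient G)" for a b
    using hom_mult[OF \<Phi> that] by simp
  show ?thesis
  proof
    show "(\<lambda>x. \<Phi> (fst x) \<otimes>\<^bsub>R\<^esub> s (snd x)) \<in> hom bar_extension R"
    proof (rule homI; clarsimp)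
      fix a g b h
      assume [simp]: "a \<in> carrier (bar_quotient G)" "g \<in> carrier G"
        "b \<in> carrier (bar_quotient G)" "h \<in> carrier G"
      have fR: "f g h \<in> carrier R" using f(1) Z by simp
      have "\<Phi> (a \<otimes>\<^bsub>bar_quotient G\<^esub> b \<otimes>\<^bsub>bar_quotient G\<^esub> bar_class G (frag_of [g, h])) \<otimes>\<^bsub>R\<^esub> s (g \<otimes> h)
          = \<Phi> a \<otimes>\<^bsub>R\<^esub> \<Phi> b \<otimes>\<^bsub>R\<^esub> (f g h \<otimes>\<^bsub>R\<^esub> s (g \<otimes> h))"
        using \<Phi>c s fR by (simp add: \<Phi>m \<Phi>k kf q.G.m_assoc)
      also have "\<dots> = \<Phi> a \<otimes>\<^bsub>R\<^esub> (\<Phi> b \<otimes>\<^bsub>R\<^esub> s g) \<otimes>\<^bsub>R\<^esub> s h"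
        using \<Phi>c s by (simp add: f(2) q.G.m_assoc)
      also have "\<Phi> b \<otimes>\<^bsub>R\<^esub> s g = s g \<otimes>\<^bsub>R\<^esub> \<Phi> b"
        by (rule q.central) (use \<Phi>c(1)[of b] s(1)[of g] Z in auto)
      finally show "\<Phi> (a \<otimes>\<^bsub>bar_quotient G\<^esub> b \<otimes>\<^bsub>bar_quotient G\<^esub> bar_class G (frag_of [g, h])) \<otimes>\<^bsub>R\<^esub> s (g \<otimes> h)
          = \<Phi> a \<otimes>\<^bsub>R\<^esub> s g \<otimes>\<^bsub>R\<^esub> (\<Phi> b \<otimes>\<^bsub>R\<^esub> s h)"
        using \<Phi>c s by (simp add: q.G.m_assoc)
    qed (use \<Phi>c s in auto)
    show "q (\<Phi> (fst x) \<otimes>\<^bsub>R\<^esub> s (snd x)) = snd x" if "x \<in> carrier bar_extension" for x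
      using that \<Phi>c s Z by (cases x) simp
  qed
qed

text \<open>The boundary \<open>C\<^sub>2/B\<^sub>2 \<rightarrow> C\<^sub>1\<close> extends to all of the bar extension by \<open>(a, g) \<mapsto> \<partial>a + [g]\<close>: the
  value \<open>[h] - [g h] + [g]\<close> of \<open>\<partial>[g|h]\<close> is just the defect of \<open>g \<mapsto> [g]\<close> from being additive. As
  \<open>C\<^sub>1\<close> is abelian, only cycles can lie in the derived subgroup.\<close>
lemma bar_boundary_extension:
  obtains d where "d \<in> hom bar_extension (bar_chain_group G (Suc 0))"
    "\<And>c. c \<in> carrier (bar_chain_group G 2) \<Longrightarrow> d (bar_embedding (bar_class G c)) = bar_boundary G 2 c"
proof -
  interpret C1: comm_group "bar_chain_group G (Suc 0)" by (rule comm_group_chain)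
  interpret q: group_hom "bar_chain_group G 2" "bar_quotient G" "bar_class G"
    by (rule group_hom_bar_class)
  interpret b: group_hom "bar_chain_group G 2" "bar_chain_group G (Suc 0)" "bar_boundary G 2"
    by (rule group_hom_boundary_2)
  have "bar_boundary G 2 (bar_boundary G 3 (frag_of [g, h, k])) = \<one>\<^bsub>bar_chain_group G (Suc 0)\<^esub>"
    if "g \<in> carrier G" "h \<in> carrier G" "k \<in> carrier G" for g h k
    using bar_boundary_2_3[OF is_group, of "frag_of [g, h, k]"] that
    by (simp add: bar_chain_group_def)
  from bar_quotient_lift[OF C1.is_group b.homh this] obtain \<delta> where
    \<delta>: "\<delta> \<in> hom (bar_quotient G) (bar_chain_group G (Suc 0))"
    and \<delta>b: "\<And>c. c \<in> carrier (bar_chain_group G 2) \<Longrightarrow> \<delta> (bar_class G c) = bar_boundary G 2 c"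
    by blast
  interpret \<delta>: group_hom "bar_quotient G" "bar_chain_group G (Suc 0)" \<delta>
    by (rule group_homI[OF comm_group.axioms(2)[OF comm_group_bar_quotient] C1.is_group \<delta>])
  let ?d = "\<lambda>x. \<delta> (fst x) \<otimes>\<^bsub>bar_chain_group G (Suc 0)\<^esub> frag_of [snd x]"
  have gen: "frag_of [g] \<in> carrier (bar_chain_group G (Suc 0))" if "g \<in> carrier G" for g
    using that by (simp add: bar_chain_group_def)
  show ?thesis
  proof
    show "?d \<in> hom bar_extension (bar_chain_group G (Suc 0))"
    proof (rule homI)
      show "?d x \<in> carrier (bar_chain_group G (Suc 0))" if "x \<in> carrier bar_extension" for x
        using that by (intro C1.m_closed \<delta>.hom_closed gen) auto
    next
      fix x y assume "x \<in> carrier bar_extension" "y \<in> carrier bar_extension"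
      then obtain a g b h where xy: "x = (a, g)" "y = (b, h)" and
        [simp]: "a \<in> carrier (bar_quotient G)" "g \<in> carrier G"
        "b \<in> carrier (bar_quotient G)" "h \<in> carrier G" by auto
      show "?d (x \<otimes>\<^bsub>bar_extension\<^esub> y) = ?d x \<otimes>\<^bsub>bar_chain_group G (Suc 0)\<^esub> ?d y"
        by (simp add: xy \<delta>b bar_boundary_2) (simp add: chain_mult)
    qed
    fix c assume c: "c \<in> carrier (bar_chain_group G 2)"
    then have "bar_class G c \<in> carrier (bar_quotient G)" by simp
    then have "?d (bar_embedding (bar_class G c))
        = bar_boundary G 2 c \<otimes>\<^bsub>bar_chain_group G (Suc 0)\<^esub> inv\<^bsub>bar_chain_group G (Suc 0)\<^esub> frag_of [\<one>]
          \<otimes>\<^bsub>bar_chain_group G (Suc 0)\<^esub> frag_of [\<one>]"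
      using c by (simp add: bar.emb_def \<delta>b bar_boundary_2)
    also have "\<dots> = bar_boundary G 2 c"
      using c gen[of \<one>] b.hom_closed[of c] by (simp add: C1.m_assoc)
    finally show "?d (bar_embedding (bar_class G c)) = bar_boundary G 2 c" .
  qed
qed

text \<open>Conversely, in the abelianization of the bar extension the class of \<open>[g|h]\<close> equals
  \<open>\<tau>[g] \<cdot> \<tau>[h] \<cdot> \<tau>[g h]\<^sup>-\<^sup>1\<close>, where \<open>\<tau>[g]\<close> is the class of the standard lift \<open>(1, g)\<close>. Hence the
  embedding of \<open>C\<^sub>2\<close> into the abelianization factors as \<open>\<tau> \<circ> \<partial>\<close> and kills cycles.\<close>
lemma bar_cycle_in_derived:
  assumes "c \<in> bar_cycles G 2"
  shows "bar_embedding (bar_class G c) \<in> derived bar_extension (carrier bar_extension)"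
proof -
  interpret E: group bar_extension by (rule bar.group_ext)
  let ?D = "derived bar_extension (carrier bar_extension)"
  let ?Eab = "bar_extension Mod ?D"
  let ?cl = "\<lambda>x. ?D #>\<^bsub>bar_extension\<^esub> x"
  interpret ab: comm_group ?Eab by (rule E.derived_quot_is_comm_group)
  interpret D: normal ?D bar_extension by (rule E.derived_self_is_normal)
  interpret q: group_hom "bar_chain_group G 2" "bar_quotient G" "bar_class G"
    by (rule group_hom_bar_class)
  interpret b: group_hom "bar_chain_group G 2" "bar_chain_group G (Suc 0)" "bar_boundary G 2"
    by (rule group_hom_boundary_2)
  interpret cl: group_hom bar_extension ?Eab ?cl
    by (rule group_homI[OF E.is_group ab.is_group D.r_coset_hom_Mod])
  let ?l = "\<lambda>g. (\<one>\<^bsub>bar_quotient G\<^esub>, g)"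
  have "?cl (?l g) \<in> carrier ?Eab" if "g \<in> carrier G" for g
    by (rule cl.hom_closed) (use that in simp)
  then have "(\<lambda>xs. ?cl (?l (hd xs))) ` {xs. length xs = Suc 0 \<and> set xs \<subseteq> carrier G} \<subseteq> carrier ?Eab"
    by (auto simp del: bar.ext_simps simp: length_Suc_conv)
  from ab.free_Abelian_group_universal[OF this] obtain \<tau> where
    \<tau>: "\<tau> \<in> hom (free_Abelian_group {xs. length xs = Suc 0 \<and> set xs \<subseteq> carrier G}) ?Eab"
    "\<And>xs. xs \<in> {xs. length xs = Suc 0 \<and> set xs \<subseteq> carrier G} \<Longrightarrow> \<tau> (frag_of xs) = ?cl (?l (hd xs))"
    by blast
  have \<tau>l: "\<tau> (frag_of [g]) = ?cl (?l g)" if "g \<in> carrier G" for g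
    using \<tau>(2)[of "[g]"] that by simp
  note \<tau> = \<tau>(1)[folded bar_chain_group_def]
  interpret \<tau>: group_hom "bar_chain_group G (Suc 0)" ?Eab \<tau>
    by (rule group_homI[OF comm_group.axioms(2)[OF comm_group_chain] ab.is_group \<tau>])
  have "(\<tau> \<circ> bar_boundary G 2) c = (?cl \<circ> (bar_embedding \<circ> bar_class G)) c"
  proof (rule bar_chain_hom_unique[OF is_group ab.is_group])
    show "\<tau> \<circ> bar_boundary G 2 \<in> hom (bar_chain_group G 2) ?Eab"
      by (rule Group.hom_compose[OF b.homh \<tau>])
    show "?cl \<circ> (bar_embedding \<circ> bar_class G) \<in> hom (bar_chain_group G 2) ?Eab"
      by (rule Group.hom_compose[OF Group.hom_compose[OF q.homh bar.emb_hom] cl.homh])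
    show "c \<in> carrier (bar_chain_group G 2)" using assms by (simp add: cycles_iff)
    fix xs assume "length xs = 2" "set xs \<subseteq> carrier G"
    then obtain g h where xs: "xs = [g, h]" and [simp]: "g \<in> carrier G" "h \<in> carrier G"
      by (auto elim: length_2_cases)
    let ?e = "bar_embedding (bar_class G (frag_of [g, h]))"
    have e: "?e \<in> carrier bar_extension" by (rule bar.emb_closed) simp
    have l: "?l g \<in> carrier bar_extension" if "g \<in> carrier G" for g using that by simp
    have "?e \<otimes>\<^bsub>bar_extension\<^esub> ?l (g \<otimes> h) = ?l g \<otimes>\<^bsub>bar_extension\<^esub> ?l h"
      by (simp add: bar.emb_mult)
    then have 1: "?cl ?e \<otimes>\<^bsub>?Eab\<^esub> ?cl (?l (g \<otimes> h)) = ?cl (?l g) \<otimes>\<^bsub>?Eab\<^esub> ?cl (?l h)"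
      using cl.hom_mult[OF e l, of "g \<otimes> h"] cl.hom_mult[OF l l, of g h] by simp
    have gen: "frag_of [g] \<in> carrier (bar_chain_group G (Suc 0))" if "g \<in> carrier G" for g
      using that by (simp add: bar_chain_group_def)
    have d: "bar_boundary G 2 (frag_of [g, h]) \<in> carrier (bar_chain_group G (Suc 0))" by simp
    have "bar_boundary G 2 (frag_of [g, h]) \<otimes>\<^bsub>bar_chain_group G (Suc 0)\<^esub> frag_of [g \<otimes> h]
        = frag_of [g] \<otimes>\<^bsub>bar_chain_group G (Suc 0)\<^esub> frag_of [h]"
      by (simp add: bar_boundary_2 chain_mult)
    then have "\<tau> (bar_boundary G 2 (frag_of [g, h])) \<otimes>\<^bsub>?Eab\<^esub> \<tau> (frag_of [g \<otimes> h])
        = \<tau> (frag_of [g]) \<otimes>\<^bsub>?Eab\<^esub> \<tau> (frag_of [h])"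
      using \<tau>.hom_mult[OF d gen, of "g \<otimes> h"] \<tau>.hom_mult[OF gen gen, of g h] by simp
    then have "\<tau> (bar_boundary G 2 (frag_of [g, h])) \<otimes>\<^bsub>?Eab\<^esub> ?cl (?l (g \<otimes> h))
        = ?cl ?e \<otimes>\<^bsub>?Eab\<^esub> ?cl (?l (g \<otimes> h))"
      using 1 by (simp only: \<tau>l m_closed \<open>g \<in> carrier G\<close> \<open>h \<in> carrier G\<close>)
    then have "\<tau> (bar_boundary G 2 (frag_of [g, h])) = ?cl ?e"
      by (rule iffD1[OF ab.right_cancel, rotated -1])
        (rule cl.hom_closed[OF l] \<tau>.hom_closed[OF d] cl.hom_closed[OF e]; simp)+
    then show "(\<tau> \<circ> bar_boundary G 2) (frag_of xs) = (?cl \<circ> (bar_embedding \<circ> bar_class G)) (frag_of xs)"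
      unfolding xs comp_apply .
  qed
  moreover have "bar_boundary G 2 c = \<one>\<^bsub>bar_chain_group G (Suc 0)\<^esub>"
    using assms by (simp add: cycles_iff chain_one)
  ultimately have "?cl (bar_embedding (bar_class G c)) = ?D"
    using \<tau>.hom_one by simp
  moreover have "bar_embedding (bar_class G c) \<in> carrier bar_extension"
    by (rule bar.emb_closed) (use assms in \<open>simp add: cycles_iff\<close>)
  ultimately show ?thesis
    using E.coset_join1[OF _ _ D.subgroup_axioms] D.subset by simp
qed

theorem bar_embedding_derived_iff:
  assumes "a \<in> carrier (bar_quotient G)"
  shows "bar_embedding a \<in> derived bar_extension (carrier bar_extension)
    \<longleftrightarrow> a \<in> carrier (group_homology G 2)"
proof
  assume a: "bar_embedding a \<in> derived bar_extension (carrier bar_extension)"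
  obtain c where c: "c \<in> carrier (bar_chain_group G 2)" "a = bar_class G c"
    using assms by (auto simp: carrier_bar_quotient)
  obtain d where d: "d \<in> hom bar_extension (bar_chain_group G (Suc 0))"
    "\<And>c. c \<in> carrier (bar_chain_group G 2) \<Longrightarrow> d (bar_embedding (bar_class G c)) = bar_boundary G 2 c"
    using bar_boundary_extension by blast
  have "bar_boundary G 2 c = 0"
    using hom_comm_group_derived[OF bar.group_ext comm_group_chain d(1) a] d(2)[OF c(1)] c(2)
    by (simp add: chain_one)
  then show "a \<in> carrier (group_homology G 2)"
    using c by (auto simp: carrier_group_homology cycles_iff)
next
  assume "a \<in> carrier (group_homology G 2)"
  then show "bar_embedding a \<in> derived bar_extension (carrier bar_extension)"
    using bar_cycle_in_derived by (auto simp: carrier_group_homology)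
qed

end

section \<open>Hopf's formula\<close>

text \<open>The subgroup \<open>[F, N]\<close>.\<close>
definition mixed_commutator :: "('a, 'm) monoid_scheme \<Rightarrow> 'a set \<Rightarrow> 'a set" where
  "mixed_commutator F N = generate F
     {x \<otimes>\<^bsub>F\<^esub> y \<otimes>\<^bsub>F\<^esub> inv\<^bsub>F\<^esub> x \<otimes>\<^bsub>F\<^esub> inv\<^bsub>F\<^esub> y | x y. x \<in> carrier F \<and> y \<in> N}"

text \<open>Conjugation is an automorphism preserving \<open>N\<close>, hence permutes the generating commutators.\<close>
lemma (in normal) mixed_commutator_normal: "mixed_commutator G H \<lhd> G"
  unfolding mixed_commutator_def
proof (rule normal_generateI)
  show "{x \<otimes> y \<otimes> inv x \<otimes> inv y | x y. x \<in> carrier G \<and> y \<in> H} \<subseteq> carrier G"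
    by auto
  fix h g assume "h \<in> {x \<otimes> y \<otimes> inv x \<otimes> inv y | x y. x \<in> carrier G \<and> y \<in> H}"
    and g: "g \<in> carrier G"
  then obtain x y where h: "h = x \<otimes> y \<otimes> inv x \<otimes> inv y" and x: "x \<in> carrier G" and y: "y \<in> H"
    by blast
  have conj_mult: "g \<otimes> (u \<otimes> v) \<otimes> inv g = (g \<otimes> u \<otimes> inv g) \<otimes> (g \<otimes> v \<otimes> inv g)"
    if "u \<in> carrier G" "v \<in> carrier G" for u v
  proof -
    have "inv g \<otimes> (g \<otimes> (v \<otimes> inv g)) = v \<otimes> inv g"
      using g that by (simp flip: m_assoc)
    then show ?thesis using g that by (simp add: m_assoc)
  qed
  have conj_inv: "g \<otimes> inv u \<otimes> inv g = inv (g \<otimes> u \<otimes> inv g)" if "u \<in> carrier G" for u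
    using g that by (simp add: inv_mult_group m_assoc)
  let ?x = "g \<otimes> x \<otimes> inv g" and ?y = "g \<otimes> y \<otimes> inv g"
  have "g \<otimes> h \<otimes> inv g = ?x \<otimes> ?y \<otimes> inv ?x \<otimes> inv ?y"
    using x y by (simp only: h conj_mult conj_inv[symmetric] m_closed inv_closed mem_carrier)
  moreover have "?x \<in> carrier G" "?y \<in> H" using g x y inv_op_closed2 by auto
  ultimately show "g \<otimes> h \<otimes> inv g \<in> {x \<otimes> y \<otimes> inv x \<otimes> inv y | x y. x \<in> carrier G \<and> y \<in> H}"
    by blast
qed

lemma (in normal) mixed_commutator_subset: "mixed_commutator G H \<subseteq> H"
  unfolding mixed_commutator_def
proof (rule generate_subgroup_incl[OF _ subgroup_axioms])
  show "{x \<otimes> y \<otimes> inv x \<otimes> inv y | x y. x \<in> carrier G \<and> y \<in> H} \<subseteq> H"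
    using inv_op_closed2 by auto
qed

lemma (in normal) mixed_commutator_incl:
  "\<lbrakk>x \<in> carrier G; y \<in> H\<rbrakk> \<Longrightarrow> x \<otimes> y \<otimes> inv x \<otimes> inv y \<in> mixed_commutator G H"
  unfolding mixed_commutator_def by (rule generate.incl) blast

locale group_surjection = group_hom F G \<phi>
  for F (structure) and G (structure) and \<phi> +
  assumes surj: "\<phi> ` carrier F = carrier G"
begin

definition "N = kernel F G \<phi>"

definition "M = mixed_commutator F N"

lemma N_iff: "x \<in> N \<longleftrightarrow> x \<in> carrier F \<and> \<phi> x = \<one>\<^bsub>G\<^esub>"
  by (simp add: N_def kernel_def)

lemma normal_N: "N \<lhd> F"
  unfolding N_def by (rule normal_kernel)

lemma normal_M: "M \<lhd> F"
  unfolding M_def by (rule normal.mixed_commutator_normal[OF normal_N])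

interpretation N: normal N F by (rule normal_N)
interpretation M: normal M F by (rule normal_M)

lemma M_subset_N: "M \<subseteq> N"
  unfolding M_def by (rule N.mixed_commutator_subset)

abbreviation "R \<equiv> F Mod M"
abbreviation "cl \<equiv> \<lambda>x. M #>\<^bsub>F\<^esub> x"

lemma cl_hom: "group_hom F R cl"
  by (rule M.group_hom_coset)

lemma cl_eq_one: "x \<in> carrier F \<Longrightarrow> cl x = \<one>\<^bsub>R\<^esub> \<longleftrightarrow> x \<in> M"
  by (rule M.coset_eq_one_iff)

text \<open>Dividing by \<open>[F, N]\<close> makes the kernel \<open>N\<close> central.\<close>
lemma central_quotient:
  obtains q where "central_extension R G q" "\<And>x. x \<in> carrier F \<Longrightarrow> q (cl x) = \<phi> x"
proof -
  interpret cl: group_hom F R cl by (rule cl_hom)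
  obtain q where q: "q \<in> hom R G" "\<And>x. x \<in> carrier F \<Longrightarrow> q (cl x) = \<phi> x"
    using FactGroup_universal_kernel[OF M.normal_axioms] M_subset_N unfolding N_def by metis
  interpret q: group_hom R G q by (rule group_homI[OF cl.H.is_group H.is_group q(1)])
  have "central_extension R G q"
  proof
    have "q ` carrier R = \<phi> ` carrier F"
      using q(2) by (force simp: carrier_FactGroup)
    then show "q ` carrier R = carrier G" using surj by simp
    fix z x assume z: "z \<in> carrier R" "q z = \<one>\<^bsub>G\<^esub>" and x: "x \<in> carrier R"
    then obtain y w where y: "y \<in> carrier F" "z = cl y" and w: "w \<in> carrier F" "x = cl w"
      by (auto simp: carrier_FactGroup)
    have "y \<in> N" using y z(2) q(2) by (simp add: N_iff)
    then have "w \<otimes>\<^bsub>F\<^esub> y \<otimes>\<^bsub>F\<^esub> inv\<^bsub>F\<^esub> w \<otimes>\<^bsub>F\<^esub> inv\<^bsub>F\<^esub> y \<in> M"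
      unfolding M_def using w(1) by (rule N.mixed_commutator_incl[rotated])
    then have "cl (w \<otimes>\<^bsub>F\<^esub> y \<otimes>\<^bsub>F\<^esub> inv\<^bsub>F\<^esub> w \<otimes>\<^bsub>F\<^esub> inv\<^bsub>F\<^esub> y) = \<one>\<^bsub>R\<^esub>"
      using y w by (subst cl_eq_one) auto
    then have "cl w \<otimes>\<^bsub>R\<^esub> cl y \<otimes>\<^bsub>R\<^esub> inv\<^bsub>R\<^esub> cl w \<otimes>\<^bsub>R\<^esub> inv\<^bsub>R\<^esub> cl y = \<one>\<^bsub>R\<^esub>"
      using y(1) w(1) by (simp only: cl.hom_mult cl.hom_inv G.m_closed G.inv_closed)
    then show "z \<otimes>\<^bsub>R\<^esub> x = x \<otimes>\<^bsub>R\<^esub> z"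
      using cl.H.commutator_eq_one[OF cl.hom_closed[OF w(1)] cl.hom_closed[OF y(1)]] y w by metis
  qed
  with q(2) show ?thesis using that by blast
qed

text \<open>Hopf's formula \<open>H\<^sub>2(G) \<cong> (N \<inter> [F,F])/[F,N]\<close>. A lift \<open>\<theta>\<close> of \<open>\<phi>\<close> to the bar extension kills
  \<open>M\<close> and maps \<open>N \<inter> [F,F]\<close> into that part of the derived subgroup which lies over \<open>1\<close>, a copy of
  \<open>H\<^sub>2(G)\<close>; this defines \<open>\<omega>\<close>. Composing with a map \<open>\<Psi>\<close> from the bar extension to \<open>F/M\<close> recovers the coset of an element of
  \<open>[F,F]\<close>, so nothing outside \<open>M\<close> is killed; the opposite composite is the identity on the derived
  subgroup, so every homology class is attained.\<close>
theorem hopf_formula: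
  assumes "free_basis F S"
  obtains \<omega> where
    "\<omega> \<in> hom (F\<lparr>carrier := N \<inter> derived F (carrier F)\<rparr>) (group_homology G 2)"
    "\<omega> ` (N \<inter> derived F (carrier F)) = carrier (group_homology G 2)"
    "\<And>x. x \<in> N \<inter> derived F (carrier F) \<Longrightarrow> \<omega> x = \<one>\<^bsub>group_homology G 2\<^esub> \<longleftrightarrow> x \<in> M"
proof -
  let ?DF = "derived F (carrier F)"
  let ?E = "H.bar_extension" and ?e = "H.bar_embedding"
  let ?DE = "derived ?E (carrier ?E)"
  let ?A = "bar_quotient G"
  interpret bar: cocycle ?A G "\<lambda>g h. bar_class G (frag_of [g, h])"
    by (rule H.bar_cocycle)
  interpret E: central_extension ?E G snd by (rule bar.central_extension_ext)
  interpret e: group_hom ?A ?E ?e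
    by (rule group_homI[OF bar.A.is_group E.G.is_group bar.emb_hom])
  interpret cl: group_hom F R cl by (rule cl_hom)
  obtain q where "central_extension R G q" and q: "\<And>x. x \<in> carrier F \<Longrightarrow> q (cl x) = \<phi> x"
    using central_quotient by blast
  then interpret q: central_extension R G q by simp
  obtain \<theta> where "\<theta> \<in> hom F ?E" and \<theta>: "\<And>x. x \<in> carrier F \<Longrightarrow> snd (\<theta> x) = \<phi> x"
    using free_group_lift[OF G.is_group assms homh E.G.is_group E.homh E.surj H.is_group] by blast
  then interpret \<theta>: group_hom F ?E \<theta> by (intro group_homI G.is_group E.G.is_group)
  obtain \<Psi> where "\<Psi> \<in> hom ?E R" and \<Psi>: "\<And>x. x \<in> carrier ?E \<Longrightarrow> q (\<Psi> x) = snd x"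
    using H.bar_extension_versal[OF q.central_extension_axioms] by blast
  then interpret \<Psi>: group_hom ?E R \<Psi> by (intro group_homI E.G.is_group cl.H.is_group)
  have "\<theta> x = \<one>\<^bsub>?E\<^esub>" if "x \<in> M" for x
  proof -
    have "M \<subseteq> kernel F ?E \<theta>"
      unfolding M_def mixed_commutator_def
    proof (rule G.generate_subgroup_incl[OF _ \<theta>.subgroup_kernel], clarsimp)
      fix a b assume a: "a \<in> carrier F" and "b \<in> N"
      then have b: "b \<in> carrier F" "\<phi> b = \<one>\<^bsub>G\<^esub>" by (auto simp: N_iff)
      have "\<theta> b \<otimes>\<^bsub>?E\<^esub> \<theta> a = \<theta> a \<otimes>\<^bsub>?E\<^esub> \<theta> b"
        by (rule E.central) (use a b \<theta> in \<open>auto simp del: bar.ext_simps\<close>)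
      then have "\<theta> a \<otimes>\<^bsub>?E\<^esub> \<theta> b \<otimes>\<^bsub>?E\<^esub> inv\<^bsub>?E\<^esub> \<theta> a \<otimes>\<^bsub>?E\<^esub> inv\<^bsub>?E\<^esub> \<theta> b = \<one>\<^bsub>?E\<^esub>"
        using E.G.commutator_eq_one[OF \<theta>.hom_closed[OF a] \<theta>.hom_closed[OF b(1)]] by simp
      then show "a \<otimes>\<^bsub>F\<^esub> b \<otimes>\<^bsub>F\<^esub> inv\<^bsub>F\<^esub> a \<otimes>\<^bsub>F\<^esub> inv\<^bsub>F\<^esub> b \<in> kernel F ?E \<theta>"
        using a b by (simp add: kernel_def del: bar.ext_simps)
    qed
    then show ?thesis using that by (auto simp: kernel_def)
  qed
  note \<theta>M = this
  then have "M \<subseteq> kernel F ?E \<theta>" using M.subset by (auto simp: kernel_def)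
  then obtain \<theta>' where "\<theta>' \<in> hom R ?E" and \<theta>': "\<And>x. x \<in> carrier F \<Longrightarrow> \<theta>' (cl x) = \<theta> x"
    using \<theta>.FactGroup_universal_kernel[OF M.normal_axioms] by blast
  then interpret \<theta>': group_hom R ?E \<theta>' by (intro group_homI cl.H.is_group E.G.is_group)

  have \<Psi>\<theta>: "\<Psi> (\<theta> x) = cl x" if "x \<in> ?DF" for x
  proof -
    have "(\<Psi> \<circ> \<theta>) x = cl x"
      by (rule q.homs_agree_on_derived[OF G.is_group Group.hom_compose[OF \<theta>.homh \<Psi>.homh] cl.homh _ that])
        (simp add: \<Psi>[OF \<theta>.hom_closed] \<theta> q del: bar.ext_simps)
    then show ?thesis by simp
  qed
  have \<theta>'\<Psi>: "\<theta>' (\<Psi> y) = y" if "y \<in> ?DE" for y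
  proof -
    have snd': "snd (\<theta>' r) = q r" if "r \<in> carrier R" for r
      using that by (auto simp: carrier_FactGroup \<theta>' \<theta> q)
    have "(\<theta>' \<circ> \<Psi>) y = id y"
    proof (rule E.homs_agree_on_derived[OF E.G.is_group Group.hom_compose[OF \<Psi>.homh \<theta>'.homh] _ _ that])
      show "id \<in> hom ?E ?E" by (simp add: hom_def)
      show "snd ((\<theta>' \<circ> \<Psi>) x) = snd (id x)" if "x \<in> carrier ?E" for x
        using \<Psi>[OF that] snd'[OF \<Psi>.hom_closed[OF that]] by simp
    qed
    then show ?thesis by simp
  qed

  have DF: "?DF \<subseteq> carrier F" by (rule G.derived_in_carrier) simp
  have \<theta>DE: "\<theta> x \<in> ?DE" if "x \<in> ?DF" for x
  proof -
    have "\<theta> ` ?DF = derived ?E (\<theta> ` carrier F)"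
      using \<theta>.derived_img[of "carrier F"] by simp
    also have "\<dots> \<subseteq> ?DE" by (rule E.G.mono_derived) (use \<theta>.hom_closed in blast)
    finally show ?thesis using that by blast
  qed
  have H2: "carrier (group_homology G 2) \<subseteq> carrier ?A"
    unfolding H.carrier_group_homology H.carrier_bar_quotient by (auto simp: H.cycles_iff)
  have "\<exists>a\<in>carrier (group_homology G 2). ?e a = \<theta> x" if x: "x \<in> N \<inter> ?DF" for x
  proof -
    have "\<theta> x \<in> carrier ?E" "snd (\<theta> x) = \<one>\<^bsub>G\<^esub>"
      using x \<theta> \<theta>.hom_closed[of x] by (auto simp: N_iff simp del: bar.ext_simps)
    then obtain a where a: "a \<in> carrier ?A" "\<theta> x = ?e a" by (rule bar.emb_onto)
    with \<theta>DE[of x] x H.bar_embedding_derived_iff[OF a(1)] show ?thesis by auto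
  qed
  then obtain \<omega> where \<omega>: "\<And>x. x \<in> N \<inter> ?DF \<Longrightarrow> \<omega> x \<in> carrier (group_homology G 2)"
    "\<And>x. x \<in> N \<inter> ?DF \<Longrightarrow> ?e (\<omega> x) = \<theta> x"
    by metis
  have \<omega>A: "\<omega> x \<in> carrier ?A" if "x \<in> N \<inter> ?DF" for x using \<omega>(1)[OF that] H2 by blast
  have mult: "\<omega> x \<otimes>\<^bsub>?A\<^esub> \<omega> y = \<omega> (x \<otimes>\<^bsub>F\<^esub> y)" if "x \<in> N \<inter> ?DF" "y \<in> N \<inter> ?DF" for x y
  proof -
    have "subgroup (N \<inter> ?DF) F"
      using G.subgroups_Inter_pair[OF N.subgroup_axioms G.derived_is_subgroup] by simp
    then have xy: "x \<otimes>\<^bsub>F\<^esub> y \<in> N \<inter> ?DF" by (rule subgroup.m_closed[OF _ that])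
    have "x \<in> carrier F" "y \<in> carrier F" using that by (auto simp: N_iff)
    then have "?e (\<omega> x \<otimes>\<^bsub>?A\<^esub> \<omega> y) = ?e (\<omega> (x \<otimes>\<^bsub>F\<^esub> y))"
      using that xy \<omega>(2) \<omega>A by (simp only: e.hom_mult \<theta>.hom_mult)
    then show ?thesis
      using inj_onD[OF bar.emb_inj] \<omega>A[OF xy] \<omega>A[OF that(1)] \<omega>A[OF that(2)] by blast
  qed
  show ?thesis
  proof
    show "\<omega> \<in> hom (F\<lparr>carrier := N \<inter> ?DF\<rparr>) (group_homology G 2)"
      by (rule homI) (use \<omega> mult in \<open>auto simp: H.group_homology_eq\<close>)
    show "\<omega> x = \<one>\<^bsub>group_homology G 2\<^esub> \<longleftrightarrow> x \<in> M" if x: "x \<in> N \<inter> ?DF" for x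
    proof -
      have "\<omega> x = \<one>\<^bsub>group_homology G 2\<^esub> \<longleftrightarrow> ?e (\<omega> x) = ?e \<one>\<^bsub>?A\<^esub>"
        using inj_onD[OF bar.emb_inj, of "\<omega> x" "\<one>\<^bsub>?A\<^esub>"] \<omega>A[OF x] by (auto simp: H.group_homology_eq)
      also have "\<dots> \<longleftrightarrow> \<theta> x = \<one>\<^bsub>?E\<^esub>"
        using \<omega>(2)[OF x] e.hom_one by simp
      also have "\<dots> \<longleftrightarrow> x \<in> M"
      proof
        assume "\<theta> x = \<one>\<^bsub>?E\<^esub>"
        then have "cl x = \<one>\<^bsub>R\<^esub>" using \<Psi>\<theta>[of x] x \<Psi>.hom_one by simp
        then show "x \<in> M" using cl_eq_one[of x] x DF by blast
      qed (rule \<theta>M)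
      finally show ?thesis .
    qed
    show "\<omega> ` (N \<inter> ?DF) = carrier (group_homology G 2)"
    proof
      show "\<omega> ` (N \<inter> ?DF) \<subseteq> carrier (group_homology G 2)" using \<omega>(1) by blast
      show "carrier (group_homology G 2) \<subseteq> \<omega> ` (N \<inter> ?DF)"
      proof
        fix a assume a: "a \<in> carrier (group_homology G 2)"
        then have aA: "a \<in> carrier ?A" using H2 by blast
        then have aD: "?e a \<in> ?DE" using a H.bar_embedding_derived_iff by blast
        have "\<Psi> ` ?DE \<subseteq> derived R (carrier R)"
        proof -
          have "\<Psi> ` ?DE = derived R (\<Psi> ` carrier ?E)"
            using \<Psi>.derived_img[of "carrier ?E"] by (metis order_refl)
          also have "\<dots> \<subseteq> derived R (carrier R)"
            by (rule cl.H.mono_derived) (use \<Psi>.hom_closed in blast)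
          finally show ?thesis .
        qed
        also have "derived R (carrier R) = cl ` ?DF"
          using cl.derived_img[of "carrier F"] by (simp add: carrier_FactGroup)
        finally obtain x where x: "x \<in> ?DF" "cl x = \<Psi> (?e a)" using aD by blast
        have xF: "x \<in> carrier F" using x DF by blast
        have "\<phi> x = snd (?e a)" using q[OF xF] \<Psi>[OF e.hom_closed[OF aA]] x(2) by simp
        then have xN: "x \<in> N \<inter> ?DF" using x xF by (simp add: N_iff bar.emb_def)
        have "\<theta> x = ?e a" using \<theta>'[OF xF] x(2) \<theta>'\<Psi>[OF aD] by simp
        then have "\<omega> x = a" using inj_onD[OF bar.emb_inj] \<omega>A[OF xN] aA \<omega>(2)[OF xN] by metis
        then show "a \<in> \<omega> ` (N \<inter> ?DF)" using xN by blast
      qed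
    qed
  qed
qed

end

section \<open>Ordered products\<close>

definition ordered_product :: "('a, 'm) monoid_scheme \<Rightarrow> nat \<Rightarrow> (nat \<Rightarrow> 'a) \<Rightarrow> 'a" where
  "ordered_product G n a = foldr (\<otimes>\<^bsub>G\<^esub>) (map a [0..<n]) \<one>\<^bsub>G\<^esub>"

lemma ordered_product_cong:
  "(\<And>i. i < n \<Longrightarrow> a i = b i) \<Longrightarrow> ordered_product G n a = ordered_product G n b"
  unfolding ordered_product_def by (intro arg_cong2[where f = "foldr _"] map_cong) auto

lemma ordered_product_restrict [simp]:
  "ordered_product G n (restrict a {..<n}) = ordered_product G n a"
  by (rule ordered_product_cong) simp

lemma ordered_product_carrier [simp]:
  "ordered_product (G\<lparr>carrier := H\<rparr>) n a = ordered_product G n a"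
  by (simp add: ordered_product_def)

lemma ordered_product_0 [simp]: "ordered_product G 0 a = \<one>\<^bsub>G\<^esub>"
  by (simp add: ordered_product_def)

context group
begin

lemma foldr_mult_shift:
  assumes "set xs \<subseteq> carrier G" "y \<in> carrier G"
  shows "foldr (\<otimes>) xs y = foldr (\<otimes>) xs \<one> \<otimes> y \<and> foldr (\<otimes>) xs \<one> \<in> carrier G"
  using assms(1)
proof (induction xs)
  case (Cons x xs)
  then have "x \<in> carrier G" "foldr (\<otimes>) xs \<one> \<in> carrier G"
    "foldr (\<otimes>) xs y = foldr (\<otimes>) xs \<one> \<otimes> y" by auto
  then show ?case using assms(2) by (simp add: m_assoc)
qed (use assms(2) in simp)

lemma ordered_product_closed [simp, intro]:
  "(\<And>i. i < n \<Longrightarrow> a i \<in> carrier G) \<Longrightarrow> ordered_product G n a \<in> carrier G"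
  unfolding ordered_product_def
  by (intro foldr_mult_shift[THEN conjunct2] one_closed) (auto simp: image_subset_iff)

lemma ordered_product_Suc:
  assumes "\<And>i. i < Suc n \<Longrightarrow> a i \<in> carrier G"
  shows "ordered_product G (Suc n) a = ordered_product G n a \<otimes> a n"
proof -
  have "set (map a [0..<n]) \<subseteq> carrier G" using assms by auto
  then show ?thesis
    using foldr_mult_shift[of "map a [0..<n]" "a n"] assms by (simp add: ordered_product_def)
qed

lemma ordered_product_1: "a 0 \<in> carrier G \<Longrightarrow> ordered_product G (Suc 0) a = a 0"
  by (simp add: ordered_product_def)

text \<open>Central factors can be moved past the others. This makes the product of the components
  multiplicative on tuples from a central subgroup although it is not on \<open>G\<^sup>n\<close>.\<close>
lemma ordered_product_mult_central:
  assumes "\<And>i. i < n \<Longrightarrow> z i \<in> carrier G" "\<And>i. i < n \<Longrightarrow> y i \<in> carrier G"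
    and "\<And>i x. \<lbrakk>i < n; x \<in> carrier G\<rbrakk> \<Longrightarrow> z i \<otimes> x = x \<otimes> z i"
  shows "ordered_product G n (\<lambda>i. z i \<otimes> y i) = ordered_product G n z \<otimes> ordered_product G n y"
  using assms
proof (induction n)
  case (Suc n)
  let ?z = "ordered_product G n z" and ?y = "ordered_product G n y"
  have c: "?z \<in> carrier G" "?y \<in> carrier G" "z n \<in> carrier G" "y n \<in> carrier G"
    using Suc.prems(1,2) by auto
  have "ordered_product G (Suc n) (\<lambda>i. z i \<otimes> y i) = ?z \<otimes> ?y \<otimes> (z n \<otimes> y n)"
    using Suc by (simp add: ordered_product_Suc)
  also have "\<dots> = ?z \<otimes> (?y \<otimes> z n) \<otimes> y n" using c by (simp add: m_assoc)
  also have "?y \<otimes> z n = z n \<otimes> ?y" using Suc.prems(3)[of n ?y] c by simp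
  also have "?z \<otimes> (z n \<otimes> ?y) \<otimes> y n = (?z \<otimes> z n) \<otimes> (?y \<otimes> y n)" using c by (simp add: m_assoc)
  finally show ?case using Suc.prems(1,2) by (simp add: ordered_product_Suc)
qed simp

text \<open>Correcting the first component by a factor on the left changes the product of a tuple to any
  prescribed value.\<close>
lemma ordered_product_multiply_first:
  assumes "n > 0" "x \<in> carrier G" "\<And>i. i < n \<Longrightarrow> a i \<in> carrier G"
  shows "ordered_product G n (\<lambda>i. if i = 0 then x \<otimes> a 0 else a i) = x \<otimes> ordered_product G n a"
  using assms
proof (induction n)
  case (Suc n)
  let ?b = "\<lambda>i. if i = 0 then x \<otimes> a 0 else a i"
  have "ordered_product G (Suc n) ?b = ordered_product G n ?b \<otimes> ?b n"
    by (rule ordered_product_Suc) (use Suc.prems in auto)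
  then show ?case
    using Suc by (cases "n = 0") (simp_all add: ordered_product_1 ordered_product_Suc m_assoc)
qed simp

end

lemma (in group_hom) hom_ordered_product:
  assumes "\<And>i. i < n \<Longrightarrow> a i \<in> carrier G"
  shows "h (ordered_product G n a) = ordered_product H n (\<lambda>i. h (a i))"
  using assms by (induction n) (simp_all add: G.ordered_product_Suc H.ordered_product_Suc)

text \<open>All explicit elements of \<open>\<K>(F,n)\<close> below have the form \<open>(x, 1, \<dots>, 1, y, 1, \<dots>, 1)\<close>, with \<open>y\<close> in
  position \<open>j > 0\<close>; counting starts at \<open>0\<close>.\<close>

definition two_slots :: "('a, 'm) monoid_scheme \<Rightarrow> nat \<Rightarrow> nat \<Rightarrow> 'a \<Rightarrow> 'a \<Rightarrow> nat \<Rightarrow> 'a" where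
  "two_slots G n j x y = (\<lambda>i\<in>{..<n}. if i = 0 then x else if i = j then y else \<one>\<^bsub>G\<^esub>)"

context group
begin

lemma two_slots_in: "\<lbrakk>subgroup H G; x \<in> H; y \<in> H\<rbrakk> \<Longrightarrow> two_slots G n j x y \<in> {..<n} \<rightarrow>\<^sub>E H"
  by (auto simp: two_slots_def subgroup.one_closed)

lemma two_slots_mult:
  assumes "x \<in> carrier G" "y \<in> carrier G" "x' \<in> carrier G" "y' \<in> carrier G"
  shows "two_slots G n j x y \<otimes>\<^bsub>power_group G n\<^esub> two_slots G n j x' y'
    = two_slots G n j (x \<otimes> x') (y \<otimes> y')"
  using assms by (auto simp: two_slots_def fun_eq_iff)

lemma ordered_product_two_slots:
  assumes "x \<in> carrier G" "y \<in> carrier G" "0 < j" "j < n"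
  shows "ordered_product G n (two_slots G n j x y) = x \<otimes> y"
proof -
  let ?a = "\<lambda>i. if i = 0 then x else if i = j then y else \<one>"
  have 1: "ordered_product G (Suc m) ?a = x \<otimes> (if j < Suc m then y else \<one>)" for m
  proof (induction m)
    case 0
    then show ?case using assms by (simp add: ordered_product_Suc)
  next
    case (Suc m)
    have "ordered_product G (Suc (Suc m)) ?a = ordered_product G (Suc m) ?a \<otimes> ?a (Suc m)"
      by (rule ordered_product_Suc) (use assms in auto)
    then show ?case unfolding Suc using assms by (auto simp: m_assoc)
  qed
  obtain m where n: "n = Suc m" using assms(4) by (cases n) auto
  show ?thesis
    unfolding two_slots_def ordered_product_restrict n 1 using assms n by simp
qed

lemma group_power: "group (power_group G n)"
  by (simp add: is_group)

lemma two_slots_hom: "(\<lambda>x. two_slots G n j x \<one>) \<in> hom G (power_group G n)"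
proof (rule homI)
  show "two_slots G n j x \<one> \<in> carrier (power_group G n)" if "x \<in> carrier G" for x
    using two_slots_in[OF subgroup_self that one_closed] by simp
  show "two_slots G n j (x \<otimes> y) \<one>
      = two_slots G n j x \<one> \<otimes>\<^bsub>power_group G n\<^esub> two_slots G n j y \<one>"
    if "x \<in> carrier G" "y \<in> carrier G" for x y
    using two_slots_mult[of x \<one> y \<one> n j] that by simp
qed

end

section \<open>The groups \<open>\<K>(G,n)\<close>\<close>

context group
begin

text \<open>In the abelianization all components commute, so multiplying them out is a homomorphism.\<close>
lemma ab_product_hom: "ab_product G n \<in> hom (power_group G n) (abelianization G)"
proof -
  let ?D = "derived G (carrier G)"
  interpret Q: comm_group "abelianization G"
    unfolding abelianization_def by (rule derived_quot_is_comm_group)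
  interpret q: group_hom G "abelianization G" "\<lambda>x. ?D #> x"
    unfolding abelianization_def
    by (rule group_homI[OF is_group derived_quot_is_group
          normal.r_coset_hom_Mod[OF derived_self_is_normal]])
  have eq: "ab_product G n x = ordered_product (abelianization G) n (\<lambda>i. ?D #> x i)"
    if "x \<in> carrier (power_group G n)" for x
  proof -
    have "?D #> ordered_product G n x = ordered_product (abelianization G) n (\<lambda>i. ?D #> x i)"
      by (rule q.hom_ordered_product) (use that in auto)
    then show ?thesis by (simp add: ab_product_def ordered_product_def)
  qed
  show ?thesis
  proof (rule homI)
    fix x assume xc: "x \<in> carrier (power_group G n)"
    then have x: "x i \<in> carrier G" if "i < n" for i using that by auto
    show "ab_product G n x \<in> carrier (abelianization G)"
      unfolding eq[OF xc] by (rule Q.ordered_product_closed) (rule q.hom_closed[OF x])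
    fix y assume yc: "y \<in> carrier (power_group G n)"
    then have y: "y i \<in> carrier G" if "i < n" for i using that by auto
    have xy: "(x \<otimes>\<^bsub>power_group G n\<^esub> y) i = x i \<otimes> y i" if "i < n" for i using that by simp
    have "ab_product G n (x \<otimes>\<^bsub>power_group G n\<^esub> y)
        = ordered_product (abelianization G) n (\<lambda>i. (?D #> x i) \<otimes>\<^bsub>abelianization G\<^esub> (?D #> y i))"
      unfolding eq[OF monoid.m_closed[OF group.is_monoid[OF group_power] xc yc]]
      by (rule ordered_product_cong) (simp only: xy q.hom_mult x y)
    also have "\<dots> = ab_product G n x \<otimes>\<^bsub>abelianization G\<^esub> ab_product G n y"
      unfolding eq[OF xc] eq[OF yc]
    proof (rule Q.ordered_product_mult_central)
      fix i assume i: "i < n"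
      show "?D #> x i \<in> carrier (abelianization G)" by (rule q.hom_closed[OF x[OF i]])
      show "?D #> y i \<in> carrier (abelianization G)" by (rule q.hom_closed[OF y[OF i]])
      show "(?D #> x i) \<otimes>\<^bsub>abelianization G\<^esub> z = z \<otimes>\<^bsub>abelianization G\<^esub> (?D #> x i)"
        if "z \<in> carrier (abelianization G)" for z
        by (rule Q.m_comm[OF q.hom_closed[OF x[OF i]] that])
    qed
    finally show "ab_product G n (x \<otimes>\<^bsub>power_group G n\<^esub> y)
        = ab_product G n x \<otimes>\<^bsub>abelianization G\<^esub> ab_product G n y" .
  qed
qed

lemma K_set_iff:
  "x \<in> K_set G n \<longleftrightarrow> x \<in> {..<n} \<rightarrow>\<^sub>E carrier G \<and> ordered_product G n x \<in> derived G (carrier G)"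
proof -
  have "derived G (carrier G) #> y = derived G (carrier G) \<longleftrightarrow> y \<in> derived G (carrier G)"
    if "y \<in> carrier G" for y
    using coset_join1[OF _ that derived_is_subgroup] coset_join2[OF that derived_is_subgroup] by blast
  moreover have "ordered_product G n x \<in> carrier G" if "x \<in> {..<n} \<rightarrow>\<^sub>E carrier G"
    using that by (intro ordered_product_closed) auto
  ultimately show ?thesis
    by (auto simp: K_set_def kernel_def ab_product_def abelianization_def ordered_product_def)
qed

lemma subgroup_K_set: "subgroup (K_set G n) (power_group G n)"
proof -
  interpret group_hom "power_group G n" "abelianization G" "ab_product G n"
    using ab_product_hom derived_quot_is_group
    by (intro group_homI) (simp_all add: abelianization_def is_group)
  show ?thesis unfolding K_set_def by (rule subgroup_kernel)
qed

lemma group_K_group: "group (K_group G n)"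
  unfolding K_group_def by (rule group.subgroup_imp_group[OF group_power subgroup_K_set])

lemma K_group_simps [simp]:
  "carrier (K_group G n) = K_set G n"
  "x \<otimes>\<^bsub>K_group G n\<^esub> y = (\<lambda>i\<in>{..<n}. x i \<otimes> y i)"
  "\<one>\<^bsub>K_group G n\<^esub> = (\<lambda>i\<in>{..<n}. \<one>)"
  by (simp_all add: K_group_def)

end

lemma (in group_hom) K_group_hom:
  "(\<lambda>a. \<lambda>i\<in>{..<n}. h (a i)) \<in> hom (K_group G n) (K_group H n)"
proof (rule homI)
  fix a assume "a \<in> carrier (K_group G n)"
  then have a: "\<And>i. i < n \<Longrightarrow> a i \<in> carrier G" "ordered_product G n a \<in> derived G (carrier G)"
    by (auto simp: G.K_set_iff)
  then show "(\<lambda>i\<in>{..<n}. h (a i)) \<in> carrier (K_group H n)"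
    using image_derived_subset[OF a(2)] hom_ordered_product[of n a, OF a(1)]
    by (auto simp: H.K_set_iff)
  fix b assume "b \<in> carrier (K_group G n)"
  then have b: "\<And>i. i < n \<Longrightarrow> b i \<in> carrier G" by (auto simp: G.K_set_iff)
  show "(\<lambda>i\<in>{..<n}. h ((a \<otimes>\<^bsub>K_group G n\<^esub> b) i))
    = (\<lambda>i\<in>{..<n}. h (a i)) \<otimes>\<^bsub>K_group H n\<^esub> (\<lambda>i\<in>{..<n}. h (b i))"
    using a(1) b by (auto simp: fun_eq_iff)
qed

section \<open>The normal closure of \<open>\<K>(N,n)\<close>\<close>

context group_surjection
begin

interpretation N: normal N F by (rule normal_N)
interpretation M: normal M F by (rule normal_M)

text \<open>An explicit description of the normal closure of \<open>\<K>(N,n)\<close> in \<open>F\<^sup>n\<close>.\<close>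
definition "L n = {a \<in> {..<n} \<rightarrow>\<^sub>E N. ordered_product F n a \<in> M}"

lemma N_closed: "x \<in> N \<Longrightarrow> x \<in> carrier F"
  by (simp add: N_iff)

lemma cl_central:
  assumes "x \<in> N" "r \<in> carrier R"
  shows "cl x \<otimes>\<^bsub>R\<^esub> r = r \<otimes>\<^bsub>R\<^esub> cl x"
proof -
  interpret cl: group_hom F R cl by (rule cl_hom)
  obtain q where "central_extension R G q" and q: "\<And>x. x \<in> carrier F \<Longrightarrow> q (cl x) = \<phi> x"
    using central_quotient by blast
  then interpret q: central_extension R G q by simp
  show ?thesis
    by (rule q.central) (use assms q N_iff cl.hom_closed in auto)
qed

lemma ordered_product_in_M_iff:
  assumes "\<And>i. i < n \<Longrightarrow> a i \<in> carrier F"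
  shows "ordered_product F n a \<in> M \<longleftrightarrow> ordered_product R n (\<lambda>i. cl (a i)) = \<one>\<^bsub>R\<^esub>"
  using cl_eq_one[OF G.ordered_product_closed[OF assms]] group_hom.hom_ordered_product[OF cl_hom assms]
  by simp

text \<open>On \<open>N\<^sup>n\<close> the product of the components taken modulo \<open>M\<close> is a homomorphism, of which \<open>L\<close> is the
  kernel; and conjugation by \<open>F\<^sup>n\<close> leaves the components of a tuple in \<open>N\<^sup>n\<close> unchanged modulo \<open>M\<close>.\<close>
lemma normal_L: "L n \<lhd> power_group F n"
proof -
  interpret P: group "power_group F n" by (rule G.group_power)
  interpret cl: group_hom F R cl by (rule cl_hom)
  let ?NN = "{..<n} \<rightarrow>\<^sub>E N"
  let ?f = "\<lambda>a. ordered_product R n (\<lambda>i. cl (a i))"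
  have NN: "subgroup ?NN (power_group F n)"
    by (subst PiE_subgroup_product_group) (simp_all add: N.subgroup_axioms)
  have "?f \<in> hom (power_group F n\<lparr>carrier := ?NN\<rparr>) R"
  proof (rule homI)
    fix a assume "a \<in> carrier (power_group F n\<lparr>carrier := ?NN\<rparr>)"
    then have a: "a i \<in> N" if "i < n" for i using that by auto
    then have ac: "a i \<in> carrier F" if "i < n" for i using that N_closed by blast
    show "?f a \<in> carrier R"
      by (rule cl.H.ordered_product_closed) (rule cl.hom_closed[OF ac])
    fix b assume "b \<in> carrier (power_group F n\<lparr>carrier := ?NN\<rparr>)"
    then have "b i \<in> N" if "i < n" for i using that by auto
    then have bc: "b i \<in> carrier F" if "i < n" for i using that N_closed by blast
    have ab: "(a \<otimes>\<^bsub>power_group F n\<lparr>carrier := ?NN\<rparr>\<^esub> b) i = a i \<otimes>\<^bsub>F\<^esub> b i" if "i < n" for i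
      using that by simp
    have "?f (a \<otimes>\<^bsub>power_group F n\<lparr>carrier := ?NN\<rparr>\<^esub> b) = ordered_product R n (\<lambda>i. cl (a i) \<otimes>\<^bsub>R\<^esub> cl (b i))"
      by (rule ordered_product_cong) (simp only: ab cl.hom_mult ac bc)
    also have "\<dots> = ?f a \<otimes>\<^bsub>R\<^esub> ?f b"
      by (rule cl.H.ordered_product_mult_central)
        (fact cl.hom_closed[OF ac] cl.hom_closed[OF bc] cl_central[OF a])+
    finally show "?f (a \<otimes>\<^bsub>power_group F n\<lparr>carrier := ?NN\<rparr>\<^esub> b) = ?f a \<otimes>\<^bsub>R\<^esub> ?f b" .
  qed
  then interpret f: group_hom "power_group F n\<lparr>carrier := ?NN\<rparr>" R ?f
    by (rule group_homI[OF P.subgroup_imp_group[OF NN] cl.H.is_group])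
  have L_iff: "a \<in> L n \<longleftrightarrow> a \<in> ?NN \<and> ?f a = \<one>\<^bsub>R\<^esub>" for a
  proof -
    have "ordered_product F n a \<in> M \<longleftrightarrow> ?f a = \<one>\<^bsub>R\<^esub>" if "a \<in> ?NN"
      by (rule ordered_product_in_M_iff) (rule N_closed[OF PiE_mem[OF that]], simp)
    then show ?thesis unfolding L_def by blast
  qed
  then have "L n = kernel (power_group F n\<lparr>carrier := ?NN\<rparr>) R ?f"
    unfolding kernel_def by simp blast
  then have sub: "subgroup (L n) (power_group F n)"
    using P.incl_subgroup[OF NN] f.subgroup_kernel by simp
  show ?thesis
  proof (rule P.normal_invI[OF sub])
    fix g a assume "g \<in> carrier (power_group F n)" "a \<in> L n"
    then have g: "g i \<in> carrier F" and a: "a i \<in> N" if "i < n" for i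
      using that by (auto simp: L_def)
    let ?b = "g \<otimes>\<^bsub>power_group F n\<^esub> a \<otimes>\<^bsub>power_group F n\<^esub> inv\<^bsub>power_group F n\<^esub> g"
    have b: "?b = (\<lambda>i\<in>{..<n}. g i \<otimes>\<^bsub>F\<^esub> a i \<otimes>\<^bsub>F\<^esub> inv\<^bsub>F\<^esub> g i)"
      using \<open>g \<in> carrier (power_group F n)\<close> by (auto simp: fun_eq_iff)
    have "?f ?b = ?f a"
    proof (rule ordered_product_cong)
      fix i assume i: "i < n"
      have c: "cl (g i) \<in> carrier R" "cl (a i) \<in> carrier R"
        using cl.hom_closed g[OF i] N_closed[OF a[OF i]] by blast+
      have "cl (?b i) = cl (g i) \<otimes>\<^bsub>R\<^esub> cl (a i) \<otimes>\<^bsub>R\<^esub> inv\<^bsub>R\<^esub> cl (g i)"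
        unfolding b using i g[OF i] N_closed[OF a[OF i]] by (simp del: mult_FactGroup)
      also have "cl (g i) \<otimes>\<^bsub>R\<^esub> cl (a i) = cl (a i) \<otimes>\<^bsub>R\<^esub> cl (g i)"
        by (rule cl_central[OF a[OF i] c(1), symmetric])
      also have "\<dots> \<otimes>\<^bsub>R\<^esub> inv\<^bsub>R\<^esub> cl (g i) = cl (a i)"
        using c by (simp add: cl.H.m_assoc del: mult_FactGroup one_FactGroup)
      finally show "cl (?b i) = cl (a i)" .
    qed
    moreover have "?b \<in> ?NN"
      unfolding b using N.inv_op_closed2 g a by auto
    ultimately show "?b \<in> L n" using \<open>a \<in> L n\<close> by (simp add: L_iff)
  qed
qed

lemma derived_N_subset_M: "derived F N \<subseteq> M"
  unfolding derived_def M_def mixed_commutator_def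
  by (rule G.mono_generate) (use N_closed in blast)

lemma M_subset_derived: "M \<subseteq> derived F (carrier F)"
  unfolding derived_def M_def mixed_commutator_def
  by (rule G.mono_generate) (use N_closed in blast)

lemma K_set_N_iff:
  "x \<in> K_set (F\<lparr>carrier := N\<rparr>) n \<longleftrightarrow> x \<in> {..<n} \<rightarrow>\<^sub>E N \<and> ordered_product F n x \<in> derived F N"
  using group.K_set_iff[OF G.subgroup_imp_group[OF N.subgroup_axioms]]
    G.derived_consistent[OF order_refl N.subgroup_axioms]
  by simp

text \<open>Every tuple in \<open>N\<^sup>n\<close> is \<open>(c, 1, \<dots>, 1)\<close>, with \<open>c\<close> its product, up to a tuple with product \<open>1\<close>;
  the latter lies in \<open>\<K>(N,n)\<close>.\<close>
lemma split_first_slot: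
  assumes "n \<ge> 2" "a \<in> {..<n} \<rightarrow>\<^sub>E N"
  obtains b where "b \<in> {..<n} \<rightarrow>\<^sub>E N" "ordered_product F n b = \<one>\<^bsub>F\<^esub>"
    "a = two_slots F n 1 (ordered_product F n a) \<one>\<^bsub>F\<^esub> \<otimes>\<^bsub>power_group F n\<^esub> b"
    "ordered_product F n a \<in> N"
proof -
  let ?c = "ordered_product F n a"
  have a: "a i \<in> N" if "i < n" for i using assms that by auto
  have ac: "a i \<in> carrier F" if "i < n" for i using a[OF that] N_closed by blast
  have c: "?c \<in> N"
  proof -
    interpret gN: group "F\<lparr>carrier := N\<rparr>" by (rule G.subgroup_imp_group[OF N.subgroup_axioms])
    show ?thesis using gN.ordered_product_closed[of n a] a by simp
  qed
  then have cF: "?c \<in> carrier F" by (rule N_closed)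
  let ?b = "\<lambda>i. if i = 0 then inv\<^bsub>F\<^esub> ?c \<otimes>\<^bsub>F\<^esub> a 0 else a i"
  show ?thesis
  proof
    show "restrict ?b {..<n} \<in> {..<n} \<rightarrow>\<^sub>E N"
      using a c assms(1) by auto
    show "ordered_product F n (restrict ?b {..<n}) = \<one>\<^bsub>F\<^esub>"
      unfolding ordered_product_restrict
      using G.ordered_product_multiply_first[of n "inv\<^bsub>F\<^esub> ?c" a] assms(1) cF ac by simp
    show "a = two_slots F n 1 ?c \<one>\<^bsub>F\<^esub> \<otimes>\<^bsub>power_group F n\<^esub> restrict ?b {..<n}"
    proof
      fix i show "a i = (two_slots F n 1 ?c \<one>\<^bsub>F\<^esub> \<otimes>\<^bsub>power_group F n\<^esub> restrict ?b {..<n}) i"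
        using assms(2) cF ac[of i] G.m_assoc[of ?c "inv\<^bsub>F\<^esub> ?c" "a i"]
        by (cases "i < n") (auto simp: two_slots_def PiE_def extensional_def)
    qed
  qed (rule c)
qed

text \<open>One inclusion holds since \<open>[N,N] \<subseteq> [F,N]\<close>. For the other, a normal subgroup \<open>J\<close> containing
  \<open>\<K>(N,n)\<close> contains the commutators of \<open>(x, 1, \<dots>, 1)\<close> with \<open>(y, y\<^sup>-\<^sup>1, 1, \<dots>, 1)\<close> for \<open>x \<in> F\<close>,
  \<open>y \<in> N\<close>, hence all \<open>(c, 1, \<dots>, 1)\<close> with \<open>c \<in> M\<close>.\<close>
theorem normal_closure_K_set:
  assumes n: "n \<ge> 2"
  shows "normal_closure (power_group F n) (K_set (F\<lparr>carrier := N\<rparr>) n) = L n"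
proof
  show "normal_closure (power_group F n) (K_set (F\<lparr>carrier := N\<rparr>) n) \<subseteq> L n"
    unfolding normal_closure_def
    by (rule Inter_lower) (use normal_L derived_N_subset_M in \<open>auto simp: L_def K_set_N_iff\<close>)
  have "L n \<subseteq> J" if J: "J \<lhd> power_group F n" and K: "K_set (F\<lparr>carrier := N\<rparr>) n \<subseteq> J" for J
  proof
    interpret J: normal J "power_group F n" by (rule J)
    interpret s: group_hom F "power_group F n" "\<lambda>x. two_slots F n 1 x \<one>\<^bsub>F\<^esub>"
      by (rule group_homI[OF G.is_group G.group_power G.two_slots_hom])
    have one: "\<one>\<^bsub>F\<^esub> \<in> derived F N"
      using subgroup.one_closed[OF G.derived_is_subgroup[OF N.subset]] .
    have M: "M \<subseteq> {x \<in> carrier F. two_slots F n 1 x \<one>\<^bsub>F\<^esub> \<in> J}"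
      unfolding M_def mixed_commutator_def
    proof (rule G.generate_subgroup_incl[OF _ s.subgroup_preimage[OF J.subgroup_axioms]], clarify)
      fix x y assume x: "x \<in> carrier F" and yN: "y \<in> N"
      then have y: "y \<in> carrier F" using N_closed by blast
      let ?u = "two_slots F n 1 x \<one>\<^bsub>F\<^esub>" and ?s = "two_slots F n 1 y (inv\<^bsub>F\<^esub> y)"
      have "?s \<in> {..<n} \<rightarrow>\<^sub>E N"
        by (rule G.two_slots_in[OF N.subgroup_axioms]) (use yN in auto)
      then have "?s \<in> J"
        using K n y one by (auto simp: K_set_N_iff G.ordered_product_two_slots)
      then have "?u \<otimes>\<^bsub>power_group F n\<^esub> ?s \<otimes>\<^bsub>power_group F n\<^esub> inv\<^bsub>power_group F n\<^esub> ?u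
          \<otimes>\<^bsub>power_group F n\<^esub> inv\<^bsub>power_group F n\<^esub> ?s \<in> J"
        using s.hom_closed[OF x] J.inv_op_closed2 J.m_closed J.m_inv_closed by blast
      moreover have "inv\<^bsub>power_group F n\<^esub> ?u = two_slots F n 1 (inv\<^bsub>F\<^esub> x) \<one>\<^bsub>F\<^esub>"
        using s.hom_inv[OF x] by simp
      moreover have "inv\<^bsub>power_group F n\<^esub> ?s = two_slots F n 1 (inv\<^bsub>F\<^esub> y) y"
      proof (rule group.inv_equality[OF G.group_power])
        show "two_slots F n 1 (inv\<^bsub>F\<^esub> y) y \<otimes>\<^bsub>power_group F n\<^esub> ?s = \<one>\<^bsub>power_group F n\<^esub>"
          using y by (subst G.two_slots_mult) (auto simp: two_slots_def fun_eq_iff)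
      qed (use G.two_slots_in[OF G.subgroup_self] y in simp_all)
      ultimately have "two_slots F n 1 (x \<otimes>\<^bsub>F\<^esub> y \<otimes>\<^bsub>F\<^esub> inv\<^bsub>F\<^esub> x \<otimes>\<^bsub>F\<^esub> inv\<^bsub>F\<^esub> y) \<one>\<^bsub>F\<^esub> \<in> J"
        using x y by (simp add: G.two_slots_mult del: mult_product_group)
      then show "x \<otimes>\<^bsub>F\<^esub> y \<otimes>\<^bsub>F\<^esub> inv\<^bsub>F\<^esub> x \<otimes>\<^bsub>F\<^esub> inv\<^bsub>F\<^esub> y \<in> carrier F
          \<and> two_slots F n 1 (x \<otimes>\<^bsub>F\<^esub> y \<otimes>\<^bsub>F\<^esub> inv\<^bsub>F\<^esub> x \<otimes>\<^bsub>F\<^esub> inv\<^bsub>F\<^esub> y) \<one>\<^bsub>F\<^esub> \<in> J"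
        using x y by simp
    qed
    fix a assume "a \<in> L n"
    then have a: "a \<in> {..<n} \<rightarrow>\<^sub>E N" "ordered_product F n a \<in> M" by (auto simp: L_def)
    from n a(1) obtain b where b: "b \<in> {..<n} \<rightarrow>\<^sub>E N" "ordered_product F n b = \<one>\<^bsub>F\<^esub>"
      "a = two_slots F n 1 (ordered_product F n a) \<one>\<^bsub>F\<^esub> \<otimes>\<^bsub>power_group F n\<^esub> b"
      by (rule split_first_slot)
    have "b \<in> J" using K b(1,2) one by (auto simp: K_set_N_iff)
    moreover have "two_slots F n 1 (ordered_product F n a) \<one>\<^bsub>F\<^esub> \<in> J" using M a(2) by blast
    ultimately have "two_slots F n 1 (ordered_product F n a) \<one>\<^bsub>F\<^esub> \<otimes>\<^bsub>power_group F n\<^esub> b \<in> J"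
      using subgroup.m_closed[OF J.subgroup_axioms] by blast
    then show "a \<in> J" using b(3) by metis
  qed
  then show "L n \<subseteq> normal_closure (power_group F n) (K_set (F\<lparr>carrier := N\<rparr>) n)"
    unfolding normal_closure_def by blast
qed

end

section \<open>The central extension of \<open>\<K>(G,n)\<close>\<close>

context group_surjection
begin

interpretation N: normal N F by (rule normal_N)
interpretation M: normal M F by (rule normal_M)

lemma L_subset_K_set: "L n \<subseteq> K_set F n"
  using M_subset_derived N_closed by (auto simp: L_def G.K_set_iff PiE_iff)

lemma normal_L_K_group: "L n \<lhd> K_group F n"
  unfolding K_group_def
  by (rule group.normal_restrict_supergroup[OF G.group_power G.subgroup_K_set normal_L L_subset_K_set])

lemma K_tilde_eq: "n \<ge> 2 \<Longrightarrow> K_tilde F N n = K_group F n Mod L n"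
  by (simp add: K_tilde_def normal_closure_K_set)

abbreviation "kl n \<equiv> \<lambda>a. L n #>\<^bsub>K_group F n\<^esub> a"

lemma kl_hom: "group_hom (K_group F n) (K_group F n Mod L n) (kl n)"
  by (rule normal.group_hom_coset[OF normal_L_K_group])

lemma kl_absorb:
  assumes "l \<in> L n" "a \<in> K_set F n"
  shows "kl n (l \<otimes>\<^bsub>K_group F n\<^esub> a) = kl n a"
proof -
  interpret L: normal "L n" "K_group F n" by (rule normal_L_K_group)
  interpret kl: group_hom "K_group F n" "K_group F n Mod L n" "kl n" by (rule kl_hom)
  have l: "l \<in> carrier (K_group F n)" and a: "a \<in> carrier (K_group F n)"
    using assms L_subset_K_set by auto
  have "kl n l = \<one>\<^bsub>K_group F n Mod L n\<^esub>" using L.coset_eq_one_iff[OF l] assms(1) by blast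
  then show ?thesis
    using kl.hom_mult[OF l a] kl.hom_closed[OF a] kl.H.l_one by metis
qed

lemma first_slot_hom:
  assumes "n \<ge> 2"
  shows "group_hom (F\<lparr>carrier := N \<inter> derived F (carrier F)\<rparr>) (K_group F n)
    (\<lambda>x. two_slots F n 1 x \<one>\<^bsub>F\<^esub>)"
proof (rule group_homI)
  have sub: "subgroup (N \<inter> derived F (carrier F)) F"
    by (rule G.subgroups_Inter_pair[OF N.subgroup_axioms G.derived_is_subgroup]) simp
  show "group (F\<lparr>carrier := N \<inter> derived F (carrier F)\<rparr>)"
    by (rule G.subgroup_imp_group[OF sub])
  show "group (K_group F n)" by (rule G.group_K_group)
  show "(\<lambda>x. two_slots F n 1 x \<one>\<^bsub>F\<^esub>)
      \<in> hom (F\<lparr>carrier := N \<inter> derived F (carrier F)\<rparr>) (K_group F n)"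
  proof (rule homI)
    fix x assume "x \<in> carrier (F\<lparr>carrier := N \<inter> derived F (carrier F)\<rparr>)"
    then have x: "x \<in> carrier F" "x \<in> derived F (carrier F)" using N_closed by auto
    show "two_slots F n 1 x \<one>\<^bsub>F\<^esub> \<in> carrier (K_group F n)"
      using G.two_slots_in[OF G.subgroup_self x(1) G.one_closed] x assms
      by (simp add: G.K_set_iff G.ordered_product_two_slots)
    fix y assume "y \<in> carrier (F\<lparr>carrier := N \<inter> derived F (carrier F)\<rparr>)"
    then have y: "y \<in> carrier F" using N_closed by auto
    show "two_slots F n 1 (x \<otimes>\<^bsub>F\<lparr>carrier := N \<inter> derived F (carrier F)\<rparr>\<^esub> y) \<one>\<^bsub>F\<^esub>
        = two_slots F n 1 x \<one>\<^bsub>F\<^esub> \<otimes>\<^bsub>K_group F n\<^esub> two_slots F n 1 y \<one>\<^bsub>F\<^esub>"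
      using x(1) y G.two_slots_mult[of x "\<one>\<^bsub>F\<^esub>" y "\<one>\<^bsub>F\<^esub>" n 1]
      by (simp add: K_group_def del: mult_product_group)
  qed
qed

lemma first_slot_in_L_iff:
  assumes "n \<ge> 2" "x \<in> N"
  shows "two_slots F n 1 x \<one>\<^bsub>F\<^esub> \<in> L n \<longleftrightarrow> x \<in> M"
  using G.two_slots_in[OF N.subgroup_axioms assms(2) N.one_closed] N_closed[OF assms(2)] assms(1)
  by (simp add: L_def G.ordered_product_two_slots)

text \<open>The commutator of \<open>(x, 1, \<dots>, 1)\<close> with \<open>b\<close> is \<open>([x, b\<^sub>0], 1, \<dots>, 1)\<close>, and \<open>[x, b\<^sub>0] \<in> M\<close>.\<close>
lemma first_slot_central:
  assumes "n \<ge> 2" "x \<in> N \<inter> derived F (carrier F)" "b \<in> K_set F n"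
  shows "kl n (two_slots F n 1 x \<one>\<^bsub>F\<^esub> \<otimes>\<^bsub>K_group F n\<^esub> b)
    = kl n (b \<otimes>\<^bsub>K_group F n\<^esub> two_slots F n 1 x \<one>\<^bsub>F\<^esub>)"
proof -
  let ?u = "two_slots F n 1 x \<one>\<^bsub>F\<^esub>"
  let ?m = "x \<otimes>\<^bsub>F\<^esub> b 0 \<otimes>\<^bsub>F\<^esub> inv\<^bsub>F\<^esub> x \<otimes>\<^bsub>F\<^esub> inv\<^bsub>F\<^esub> b 0"
  interpret K: group "K_group F n" by (rule G.group_K_group)
  have b: "b i \<in> carrier F" if "i < n" for i
    using assms(3) that by (auto simp: G.K_set_iff)
  have x: "x \<in> carrier F" using assms(2) N_closed by auto
  have b0: "b 0 \<in> carrier F" using b assms(1) by simp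
  have "inv\<^bsub>F\<^esub> (b 0 \<otimes>\<^bsub>F\<^esub> x \<otimes>\<^bsub>F\<^esub> inv\<^bsub>F\<^esub> b 0 \<otimes>\<^bsub>F\<^esub> inv\<^bsub>F\<^esub> x) \<in> M"
    unfolding M_def by (rule subgroup.m_inv_closed[OF normal_imp_subgroup[OF N.mixed_commutator_normal]])
      (rule N.mixed_commutator_incl; use b0 assms(2) in simp)
  also have "inv\<^bsub>F\<^esub> (b 0 \<otimes>\<^bsub>F\<^esub> x \<otimes>\<^bsub>F\<^esub> inv\<^bsub>F\<^esub> b 0 \<otimes>\<^bsub>F\<^esub> inv\<^bsub>F\<^esub> x) = ?m"
    using b0 x by (simp add: G.inv_mult_group G.m_assoc)
  finally have m: "?m \<in> M" .
  then have l: "two_slots F n 1 ?m \<one>\<^bsub>F\<^esub> \<in> L n"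
    using first_slot_in_L_iff[OF assms(1)] M_subset_N by blast
  interpret s: group_hom "F\<lparr>carrier := N \<inter> derived F (carrier F)\<rparr>" "K_group F n"
    "\<lambda>x. two_slots F n 1 x \<one>\<^bsub>F\<^esub>" by (rule first_slot_hom[OF assms(1)])
  have u: "?u \<in> carrier (K_group F n)" using s.hom_closed assms(2) by simp
  have bu: "b \<otimes>\<^bsub>K_group F n\<^esub> ?u \<in> K_set F n"
    using K.m_closed[OF _ u, of b] assms(3) by (simp only: G.K_group_simps)
  have "?u \<otimes>\<^bsub>K_group F n\<^esub> b = two_slots F n 1 ?m \<one>\<^bsub>F\<^esub> \<otimes>\<^bsub>K_group F n\<^esub> (b \<otimes>\<^bsub>K_group F n\<^esub> ?u)"
  proof -
    have "inv\<^bsub>F\<^esub> b 0 \<otimes>\<^bsub>F\<^esub> (b 0 \<otimes>\<^bsub>F\<^esub> x) = x"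
      using b0 x by (simp flip: G.m_assoc)
    then have "?m \<otimes>\<^bsub>F\<^esub> (b 0 \<otimes>\<^bsub>F\<^esub> x) = x \<otimes>\<^bsub>F\<^esub> b 0"
      using b0 x by (simp add: G.m_assoc)
    then show ?thesis using b x by (auto simp: two_slots_def fun_eq_iff)
  qed
  then show ?thesis using kl_absorb[OF l bu] by simp
qed

text \<open>Componentwise lifts of a tuple in \<open>\<K>(G,n)\<close> have a product in \<open>N [F,F]\<close>; an element of \<open>N\<close> put
  into the first component brings it into \<open>[F,F]\<close>.\<close>
lemma K_group_map_surj:
  assumes "n > 0" "y \<in> K_set G n"
  obtains a where "a \<in> K_set F n" "(\<lambda>i\<in>{..<n}. \<phi> (a i)) = y"
proof -
  have y: "y i \<in> carrier G" if "i < n" for i using assms(2) that by (auto simp: H.K_set_iff)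
  have "\<forall>i\<in>{..<n}. \<exists>x\<in>carrier F. \<phi> x = y i"
    using y surj by (metis imageE lessThan_iff)
  then obtain a where a: "\<And>i. i < n \<Longrightarrow> a i \<in> carrier F" "\<And>i. i < n \<Longrightarrow> \<phi> (a i) = y i"
    by (metis lessThan_iff)
  let ?u = "ordered_product F n a"
  have u: "?u \<in> carrier F" using a(1) by (rule G.ordered_product_closed)
  have "\<phi> ?u = ordered_product G n (\<lambda>i. \<phi> (a i))"
    using a(1) by (rule hom_ordered_product)
  also have "\<dots> = ordered_product G n y" using a(2) by (rule ordered_product_cong)
  also have "\<dots> \<in> derived G (\<phi> ` carrier F)" using assms(2) by (simp add: H.K_set_iff surj)
  also have "\<dots> = \<phi> ` derived F (carrier F)" by (rule derived_img) simp
  finally obtain d where d: "d \<in> derived F (carrier F)" "\<phi> ?u = \<phi> d" by blast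
  have dF: "d \<in> carrier F" using d(1) G.derived_in_carrier[OF order_refl] by blast
  let ?c = "d \<otimes>\<^bsub>F\<^esub> inv\<^bsub>F\<^esub> ?u"
  let ?a = "\<lambda>i. if i = 0 then ?c \<otimes>\<^bsub>F\<^esub> a 0 else a i"
  have c: "?c \<in> carrier F" "\<phi> ?c = \<one>\<^bsub>G\<^esub>" using u dF d(2) by auto
  have "ordered_product F n ?a = ?c \<otimes>\<^bsub>F\<^esub> ?u"
    using assms(1) c(1) a(1) by (rule G.ordered_product_multiply_first)
  also have "\<dots> = d" using u dF by (simp add: G.m_assoc)
  finally have "restrict ?a {..<n} \<in> K_set F n"
    using d(1) a(1) c(1) by (auto simp: G.K_set_iff)
  moreover have "(\<lambda>i\<in>{..<n}. \<phi> (restrict ?a {..<n} i)) = y"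
  proof
    fix i show "(\<lambda>i\<in>{..<n}. \<phi> (restrict ?a {..<n} i)) i = y i"
      using a[of i] y[of i] c assms(2) by (cases "i < n") (auto simp: H.K_set_iff PiE_def extensional_def)
  qed
  ultimately show ?thesis by (rule that)
qed

text \<open>With three components, \<open>([x,y], 1, 1)\<close> is the commutator of \<open>(x, x\<^sup>-\<^sup>1, 1)\<close> and
  \<open>(y, 1, y\<^sup>-\<^sup>1)\<close>, both in \<open>\<K>(F,n)\<close>: the compensating entries sit in different positions and do not
  interact.\<close>
lemma first_slot_in_derived:
  assumes n: "n \<ge> 3" and c: "c \<in> derived F (carrier F)"
  shows "two_slots F n 1 c \<one>\<^bsub>F\<^esub> \<in> derived (K_group F n) (K_set F n)"
proof -
  let ?D = "derived (power_group F n) (K_set F n)"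
  interpret P: group "power_group F n" by (rule G.group_power)
  interpret s: group_hom F "power_group F n" "\<lambda>x. two_slots F n 1 x \<one>\<^bsub>F\<^esub>"
    by (rule group_homI[OF G.is_group G.group_power G.two_slots_hom])
  have K: "subgroup (K_set F n) (power_group F n)" by (rule G.subgroup_K_set)
  have D: "subgroup ?D (power_group F n)"
    by (rule P.derived_is_subgroup[OF subgroup.subset[OF K]])
  have one: "\<one>\<^bsub>F\<^esub> \<in> derived F (carrier F)"
    using subgroup.one_closed[OF G.derived_is_subgroup[OF order_refl]] .
  have slots_K: "two_slots F n j x (inv\<^bsub>F\<^esub> x) \<in> K_set F n" if "x \<in> carrier F" "0 < j" "j < n" for j x
    using that one G.two_slots_in[OF G.subgroup_self that(1), of "inv\<^bsub>F\<^esub> x" n j]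
    by (simp add: G.K_set_iff G.ordered_product_two_slots)
  have inv_slots: "inv\<^bsub>power_group F n\<^esub> two_slots F n j x (inv\<^bsub>F\<^esub> x) = two_slots F n j (inv\<^bsub>F\<^esub> x) x"
    if "x \<in> carrier F" for j x
  proof (rule P.inv_equality)
    show "two_slots F n j (inv\<^bsub>F\<^esub> x) x \<otimes>\<^bsub>power_group F n\<^esub> two_slots F n j x (inv\<^bsub>F\<^esub> x)
        = \<one>\<^bsub>power_group F n\<^esub>"
      using that by (subst G.two_slots_mult) (auto simp: two_slots_def fun_eq_iff)
  qed (use G.two_slots_in[OF G.subgroup_self] that in simp_all)
  have "derived F (carrier F) \<subseteq> {x \<in> carrier F. two_slots F n 1 x \<one>\<^bsub>F\<^esub> \<in> ?D}"
    unfolding derived_def[of F]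
  proof (rule G.generate_subgroup_incl[OF _ s.subgroup_preimage[OF D]], clarify)
    fix x y assume x: "x \<in> carrier F" and y: "y \<in> carrier F"
    let ?u = "two_slots F n 1 x (inv\<^bsub>F\<^esub> x)" and ?v = "two_slots F n 2 y (inv\<^bsub>F\<^esub> y)"
    have "?u \<in> K_set F n" "?v \<in> K_set F n" using slots_K x y n by auto
    then have "?u \<otimes>\<^bsub>power_group F n\<^esub> ?v \<otimes>\<^bsub>power_group F n\<^esub> inv\<^bsub>power_group F n\<^esub> ?u
        \<otimes>\<^bsub>power_group F n\<^esub> inv\<^bsub>power_group F n\<^esub> ?v \<in> ?D"
      unfolding derived_def by (intro generate.incl) blast
    also have "?u \<otimes>\<^bsub>power_group F n\<^esub> ?v \<otimes>\<^bsub>power_group F n\<^esub> inv\<^bsub>power_group F n\<^esub> ?u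
        \<otimes>\<^bsub>power_group F n\<^esub> inv\<^bsub>power_group F n\<^esub> ?v
        = two_slots F n 1 (x \<otimes>\<^bsub>F\<^esub> y \<otimes>\<^bsub>F\<^esub> inv\<^bsub>F\<^esub> x \<otimes>\<^bsub>F\<^esub> inv\<^bsub>F\<^esub> y) \<one>\<^bsub>F\<^esub>"
      unfolding inv_slots[OF x] inv_slots[OF y]
      using x y by (auto simp: two_slots_def fun_eq_iff)
    finally show "x \<otimes>\<^bsub>F\<^esub> y \<otimes>\<^bsub>F\<^esub> inv\<^bsub>F\<^esub> x \<otimes>\<^bsub>F\<^esub> inv\<^bsub>F\<^esub> y \<in> carrier F
        \<and> two_slots F n 1 (x \<otimes>\<^bsub>F\<^esub> y \<otimes>\<^bsub>F\<^esub> inv\<^bsub>F\<^esub> x \<otimes>\<^bsub>F\<^esub> inv\<^bsub>F\<^esub> y) \<one>\<^bsub>F\<^esub> \<in> ?D"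
      using x y by simp
  qed
  then show ?thesis
    using c P.derived_consistent[OF order_refl K] by (auto simp: K_group_def)
qed

text \<open>By Hopf's formula, \<open>\<iota>\<close> may be defined as sending the class of \<open>c \<in> N \<inter> [F,F]\<close> to the coset of
  \<open>(c, 1, \<dots>, 1)\<close>. It is well defined and injective since this tuple is in \<open>L\<close> exactly for
  \<open>c \<in> M\<close>; \<open>\<pi>\<close> is induced by applying \<open>\<phi>\<close> to the components.\<close>
theorem K_tilde_central_extension:
  assumes "free_basis F S" and n: "n \<ge> 2"
  obtains \<iota> \<pi> where
    "central_short_exact_sequence (group_homology G 2) (K_tilde F N n) (K_group G n) \<iota> \<pi>"
    "n \<ge> 3 \<Longrightarrow> \<iota> ` carrier (group_homology G 2) \<subseteq> derived (K_tilde F N n) (carrier (K_tilde F N n))"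
proof -
  let ?D = "N \<inter> derived F (carrier F)"
  let ?K = "K_group F n Mod L n"
  let ?s = "\<lambda>x. two_slots F n 1 x \<one>\<^bsub>F\<^esub>"
  let ?\<Phi> = "\<lambda>a. \<lambda>i\<in>{..<n}. \<phi> (a i)"
  interpret L: normal "L n" "K_group F n" by (rule normal_L_K_group)
  interpret kl: group_hom "K_group F n" ?K "kl n" by (rule kl_hom)
  interpret s: group_hom "F\<lparr>carrier := ?D\<rparr>" "K_group F n" ?s by (rule first_slot_hom[OF n])
  interpret Phi: group_hom "K_group F n" "K_group G n" ?\<Phi>
    by (rule group_homI[OF G.group_K_group H.group_K_group K_group_hom])
  obtain \<omega> where \<omega>: "\<omega> \<in> hom (F\<lparr>carrier := ?D\<rparr>) (group_homology G 2)"
    "\<omega> ` ?D = carrier (group_homology G 2)"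
    "\<And>x. x \<in> ?D \<Longrightarrow> \<omega> x = \<one>\<^bsub>group_homology G 2\<^esub> \<longleftrightarrow> x \<in> M"
    using hopf_formula[OF assms(1)] by blast

  have mon1: "group_hom (F\<lparr>carrier := ?D\<rparr>) (group_homology G 2) \<omega>"
    by (rule group_homI[OF s.G.is_group H.group_homology_group \<omega>(1)])
  have mon2: "\<omega> ` carrier (F\<lparr>carrier := ?D\<rparr>) = carrier (group_homology G 2)"
    using \<omega>(2) by simp
  have mon3: "group_hom (F\<lparr>carrier := ?D\<rparr>) ?K (kl n \<circ> ?s)"
    by (rule group_homI[OF s.G.is_group kl.H.is_group Group.hom_compose[OF s.homh kl.homh]])
  have mon4: "\<omega> x = \<one>\<^bsub>group_homology G 2\<^esub> \<longleftrightarrow> (kl n \<circ> ?s) x = \<one>\<^bsub>?K\<^esub>"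
    if "x \<in> carrier (F\<lparr>carrier := ?D\<rparr>)" for x
    using \<omega>(3)[of x] first_slot_in_L_iff[OF n, of x] L.coset_eq_one_iff[OF s.hom_closed[OF that]] that
    by (simp only: comp_apply) simp
  obtain \<iota> where \<iota>: "\<iota> \<in> mon (group_homology G 2) ?K"
    and "\<And>x. x \<in> carrier (F\<lparr>carrier := ?D\<rparr>) \<Longrightarrow> \<iota> (\<omega> x) = (kl n \<circ> ?s) x"
    using mon_from_equal_kernels[OF mon1 mon2 mon3 mon4] by blast
  then have \<iota>\<omega>: "\<iota> (\<omega> x) = kl n (?s x)" if "x \<in> ?D" for x
    using that by simp
  have \<iota>_image: "\<iota> ` carrier (group_homology G 2) = (\<lambda>x. kl n (?s x)) ` ?D"
    using \<iota>\<omega> unfolding \<omega>(2)[symmetric] image_image by (rule image_cong[OF refl])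

  have \<Phi>_one: "?\<Phi> a = \<one>\<^bsub>K_group G n\<^esub> \<longleftrightarrow> a \<in> {..<n} \<rightarrow>\<^sub>E N" if "a \<in> K_set F n" for a
  proof -
    have "?\<Phi> a = \<one>\<^bsub>K_group G n\<^esub> \<longleftrightarrow> (\<forall>i<n. \<phi> (a i) = \<one>\<^bsub>G\<^esub>)"
      unfolding H.K_group_simps fun_eq_iff restrict_def by auto
    also have "\<dots> \<longleftrightarrow> a \<in> {..<n} \<rightarrow>\<^sub>E N"
      using that by (auto simp: G.K_set_iff N_iff PiE_iff)
    finally show ?thesis .
  qed
  have "L n \<subseteq> kernel (K_group F n) (K_group G n) ?\<Phi>"
    using L_subset_K_set \<Phi>_one by (auto simp: kernel_def L_def simp del: H.K_group_simps(3))
  then obtain \<pi> where \<pi>: "\<pi> \<in> hom ?K (K_group G n)"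
    and \<pi>kl: "\<And>a. a \<in> K_set F n \<Longrightarrow> \<pi> (kl n a) = ?\<Phi> a"
    using Phi.FactGroup_universal_kernel[OF normal_L_K_group] unfolding G.K_group_simps by blast
  have carrier_K: "carrier ?K = kl n ` K_set F n" by (simp add: carrier_FactGroup)
  have "\<pi> \<in> epi ?K (K_group G n)"
  proof -
    have "carrier (K_group G n) \<subseteq> \<pi> ` carrier ?K"
    proof
      fix y assume "y \<in> carrier (K_group G n)"
      then have "y \<in> K_set G n" by simp
      then obtain a where a: "a \<in> K_set F n" "?\<Phi> a = y"
        using K_group_map_surj[of n y] n by auto
      show "y \<in> \<pi> ` carrier ?K"
        unfolding carrier_K image_image
        by (rule image_eqI[OF _ a(1)]) (use \<pi>kl[OF a(1)] a(2) in simp)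
    qed
    then show ?thesis using \<pi> by (simp add: epi_iff_subset)
  qed
  moreover have "\<iota> ` carrier (group_homology G 2) = kernel ?K (K_group G n) \<pi>"
  proof
    show "\<iota> ` carrier (group_homology G 2) \<subseteq> kernel ?K (K_group G n) \<pi>"
    proof
      fix z assume "z \<in> \<iota> ` carrier (group_homology G 2)"
      then obtain x where x: "x \<in> ?D" "z = kl n (?s x)" unfolding \<iota>_image by blast
      have sK: "?s x \<in> K_set F n" using s.hom_closed[of x] x(1) by simp
      have "?s x \<in> {..<n} \<rightarrow>\<^sub>E N"
        using G.two_slots_in[OF N.subgroup_axioms _ N.one_closed] x(1) by blast
      then have "\<pi> z = \<one>\<^bsub>K_group G n\<^esub>" using \<Phi>_one[OF sK] \<pi>kl[OF sK] x(2) by metis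
      then show "z \<in> kernel ?K (K_group G n) \<pi>" using x(2) sK carrier_K by (simp add: kernel_def)
    qed
    show "kernel ?K (K_group G n) \<pi> \<subseteq> \<iota> ` carrier (group_homology G 2)"
    proof
      fix z assume "z \<in> kernel ?K (K_group G n) \<pi>"
      then obtain a where a: "a \<in> K_set F n" "z = kl n a" "\<pi> z = \<one>\<^bsub>K_group G n\<^esub>"
        unfolding kernel_def carrier_K by blast
      then have aN: "a \<in> {..<n} \<rightarrow>\<^sub>E N" using \<pi>kl[OF a(1)] \<Phi>_one[OF a(1)] by metis
      let ?c = "ordered_product F n a"
      from n aN obtain b where b: "b \<in> {..<n} \<rightarrow>\<^sub>E N" "ordered_product F n b = \<one>\<^bsub>F\<^esub>"
        "a = ?s ?c \<otimes>\<^bsub>power_group F n\<^esub> b" and c: "?c \<in> N"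
        by (rule split_first_slot)
      have cD: "?c \<in> ?D" using c a(1) by (simp add: G.K_set_iff)
      have bL: "b \<in> L n" using b(1,2) by (simp add: L_def)
      then have bK: "b \<in> carrier (K_group F n)" using L_subset_K_set by auto
      have sK: "?s ?c \<in> carrier (K_group F n)" using s.hom_closed cD by simp
      have "a = ?s ?c \<otimes>\<^bsub>K_group F n\<^esub> b" using b(3) by (simp add: K_group_def)
      then have "kl n a = kl n (?s ?c) \<otimes>\<^bsub>?K\<^esub> kl n b" using kl.hom_mult[OF sK bK] by metis
      also have "kl n b = \<one>\<^bsub>?K\<^esub>" using L.coset_eq_one_iff[OF bK] bL by blast
      also have "kl n (?s ?c) \<otimes>\<^bsub>?K\<^esub> \<one>\<^bsub>?K\<^esub> = kl n (?s ?c)" by (rule kl.H.r_one[OF kl.hom_closed[OF sK]])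
      finally show "z \<in> \<iota> ` carrier (group_homology G 2)"
        unfolding \<iota>_image a(2) using cD by blast
    qed
  qed
  moreover have "\<iota> z \<otimes>\<^bsub>?K\<^esub> w = w \<otimes>\<^bsub>?K\<^esub> \<iota> z"
    if "z \<in> carrier (group_homology G 2)" "w \<in> carrier ?K" for z w
  proof -
    have "\<iota> z \<in> (\<lambda>x. kl n (?s x)) ` ?D"
      unfolding \<iota>_image[symmetric] using that(1) by (rule imageI)
    then obtain x where x: "\<iota> z = kl n (?s x)" "x \<in> ?D" by (rule imageE)
    from that(2) obtain b where b: "w = kl n b" "b \<in> K_set F n"
      unfolding carrier_K by (rule imageE)
    have sK: "?s x \<in> carrier (K_group F n)" using s.hom_closed x(2) by simp
    have bK: "b \<in> carrier (K_group F n)" using b(2) by simp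
    show ?thesis
      unfolding x(1) b(1)
      using first_slot_central[OF n x(2) b(2)] kl.hom_mult[OF sK bK] kl.hom_mult[OF bK sK] by metis
  qed
  ultimately have "central_short_exact_sequence (group_homology G 2) ?K (K_group G n) \<iota> \<pi>"
    unfolding central_short_exact_sequence_def
    using H.group_homology_group kl.H.is_group H.group_K_group \<iota> by blast
  moreover have "\<iota> ` carrier (group_homology G 2) \<subseteq> derived ?K (carrier ?K)" if "n \<ge> 3"
  proof -
    have "derived ?K (carrier ?K) = kl n ` derived (K_group F n) (K_set F n)"
      unfolding carrier_K by (rule kl.derived_img) simp
    then show ?thesis unfolding \<iota>_image using first_slot_in_derived[OF that] by blast
  qed
  ultimately show ?thesis using that unfolding K_tilde_eq[OF n] by blast
qed

end

section \<open>Independence of the presentation\<close>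

lemma mixed_commutator_image:
  assumes "group_surjection F G \<phi>" "group_surjection F' G \<phi>'" "\<alpha> \<in> hom F F'"
    and over: "\<And>x. x \<in> carrier F \<Longrightarrow> \<phi>' (\<alpha> x) = \<phi> x"
    and "x \<in> group_surjection.M F G \<phi>"
  shows "\<alpha> x \<in> group_surjection.M F' G \<phi>'"
proof -
  interpret A: group_surjection F G \<phi> by fact
  interpret B: group_surjection F' G \<phi>' by fact
  interpret a: group_hom F F' \<alpha> by (rule group_homI[OF A.G.is_group B.G.is_group assms(3)])
  have "A.M \<subseteq> {x \<in> carrier F. \<alpha> x \<in> B.M}"
    unfolding A.M_def mixed_commutator_def
  proof (rule A.G.generate_subgroup_incl[OF _ a.subgroup_preimage[OF normal_imp_subgroup[OF B.normal_M]]], clarify)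
    fix x y assume x: "x \<in> carrier F" and y: "y \<in> A.N"
    then have yF: "y \<in> carrier F" by (rule_tac A.N_closed)
    have "\<alpha> y \<in> B.N" using y over[OF yF] yF by (simp add: A.N_iff B.N_iff)
    then have "\<alpha> x \<otimes>\<^bsub>F'\<^esub> \<alpha> y \<otimes>\<^bsub>F'\<^esub> inv\<^bsub>F'\<^esub> \<alpha> x \<otimes>\<^bsub>F'\<^esub> inv\<^bsub>F'\<^esub> \<alpha> y \<in> B.M"
      unfolding B.M_def using normal.mixed_commutator_incl[OF B.normal_N] a.hom_closed[OF x] by blast
    then show "x \<otimes>\<^bsub>F\<^esub> y \<otimes>\<^bsub>F\<^esub> inv\<^bsub>F\<^esub> x \<otimes>\<^bsub>F\<^esub> inv\<^bsub>F\<^esub> y \<in> carrier F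
        \<and> \<alpha> (x \<otimes>\<^bsub>F\<^esub> y \<otimes>\<^bsub>F\<^esub> inv\<^bsub>F\<^esub> x \<otimes>\<^bsub>F\<^esub> inv\<^bsub>F\<^esub> y) \<in> B.M"
      using x yF by simp
  qed
  then show ?thesis using assms(5) by blast
qed

text \<open>The agreement principle for \<open>\<gamma>\<close> and the identity, both followed by the projection to the central
  extension \<open>F/M\<close>.\<close>
lemma (in group_surjection) endo_over_base:
  assumes "\<gamma> \<in> hom F F" and over: "\<And>x. x \<in> carrier F \<Longrightarrow> \<phi> (\<gamma> x) = \<phi> x"
    and x: "x \<in> derived F (carrier F)"
  shows "cl (\<gamma> x) = cl x"
proof -
  obtain q where "central_extension R G q" and q: "\<And>x. x \<in> carrier F \<Longrightarrow> q (cl x) = \<phi> x"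
    using central_quotient by blast
  then interpret q: central_extension R G q by simp
  have cl: "cl \<in> hom F R" using cl_hom by (rule group_hom.homh)
  have "(cl \<circ> \<gamma>) x = cl x"
  proof (rule q.homs_agree_on_derived[OF G.is_group Group.hom_compose[OF assms(1) cl] cl _ x])
    show "q ((cl \<circ> \<gamma>) y) = q (cl y)" if "y \<in> carrier F" for y
      using q[OF hom_in_carrier[OF assms(1) that]] q[OF that] over[OF that] by simp
  qed
  then show ?thesis by simp
qed

text \<open>The lift \<open>\<alpha>\<close> induces the isomorphism. For the kernel: if \<open>\<alpha>\<close> maps the product \<open>p \<in> [F,F]\<close> of a
  tuple into \<open>[F',N']\<close>, then \<open>\<beta> (\<alpha> p) \<in> [F,N]\<close>, and \<open>\<beta> (\<alpha> p)\<close> agrees with \<open>p\<close> modulo \<open>[F,N]\<close>. For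
  surjectivity: \<open>\<alpha> \<circ> \<beta>\<close> alters the components of \<open>y \<in> \<K>(F',n)\<close> by factors from \<open>N'\<close>, whose product is
  trivial modulo \<open>[F',N']\<close> since that of \<open>y\<close> lies in \<open>[F',F']\<close>.\<close>
theorem K_tilde_independent:
  assumes A: "group_surjection F G \<phi>" and B: "group_surjection F' G \<phi>'"
    and S: "free_basis F S" and S': "free_basis F' S'" and n: "n \<ge> 2"
  shows "K_tilde F (group_surjection.N F G \<phi>) n \<cong> K_tilde F' (group_surjection.N F' G \<phi>') n"
proof -
  interpret A: group_surjection F G \<phi> by fact
  interpret B: group_surjection F' G \<phi>' by fact
  obtain \<alpha> where \<alpha>: "\<alpha> \<in> hom F F'" and \<alpha>o: "\<And>x. x \<in> carrier F \<Longrightarrow> \<phi>' (\<alpha> x) = \<phi> x"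
    using free_group_lift[OF A.G.is_group S A.homh B.G.is_group B.homh B.surj A.H.is_group] by blast
  obtain \<beta> where \<beta>: "\<beta> \<in> hom F' F" and \<beta>o: "\<And>x. x \<in> carrier F' \<Longrightarrow> \<phi> (\<beta> x) = \<phi>' x"
    using free_group_lift[OF B.G.is_group S' B.homh A.G.is_group A.homh A.surj A.H.is_group] by blast
  interpret a: group_hom F F' \<alpha> by (rule group_homI[OF A.G.is_group B.G.is_group \<alpha>])
  interpret b: group_hom F' F \<beta> by (rule group_homI[OF B.G.is_group A.G.is_group \<beta>])
  let ?K = "K_group F n" and ?K' = "K_group F' n Mod B.L n"
  let ?\<alpha> = "\<lambda>a. \<lambda>i\<in>{..<n}. \<alpha> (a i)" and ?\<beta> = "\<lambda>a. \<lambda>i\<in>{..<n}. \<beta> (a i)"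
  interpret L': normal "B.L n" "K_group F' n" by (rule B.normal_L_K_group)
  interpret kl: group_hom "K_group F' n" ?K' "B.kl n" by (rule B.kl_hom)
  interpret h: group_hom ?K ?K' "B.kl n \<circ> ?\<alpha>"
    by (rule group_homI[OF A.G.group_K_group kl.H.is_group Group.hom_compose[OF a.K_group_hom kl.homh]])
  have \<alpha>K: "?\<alpha> a \<in> K_set F' n" if "a \<in> K_set F n" for a
    using hom_in_carrier[OF a.K_group_hom, of a n] that by simp
  have \<beta>K: "?\<beta> a \<in> K_set F n" if "a \<in> K_set F' n" for a
    using hom_in_carrier[OF b.K_group_hom, of a n] that by simp

  have kernel: "kernel ?K ?K' (B.kl n \<circ> ?\<alpha>) = A.L n"
  proof -
    have "?\<alpha> a \<in> B.L n \<longleftrightarrow> a \<in> A.L n" if a: "a \<in> K_set F n" for a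
    proof -
      have ai: "a i \<in> carrier F" if "i < n" for i using a that by (auto simp: A.G.K_set_iff)
      have N: "\<alpha> (a i) \<in> B.N \<longleftrightarrow> a i \<in> A.N" if "i < n" for i
        using ai[OF that] \<alpha>o by (simp add: A.N_iff B.N_iff)
      let ?p = "ordered_product F n a"
      have p: "?p \<in> carrier F" "?p \<in> derived F (carrier F)"
        using a A.G.derived_in_carrier[of "carrier F"] by (auto simp: A.G.K_set_iff)
      have prod: "ordered_product F' n (?\<alpha> a) = \<alpha> ?p"
        using a.hom_ordered_product[of n a] ai by simp
      have "\<alpha> ?p \<in> B.M \<longleftrightarrow> ?p \<in> A.M"
      proof
        assume "\<alpha> ?p \<in> B.M"
        then have M: "\<beta> (\<alpha> ?p) \<in> A.M"
          using mixed_commutator_image[OF B A \<beta>] \<beta>o by blast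
        have "A.cl ((\<beta> \<circ> \<alpha>) ?p) = A.cl ?p"
          by (rule A.endo_over_base[OF Group.hom_compose[OF \<alpha> \<beta>] _ p(2)])
            (use \<alpha>o \<beta>o[OF a.hom_closed] in simp)
        then show "?p \<in> A.M"
          using M A.cl_eq_one[OF p(1)] A.cl_eq_one[OF b.hom_closed[OF a.hom_closed[OF p(1)]]]
          by (metis comp_apply)
      qed (rule mixed_commutator_image[OF A B \<alpha> \<alpha>o])
      moreover have "?\<alpha> a \<in> {..<n} \<rightarrow>\<^sub>E B.N \<longleftrightarrow> a \<in> {..<n} \<rightarrow>\<^sub>E A.N"
        using N a by (auto simp: PiE_iff A.G.K_set_iff)
      ultimately show ?thesis unfolding A.L_def B.L_def mem_Collect_eq prod by blast
    qed
    moreover have "(B.kl n \<circ> ?\<alpha>) a = \<one>\<^bsub>?K'\<^esub> \<longleftrightarrow> ?\<alpha> a \<in> B.L n" if "a \<in> K_set F n" for a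
      using L'.coset_eq_one_iff[of "?\<alpha> a"] \<alpha>K[OF that] by (simp only: comp_apply B.G.K_group_simps)
    ultimately show ?thesis
      using A.L_subset_K_set[of n] unfolding kernel_def A.G.K_group_simps by blast
  qed

  have "B.kl n (?\<alpha> (?\<beta> y)) = B.kl n y" if y: "y \<in> K_set F' n" for y
  proof -
    interpret cl: group_hom F' B.R B.cl by (rule B.cl_hom)
    have yi: "y i \<in> carrier F'" if "i < n" for i using y that by (auto simp: B.G.K_set_iff)
    let ?g = "\<lambda>x. \<alpha> (\<beta> x)"
    let ?z = "\<lambda>i\<in>{..<n}. ?g (y i) \<otimes>\<^bsub>F'\<^esub> inv\<^bsub>F'\<^esub> y i"
    have gi: "?g (y i) \<in> carrier F'" if "i < n" for i using yi[OF that] by simp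
    have zN: "?z i \<in> B.N" if "i < n" for i
      using yi[OF that] that \<alpha>o \<beta>o by (simp add: B.N_iff)
    have zi: "?z i \<in> carrier F'" if "i < n" for i by (rule B.N_closed[OF zN[OF that]])
    have zy: "?z i \<otimes>\<^bsub>F'\<^esub> y i = ?g (y i)" if "i < n" for i
      using that yi[OF that] gi[OF that] by (simp add: B.G.m_assoc)
    let ?p = "ordered_product F' n y"
    have p: "?p \<in> carrier F'" "?p \<in> derived F' (carrier F')"
      using y B.G.derived_in_carrier[of "carrier F'"] by (auto simp: B.G.K_set_iff)
    have clz: "B.cl (?z i) \<in> carrier B.R" and cly: "B.cl (y i) \<in> carrier B.R" if "i < n" for i
      using cl.hom_closed zi[OF that] yi[OF that] by blast+
    have "ordered_product B.R n (\<lambda>i. B.cl (?z i)) \<otimes>\<^bsub>B.R\<^esub> ordered_product B.R n (\<lambda>i. B.cl (y i))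
        = ordered_product B.R n (\<lambda>i. B.cl (?z i) \<otimes>\<^bsub>B.R\<^esub> B.cl (y i))"
      by (rule cl.H.ordered_product_mult_central[symmetric])
        (fact clz cly B.cl_central[OF zN])+
    also have "\<dots> = ordered_product B.R n (\<lambda>i. B.cl (?g (y i)))"
      by (rule ordered_product_cong) (simp only: cl.hom_mult[symmetric] zi yi zy)
    also have "\<dots> = B.cl (?g ?p)"
    proof -
      have "\<beta> ?p = ordered_product F n (\<lambda>i. \<beta> (y i))"
        by (rule b.hom_ordered_product) (rule yi)
      then have "?g ?p = ordered_product F' n (\<lambda>i. ?g (y i))"
        using a.hom_ordered_product[of n "\<lambda>i. \<beta> (y i)"] yi by simp
      then show ?thesis
        using cl.hom_ordered_product[of n "\<lambda>i. ?g (y i)"] gi by simp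
    qed
    also have "\<dots> = B.cl ((\<alpha> \<circ> \<beta>) ?p)" by simp
    also have "\<dots> = B.cl ?p"
      by (rule B.endo_over_base[OF Group.hom_compose[OF \<beta> \<alpha>] _ p(2)])
        (use \<alpha>o[OF b.hom_closed] \<beta>o in simp)
    also have "\<dots> = ordered_product B.R n (\<lambda>i. B.cl (y i))"
      by (rule cl.hom_ordered_product) (rule yi)
    finally have "ordered_product B.R n (\<lambda>i. B.cl (?z i)) = \<one>\<^bsub>B.R\<^esub>"
      using cl.H.r_cancel_one cl.H.ordered_product_closed[of n "\<lambda>i. B.cl (?z i)"]
        cl.H.ordered_product_closed[of n "\<lambda>i. B.cl (y i)"] clz cly by blast
    then have "ordered_product F' n ?z \<in> B.M"
      using B.ordered_product_in_M_iff[of n ?z] zi by blast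
    then have z: "?z \<in> B.L n" using zN by (auto simp: B.L_def)
    have "?\<alpha> (?\<beta> y) = ?z \<otimes>\<^bsub>K_group F' n\<^esub> y"
      using zy by (auto simp: fun_eq_iff)
    then show ?thesis using B.kl_absorb[OF z y] by simp
  qed
  note \<alpha>\<beta> = this
  have "carrier ?K' \<subseteq> (B.kl n \<circ> ?\<alpha>) ` carrier ?K"
  proof
    fix z assume "z \<in> carrier ?K'"
    then obtain y where y: "y \<in> K_set F' n" "z = B.kl n y"
      unfolding carrier_FactGroup B.G.K_group_simps by blast
    show "z \<in> (B.kl n \<circ> ?\<alpha>) ` carrier ?K"
      by (rule image_eqI[of _ _ "?\<beta> y"]) (simp_all only: comp_apply \<alpha>\<beta>[OF y(1)] y(2) A.G.K_group_simps \<beta>K[OF y(1)])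
  qed
  then have "(B.kl n \<circ> ?\<alpha>) ` carrier ?K = carrier ?K'"
    using h.hom_closed by blast
  then have "?K Mod A.L n \<cong> ?K'" using h.FactGroup_iso unfolding kernel by blast
  then show ?thesis by (simp add: A.K_tilde_eq[OF n] B.K_tilde_eq[OF n])
qed

lemma presentation_surjection:
  assumes "group G" "presentation G F N"
  obtains \<phi> S where "group_surjection F G \<phi>" "free_basis F S" "group_surjection.N F G \<phi> = N"
proof -
  interpret N: normal N F using assms(2) by (simp add: presentation_def)
  obtain S where S: "free_basis F S" using assms(2) by (auto simp: presentation_def free_group_def)
  obtain \<psi> where \<psi>: "\<psi> \<in> iso (F Mod N) G"
    using assms(2) by (auto simp: presentation_def is_iso_def)
  interpret q: group_hom F "F Mod N" "\<lambda>x. N #>\<^bsub>F\<^esub> x" by (rule N.group_hom_coset)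
  interpret \<psi>: group_hom "F Mod N" G \<psi>
    using \<psi> by (intro group_homI N.factorgroup_is_group assms(1)) (simp add: iso_def)
  let ?\<phi> = "\<psi> \<circ> (\<lambda>x. N #>\<^bsub>F\<^esub> x)"
  have surj: "\<psi> ` carrier (F Mod N) = carrier G" and inj: "inj_on \<psi> (carrier (F Mod N))"
    using \<psi> by (auto simp: iso_def bij_betw_def)
  have "group_hom F G ?\<phi>"
    by (rule group_homI[OF N.is_group assms(1) Group.hom_compose[OF q.homh \<psi>.homh]])
  then have gs: "group_surjection F G ?\<phi>"
    using surj by (intro group_surjection.intro group_surjection_axioms.intro)
      (simp_all add: carrier_FactGroup image_comp)
  then interpret s: group_surjection F G ?\<phi> .
  have "x \<in> s.N \<longleftrightarrow> x \<in> N" for x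
  proof (cases "x \<in> carrier F")
    case True
    have "\<psi> (N #>\<^bsub>F\<^esub> x) = \<one>\<^bsub>G\<^esub> \<longleftrightarrow> N #>\<^bsub>F\<^esub> x = \<one>\<^bsub>F Mod N\<^esub>"
      using inj_on_eq_iff[OF inj q.hom_closed[OF True] q.H.one_closed] \<psi>.hom_one by simp
    then show ?thesis using True N.coset_eq_one_iff[OF True] by (simp add: s.N_iff)
  qed (use N.subset in \<open>auto simp: s.N_iff\<close>)
  then show ?thesis using that[OF gs S] by blast
qed

theorem theorem2p2:
  fixes G :: "'a monoid"
    and F :: "'b monoid" and N :: "'b set"
    and F' :: "'c monoid" and N' :: "'c set"
    and n :: nat
  assumes "group G" and "n \<ge> 2"
    and "presentation G F N" and "presentation G F' N'"
  shows "K_tilde F N n \<cong> K_tilde F' N' n \<and>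
    (\<exists>\<iota> \<pi>. central_short_exact_sequence (group_homology G 2) (K_tilde F N n) (K_group G n) \<iota> \<pi> \<and>
      (n \<ge> 3 \<longrightarrow>
        \<iota> ` carrier (group_homology G 2) \<subseteq> derived (K_tilde F N n) (carrier (K_tilde F N n))))"
proof -
  obtain \<phi> S where \<phi>: "group_surjection F G \<phi>" "free_basis F S" "group_surjection.N F G \<phi> = N"
    by (rule presentation_surjection[OF assms(1,3)])
  obtain \<phi>' S' where \<phi>': "group_surjection F' G \<phi>'" "free_basis F' S'"
    "group_surjection.N F' G \<phi>' = N'"
    by (rule presentation_surjection[OF assms(1,4)])
  have "K_tilde F N n \<cong> K_tilde F' N' n"
    using K_tilde_independent[OF \<phi>(1) \<phi>'(1) \<phi>(2) \<phi>'(2) assms(2)] \<phi>(3) \<phi>'(3) by simp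
  moreover obtain \<iota> \<pi> where
    "central_short_exact_sequence (group_homology G 2) (K_tilde F N n) (K_group G n) \<iota> \<pi>"
    "n \<ge> 3 \<Longrightarrow> \<iota> ` carrier (group_homology G 2) \<subseteq> derived (K_tilde F N n) (carrier (K_tilde F N n))"
    using group_surjection.K_tilde_central_extension[OF \<phi>(1,2) assms(2)] unfolding \<phi>(3) by blast
  ultimately show ?thesis by blast
qed

end
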